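(* Let $k$ be a field of characteristic $\neq 2$ and $A$ a Hopf algebra over $k$. Then there exists a bijection between the set of all crossed systems of Hopf algebras $(A, H_4, \triangleright, f)$ and the set $\mathcal{Z}\mathcal{P}(A)$ of all central primitive elements of $A$ such that the crossed system $(A, H_4, \triangleright, f)$ corresponding to $a \in \mathcal{Z}\mathcal{P}(A)$ is given as follows: the action $\triangleright : H_4 \otimes A \to A$ is the trivial action $h \triangleright b = \varepsilon(h) \, b$, for any $h \in H_4$, $b \in A$, and the cocycle $f = f_a : H_4 \otimes H_4 \to A$ is given by the following table (the entry in the row of $s$ and the column of $t$ is $f(s,t)$): $$\begin{array}{c|cccc} f & 1 & g & x & gx \\ \hline 1 & 1 & 1 & 0 & 0 \\ g & 1 & 1 & 0 & 0 \\ x & 0 & 0 & a & -a \\ gx & 0 & 0 & a & -a \end{array}$$ In particular, if $\mathcal{Z}\mathcal{P}(A) = \{0\}$, then there are no nontrivial crossed systems of Hopf algebras $(A, H_4, \triangleright, f)$ and thus the only crossed product $A \#^{\triangleright}_{f} H_4$ is the usual tensor product $A \otimes H_4$ of Hopf algebras, that is, $\mathcal{H}^{2}(H_4, A) \cong \mathrm{Crp}(H_4, A) = \{ A \otimes H_4 \}$ (both are one-element sets).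
   Context: $H_4$ is Sweedler's 4-dimensional Hopf algebra over $k$, with basis $\{1,g,x,gx\}$, relations $g^2=1$, $x^2=0$, $xg=-gx$, and $\Delta(g)=g\otimes g$, $\Delta(x)=x\otimes 1+g\otimes x$, $\varepsilon(g)=1$, $\varepsilon(x)=0$. $\mathcal{Z}\mathcal{P}(A)=P(A)\cap Z(A)$, where $P(A)=\{z\in A\mid \Delta(z)=z\otimes 1+1\otimes z\}$ and $Z(A)$ is the center of $A$. Sweedler notation is used. For Hopf algebras $A$, $H$, a weak action of $H$ on $A$ is a $k$-linear map $\triangleright: H\otimes A\to A$ with $h\triangleright 1_A=\varepsilon_H(h)1_A$, $1_H\triangleright a=a$, and $h\triangleright(ab)=(h_{(1)}\triangleright a)(h_{(2)}\triangleright b)$. Given a weak action $\triangleright$ and a $k$-linear map $f:H\otimes H\to A$ (write $f(g,h)=f(g\otimes h)$), $A\#_f^{\triangleright}H$ denotes the vector space $A\otimes H$ (write $a\#h$ for $a\otimes h$) with multiplication $(a\#h)\cdot(c\#g):=a(h_{(1)}\triangleright c)f(h_{(2)},g_{(1)})\#h_{(3)}g_{(2)}$. $(A,H,\triangleright,f)$ is a crossed system of Hopf algebras, and $A\#_f^{\triangleright}H$ a crossed product of Hopf algebras, if $A\#_f^{\triangleright}H$ is a Hopf algebra with this multiplication, unit $1_A\#1_H$ and the tensor product coalgebra structure. $\mathrm{Crp}(H,A)$ is the set of Hopf algebra isomorphism types of all crossed products $A\#_f^{\triangleright}H$. Let $\mathcal{CS}(A,H)$ be the set of pairs $(\triangleright,f)$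 such that $(A,H,\triangleright,f)$ is a crossed system of Hopf algebras. Put $(\triangleright,f)\approx(\triangleright',f')$ if there is a unitary cocentral map $r:H\to A$ (a coalgebra map with $r(1)=1$ and $r(h_{(1)})\otimes h_{(2)}=r(h_{(2)})\otimes h_{(1)}$ for all $h$) such that $h\triangleright' a=r(h_{(1)})(h_{(2)}\triangleright a)(S_A\circ r)(h_{(3)})$ and $f'(h,g)=r(h_{(1)})\bigl(h_{(2)}\triangleright r(g_{(1)})\bigr)f(h_{(3)},g_{(2)})(S_A\circ r)(h_{(4)}g_{(3)})$ for all $a\in A$, $h,g\in H$. This is an equivalence relation, and $\mathcal{H}^2(H,A):=\mathcal{CS}(A,H)/\approx$. *)

theory Defs
  imports Complex_Main "HOL-Library.FuncSet" "HOL-Library.Function_Algebras"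
begin

section \<open>Vector spaces over a field and their tensor product\<close>

text \<open>
  A vector space is a subspace \<open>vcarrier V\<close> of an ambient vector space given by a type of class
  \<^class>\<open>ab_group_add\<close> and a scalar multiplication. Carriers are needed because the tensor product
  below is a proper subspace of its ambient type.
\<close>

record ('k, 'v) vspace =
  vcarrier :: "'v set"
  vscale :: "'k \<Rightarrow> 'v \<Rightarrow> 'v"

definition kspace :: "('k::field, 'v::ab_group_add, 'm) vspace_scheme \<Rightarrow> bool" where
  "kspace V \<longleftrightarrow> vector_space (vscale V) \<and> module.subspace (vscale V) (vcarrier V)"

definition base_field :: "('k::field, 'k) vspace" where
  "base_field = \<lparr>vcarrier = UNIV, vscale = (*)\<rparr>"

definition klinear :: "('k::field, 'v::ab_group_add, 'm) vspace_scheme \<Rightarrow>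
    ('k, 'w::ab_group_add, 'n) vspace_scheme \<Rightarrow> ('v \<Rightarrow> 'w) \<Rightarrow> bool" where
  "klinear V W f \<longleftrightarrow>
     f \<in> vcarrier V \<rightarrow> vcarrier W \<and>
     (\<forall>x\<in>vcarrier V. \<forall>y\<in>vcarrier V. f (x + y) = f x + f y) \<and>
     (\<forall>c. \<forall>x\<in>vcarrier V. f (vscale V c x) = vscale W c (f x))"

definition kbilinear :: "('k::field, 'u::ab_group_add, 'l) vspace_scheme \<Rightarrow>
    ('k, 'v::ab_group_add, 'm) vspace_scheme \<Rightarrow>
    ('k, 'w::ab_group_add, 'n) vspace_scheme \<Rightarrow> ('u \<Rightarrow> 'v \<Rightarrow> 'w) \<Rightarrow> bool" where
  "kbilinear U V W f \<longleftrightarrow>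
     (\<forall>x\<in>vcarrier U. klinear V W (f x)) \<and> (\<forall>y\<in>vcarrier V. klinear U W (\<lambda>x. f x y))"

text \<open>
  The tensor product of \<open>U\<close> and \<open>V\<close> is realised inside the dual of the space of bilinear forms on
  \<open>U\<close> and \<open>V\<close>: the pure tensor of \<open>x\<close> and \<open>y\<close> is evaluation of bilinear forms at \<open>(x, y)\<close>, and the
  tensor product is the span of the pure tensors. Over a field this has the universal
  property of the tensor product; see \<open>tensor_lift_sum\<close> and \<open>tensor_lift_universal\<close> below.
\<close>

type_synonym ('k, 'u, 'v) tensor = "('u \<Rightarrow> 'v \<Rightarrow> 'k) \<Rightarrow> 'k"

definition tens :: "'u \<Rightarrow> ('k::field, 'u::ab_group_add, 'm) vspace_scheme \<Rightarrow>
    ('k, 'v::ab_group_add, 'n) vspace_scheme \<Rightarrow> 'v \<Rightarrow> ('k, 'u, 'v) tensor"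
    ("_ \<otimes>\<^bsub>_,_\<^esub> _" [71, 0, 0, 72] 71) where
  "x \<otimes>\<^bsub>U,V\<^esub> y = (\<lambda>\<beta>. if kbilinear U V base_field \<beta> then \<beta> x y else 0)"

definition tensor_space :: "('k::field, 'u::ab_group_add, 'm) vspace_scheme \<Rightarrow>
    ('k, 'v::ab_group_add, 'n) vspace_scheme \<Rightarrow> ('k, ('k, 'u, 'v) tensor) vspace" where
  "tensor_space U V =
     (let scale = (\<lambda>c t \<beta>. c * t \<beta>) in
      \<lparr>vcarrier = module.span scale {x \<otimes>\<^bsub>U,V\<^esub> y | x y. x \<in> vcarrier U \<and> y \<in> vcarrier V},
       vscale = scale\<rparr>)"

text \<open>
  \<open>tensor_lift U V F t\<close> is the value at \<open>t\<close> of the linear map on the tensor product that is induced by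
  the bilinear map \<open>F\<close>.
\<close>

definition tensor_lift :: "('k::field, 'u::ab_group_add, 'm) vspace_scheme \<Rightarrow>
    ('k, 'v::ab_group_add, 'n) vspace_scheme \<Rightarrow> ('u \<Rightarrow> 'v \<Rightarrow> 'w::ab_group_add) \<Rightarrow>
    ('k, 'u, 'v) tensor \<Rightarrow> 'w" where
  "tensor_lift U V F t =
     (THE w. \<exists>(n::nat) x y. (\<forall>i<n. x i \<in> vcarrier U \<and> y i \<in> vcarrier V) \<and>
        t = (\<Sum>i<n. x i \<otimes>\<^bsub>U,V\<^esub> y i) \<and> w = (\<Sum>i<n. F (x i) (y i)))"

definition tensor_lift2 :: "('k::field, 'u::ab_group_add, 'm) vspace_scheme \<Rightarrow>
    ('k, 'v::ab_group_add, 'n) vspace_scheme \<Rightarrow>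
    ('u \<Rightarrow> 'v \<Rightarrow> 'u \<Rightarrow> 'v \<Rightarrow> 'w::ab_group_add) \<Rightarrow>
    ('k, 'u, 'v) tensor \<Rightarrow> ('k, 'u, 'v) tensor \<Rightarrow> 'w" where
  "tensor_lift2 U V F =
     (\<lambda>s\<in>vcarrier (tensor_space U V). \<lambda>t\<in>vcarrier (tensor_space U V).
        tensor_lift U V (\<lambda>x y. tensor_lift U V (F x y) t) s)"


subsection \<open>The universal property\<close>

lemma sum_fun_apply: "(\<Sum>i\<in>I. f i) x = (\<Sum>i\<in>I. f i x)"
  for f :: "'i \<Rightarrow> 'a \<Rightarrow> 'b::comm_monoid_add"
  by (induction I rule: infinite_finite_induct) auto

lemma vector_space_fun: "vector_space (\<lambda>(c::'k::field) (t::'a \<Rightarrow> 'k) \<beta>. c * t \<beta>)"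
  by unfold_locales (auto simp: fun_eq_iff algebra_simps)

lemma kspace_tensor_space:
  "kspace (tensor_space (U :: ('k::field, 'u::ab_group_add, 'm) vspace_scheme)
                        (V :: ('k, 'v::ab_group_add, 'n) vspace_scheme))"
  unfolding kspace_def tensor_space_def Let_def
  by (simp add: vector_space_fun module.subspace_span module_iff_vector_space)

lemma vscale_tensor_space: "vscale (tensor_space U V) c t = (\<lambda>\<beta>. c * t \<beta>)"
  by (simp add: tensor_space_def Let_def)

lemma klinear_in: "klinear V W f \<Longrightarrow> x \<in> vcarrier V \<Longrightarrow> f x \<in> vcarrier W"
  and klinear_add: "klinear V W f \<Longrightarrow> x \<in> vcarrier V \<Longrightarrow> y \<in> vcarrier V \<Longrightarrow> f (x + y) = f x + f y"
  and klinear_scale: "klinear V W f \<Longrightarrow> x \<in> vcarrier V \<Longrightarrow> f (vscale V c x) = vscale W c (f x)"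
  by (auto simp: klinear_def)

lemma kbilinearD:
  assumes "kbilinear U V W f" "x \<in> vcarrier U" "y \<in> vcarrier V"
  shows "f x y \<in> vcarrier W"
    and "x' \<in> vcarrier U \<Longrightarrow> f (x + x') y = f x y + f x' y"
    and "y' \<in> vcarrier V \<Longrightarrow> f x (y + y') = f x y + f x y'"
    and "f (vscale U c x) y = vscale W c (f x y)"
    and "f x (vscale V c y) = vscale W c (f x y)"
  using assms by (auto simp: kbilinear_def klinear_def)

lemma kbilinear_tens: "kbilinear U V (tensor_space U V) (\<lambda>x y. x \<otimes>\<^bsub>U,V\<^esub> y)"
proof -
  have closed: "x \<otimes>\<^bsub>U,V\<^esub> y \<in> vcarrier (tensor_space U V)"
    if "x \<in> vcarrier U" "y \<in> vcarrier V" for x y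
  proof -
    have "x \<otimes>\<^bsub>U,V\<^esub> y \<in> {x \<otimes>\<^bsub>U,V\<^esub> y | x y. x \<in> vcarrier U \<and> y \<in> vcarrier V}"
      using that by blast
    then show ?thesis
      unfolding tensor_space_def Let_def vspace.simps
      by (rule module.span_base[OF vector_space_fun[folded module_iff_vector_space]])
  qed
  have add: "(x + x') \<otimes>\<^bsub>U,V\<^esub> y = x \<otimes>\<^bsub>U,V\<^esub> y + x' \<otimes>\<^bsub>U,V\<^esub> y"
      "x \<otimes>\<^bsub>U,V\<^esub> (y + y') = x \<otimes>\<^bsub>U,V\<^esub> y + x \<otimes>\<^bsub>U,V\<^esub> y'"
    if "x \<in> vcarrier U" "x' \<in> vcarrier U" "y \<in> vcarrier V" "y' \<in> vcarrier V" for x x' y y'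
    unfolding tens_def plus_fun_def
    using kbilinearD(2,3)[of U V base_field, OF _ that(1,3)] that(2,4) by (intro ext, simp)+
  have scale: "vscale U c x \<otimes>\<^bsub>U,V\<^esub> y = vscale (tensor_space U V) c (x \<otimes>\<^bsub>U,V\<^esub> y)"
      "x \<otimes>\<^bsub>U,V\<^esub> vscale V c y = vscale (tensor_space U V) c (x \<otimes>\<^bsub>U,V\<^esub> y)"
    if "x \<in> vcarrier U" "y \<in> vcarrier V" for x y c
    unfolding tens_def vscale_tensor_space
    using kbilinearD(4,5)[of U V base_field, OF _ that] by (intro ext, simp add: base_field_def)+
  show ?thesis
    unfolding kbilinear_def[of _ _ "tensor_space U V"] klinear_def
    by (intro conjI ballI allI Pi_I closed add scale)
qed

lemma tensor_space_sum:
  assumes U: "kspace U" and t: "t \<in> vcarrier (tensor_space U V)"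
  obtains n :: nat and x y where
    "\<forall>i<n. x i \<in> vcarrier U \<and> y i \<in> vcarrier V" "t = (\<Sum>i<n. x i \<otimes>\<^bsub>U,V\<^esub> y i)"
proof -
  let ?S = "{x \<otimes>\<^bsub>U,V\<^esub> y | x y. x \<in> vcarrier U \<and> y \<in> vcarrier V}"
  let ?P = "\<lambda>t. \<exists>(n::nat) x y. (\<forall>i<n. x i \<in> vcarrier U \<and> y i \<in> vcarrier V) \<and>
      t = (\<Sum>i<n. x i \<otimes>\<^bsub>U,V\<^esub> y i)"
  have m: "module (\<lambda>(c::'a) (t::('a, 'b, 'd) tensor) \<beta>. c * t \<beta>)"
    by (simp add: vector_space_fun module_iff_vector_space)
  have mU: "module (vscale U)" and sU: "module.subspace (vscale U) (vcarrier U)"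
    using U by (auto simp: kspace_def module_iff_vector_space)
  have "t \<in> module.span (\<lambda>c t \<beta>. c * t \<beta>) ?S"
    using t by (simp add: tensor_space_def Let_def)
  then have "?P t"
  proof (induction rule: module.span_induct_alt[OF m, consumes 1])
    case 1
    show ?case by (rule exI[of _ 0]) simp
  next
    case (2 c s t)
    from 2(2) obtain n :: nat and x y where
      n: "\<forall>i<n. x i \<in> vcarrier U \<and> y i \<in> vcarrier V" "t = (\<Sum>i<n. x i \<otimes>\<^bsub>U,V\<^esub> y i)"
      by blast
    from 2(1) obtain a b where ab: "s = a \<otimes>\<^bsub>U,V\<^esub> b" "a \<in> vcarrier U" "b \<in> vcarrier V" by blast
    have s: "(\<lambda>\<beta>. c * s \<beta>) = vscale U c a \<otimes>\<^bsub>U,V\<^esub> b"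
      using kbilinearD(4)[OF kbilinear_tens ab(2,3), of c] ab(1)
      by (simp add: vscale_tensor_space)
    have "vscale U c a \<in> vcarrier U"
      using module.subspace_scale[OF mU sU ab(2)] .
    moreover have "(\<lambda>\<beta>. c * s \<beta>) + t =
        (\<Sum>i<Suc n. (x(n := vscale U c a)) i \<otimes>\<^bsub>U,V\<^esub> (y(n := b)) i)"
      unfolding s n(2) sum.lessThan_Suc add.commute[of "vscale U c a \<otimes>\<^bsub>U,V\<^esub> b"]
      by (intro arg_cong2[where f = "(+)"] sum.cong) auto
    ultimately show ?case
      using n(1) ab(3)
      by (intro exI[of _ "Suc n"] exI[of _ "x(n := vscale U c a)"] exI[of _ "y(n := b)"])
         (simp add: less_Suc_eq)
  qed
  then show ?thesis using that by blast
qed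

lemma exists_functional:
  assumes "vector_space s" "w \<noteq> 0"
  obtains \<phi> where "Vector_Spaces.linear s ((*) :: 'k::field \<Rightarrow> 'k \<Rightarrow> 'k) \<phi>" "\<phi> w \<noteq> 0"
proof -
  interpret vs1: vector_space s by fact
  interpret k: vector_space "(*) :: 'k \<Rightarrow> 'k \<Rightarrow> 'k" by unfold_locales (auto simp: algebra_simps)
  interpret vector_space_pair s "(*) :: 'k \<Rightarrow> 'k \<Rightarrow> 'k" ..
  have i: "vs1.independent {w}" using assms(2) by simp
  show ?thesis
    by (rule that[OF linear_construct[OF i, of "\<lambda>_. 1"]]) (simp add: construct_basis[OF i])
qed

lemma tensor_lift_sum:
  fixes n :: nat
  assumes U: "kspace U" and V: "kspace V" and W: "kspace W" and F: "kbilinear U V W F"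
    and x: "\<forall>i<n. x i \<in> vcarrier U \<and> y i \<in> vcarrier V"
  shows "tensor_lift U V F (\<Sum>i<n. x i \<otimes>\<^bsub>U,V\<^esub> y i) = (\<Sum>i<n. F (x i) (y i))"
proof -
  have eq: "(\<Sum>i<m. F (a i) (b i)) = (\<Sum>i<n. F (x i) (y i))"
    if a: "\<forall>i<m. a i \<in> vcarrier U \<and> b i \<in> vcarrier V"
      and t: "(\<Sum>i<n. x i \<otimes>\<^bsub>U,V\<^esub> y i) = (\<Sum>i<m. a i \<otimes>\<^bsub>U,V\<^esub> b i)" for m :: nat and a b
  proof (rule ccontr)
    assume "\<not> ?thesis"
    then have "(\<Sum>i<m. F (a i) (b i)) - (\<Sum>i<n. F (x i) (y i)) \<noteq> 0" by simp
    moreover have "vector_space (vscale W)"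
      using W by (simp add: kspace_def)
    ultimately obtain \<phi> where l: "Vector_Spaces.linear (vscale W) (*) \<phi>"
      and ne: "\<phi> ((\<Sum>i<m. F (a i) (b i)) - (\<Sum>i<n. F (x i) (y i))) \<noteq> 0"
      by (blast elim: exists_functional)
    interpret \<phi>: Vector_Spaces.linear "vscale W" "(*)" \<phi> by fact
    have b: "kbilinear U V base_field (\<lambda>u v. \<phi> (F u v))"
      unfolding kbilinear_def[of _ _ base_field] klinear_def
      by (simp add: base_field_def kbilinearD[OF F] \<phi>.add \<phi>.scale)
    have "(\<Sum>i<n. x i \<otimes>\<^bsub>U,V\<^esub> y i) (\<lambda>u v. \<phi> (F u v)) = (\<Sum>i<m. a i \<otimes>\<^bsub>U,V\<^esub> b i) (\<lambda>u v. \<phi> (F u v))"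
      by (rule arg_cong[OF t])
    then have "(\<Sum>i<n. \<phi> (F (x i) (y i))) = (\<Sum>i<m. \<phi> (F (a i) (b i)))"
      unfolding sum_fun_apply by (simp add: tens_def b)
    then show False
      using ne by (simp add: \<phi>.diff \<phi>.sum)
  qed
  show ?thesis
    unfolding tensor_lift_def
  proof (rule the_equality, goal_cases)
    case 1
    show ?case by (rule exI[of _ n], rule exI[of _ x], rule exI[of _ y], intro conjI x refl)
  next
    case (2 w)
    then obtain m :: nat and a b where a: "\<forall>i<m. a i \<in> vcarrier U \<and> b i \<in> vcarrier V"
      and t: "(\<Sum>i<n. x i \<otimes>\<^bsub>U,V\<^esub> y i) = (\<Sum>i<m. a i \<otimes>\<^bsub>U,V\<^esub> b i)"
      and w: "w = (\<Sum>i<m. F (a i) (b i))"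
      by (elim exE conjE)
    show ?case unfolding w by (rule eq[OF a t])
  qed
qed

lemma tensor_lift_tens:
  assumes "kspace U" "kspace V" "kspace W" "kbilinear U V W F" "x \<in> vcarrier U" "y \<in> vcarrier V"
  shows "tensor_lift U V F (x \<otimes>\<^bsub>U,V\<^esub> y) = F x y"
  using tensor_lift_sum[OF assms(1-4), of "Suc 0" "\<lambda>_. x" "\<lambda>_. y"] assms(5,6)
  by (simp add: lessThan_Suc del: sum_constant)

lemma sum_append:
  fixes h :: "'b \<Rightarrow> 'd \<Rightarrow> 'z::comm_monoid_add" and n m :: nat
  shows "(\<Sum>i<n + m. h (if i < n then x i else a (i - n)) (if i < n then y i else b (i - n))) =
    (\<Sum>i<n. h (x i) (y i)) + (\<Sum>i<m. h (a i) (b i))"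
  by (induction m) (simp_all add: add.assoc)

lemma tensor_lift_universal:
  assumes U: "kspace U" and V: "kspace V" and W: "kspace W" and F: "kbilinear U V W F"
  shows "klinear (tensor_space U V) W (tensor_lift U V F)"
    and "klinear (tensor_space U V) W G \<Longrightarrow>
      (\<And>x y. x \<in> vcarrier U \<Longrightarrow> y \<in> vcarrier V \<Longrightarrow> G (x \<otimes>\<^bsub>U,V\<^esub> y) = F x y) \<Longrightarrow>
      t \<in> vcarrier (tensor_space U V) \<Longrightarrow> G t = tensor_lift U V F t"
proof -
  have mU: "module (vscale U)" and sU: "module.subspace (vscale U) (vcarrier U)"
    using U by (auto simp: kspace_def module_iff_vector_space)
  have mW: "module (vscale W)" and sW: "module.subspace (vscale W) (vcarrier W)"
    using W by (auto simp: kspace_def module_iff_vector_space)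
  have mT: "module (vscale (tensor_space U V))"
    and sT: "module.subspace (vscale (tensor_space U V)) (vcarrier (tensor_space U V))"
    using kspace_tensor_space[of U V] by (auto simp: kspace_def module_iff_vector_space)
  let ?L = "tensor_lift U V F" and ?T = "vcarrier (tensor_space U V)"
  show "klinear (tensor_space U V) W ?L"
    unfolding klinear_def
  proof (intro conjI ballI allI Pi_I)
    fix s assume "s \<in> ?T"
    then obtain n :: nat and x y where n: "\<forall>i<n. x i \<in> vcarrier U \<and> y i \<in> vcarrier V"
      "s = (\<Sum>i<n. x i \<otimes>\<^bsub>U,V\<^esub> y i)" by (rule tensor_space_sum[OF U])
    show "?L s \<in> vcarrier W"
      unfolding n(2) tensor_lift_sum[OF U V W F n(1)]
      using n(1) kbilinearD(1)[OF F] by (intro module.subspace_sum[OF mW sW]) auto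
    fix c
    have x: "\<forall>i<n. vscale U c (x i) \<in> vcarrier U \<and> y i \<in> vcarrier V"
      using n(1) module.subspace_scale[OF mU sU] by blast
    have "vscale (tensor_space U V) c s = (\<Sum>i<n. vscale U c (x i) \<otimes>\<^bsub>U,V\<^esub> y i)"
      using n kbilinearD(4)[OF kbilinear_tens, of _ U _ V c]
      by (simp add: module.scale_sum_right[OF mT])
    then have "?L (vscale (tensor_space U V) c s) = (\<Sum>i<n. F (vscale U c (x i)) (y i))"
      using tensor_lift_sum[OF U V W F x] by simp
    also have "\<dots> = vscale W c (\<Sum>i<n. F (x i) (y i))"
      using n(1) by (simp add: module.scale_sum_right[OF mW] kbilinearD(4)[OF F])
    finally show "?L (vscale (tensor_space U V) c s) = vscale W c (?L s)"
      by (simp add: n(2) tensor_lift_sum[OF U V W F n(1)])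
  next
    fix s t assume s: "s \<in> ?T" and t: "t \<in> ?T"
    obtain n :: nat and x y where n: "\<forall>i<n. x i \<in> vcarrier U \<and> y i \<in> vcarrier V"
      "s = (\<Sum>i<n. x i \<otimes>\<^bsub>U,V\<^esub> y i)" by (rule tensor_space_sum[OF U s])
    obtain m :: nat and a b where m: "\<forall>i<m. a i \<in> vcarrier U \<and> b i \<in> vcarrier V"
      "t = (\<Sum>i<m. a i \<otimes>\<^bsub>U,V\<^esub> b i)" by (rule tensor_space_sum[OF U t])
    let ?x = "\<lambda>i. if i < n then x i else a (i - n)" and ?y = "\<lambda>i. if i < n then y i else b (i - n)"
    have xy: "\<forall>i<n + m. ?x i \<in> vcarrier U \<and> ?y i \<in> vcarrier V"
      using n(1) m(1) by auto
    show "?L (s + t) = ?L s + ?L t"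
      using tensor_lift_sum[OF U V W F xy]
      unfolding sum_append[where h = F] sum_append[where h = "\<lambda>x y. x \<otimes>\<^bsub>U,V\<^esub> y"]
      by (simp add: n(2) m(2) tensor_lift_sum[OF U V W F n(1)] tensor_lift_sum[OF U V W F m(1)])
  qed
  assume G: "klinear (tensor_space U V) W G"
    "\<And>x y. x \<in> vcarrier U \<Longrightarrow> y \<in> vcarrier V \<Longrightarrow> G (x \<otimes>\<^bsub>U,V\<^esub> y) = F x y" and t: "t \<in> ?T"
  obtain n :: nat and x y where n: "\<forall>i<n. x i \<in> vcarrier U \<and> y i \<in> vcarrier V"
    "t = (\<Sum>i<n. x i \<otimes>\<^bsub>U,V\<^esub> y i)" by (rule tensor_space_sum[OF U t])
  have G0: "G 0 = 0"
    using klinear_add[OF G(1) module.subspace_0[OF mT sT] module.subspace_0[OF mT sT]] by simp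
  have "G (\<Sum>i<k. x i \<otimes>\<^bsub>U,V\<^esub> y i) = (\<Sum>i<k. F (x i) (y i))" if "k \<le> n" for k
    using that
  proof (induction k)
    case 0
    show ?case using G0 by (simp only: lessThan_0 sum.empty)
  next
    case (Suc k)
    have k: "x k \<in> vcarrier U" "y k \<in> vcarrier V"
      using n(1) Suc.prems by auto
    have "(\<Sum>i<k. x i \<otimes>\<^bsub>U,V\<^esub> y i) \<in> ?T"
      using n(1) Suc.prems kbilinearD(1)[OF kbilinear_tens, of _ U _ V]
      by (intro module.subspace_sum[OF mT sT]) auto
    then have "G (\<Sum>i<Suc k. x i \<otimes>\<^bsub>U,V\<^esub> y i) =
        G (\<Sum>i<k. x i \<otimes>\<^bsub>U,V\<^esub> y i) + G (x k \<otimes>\<^bsub>U,V\<^esub> y k)"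
      unfolding sum.lessThan_Suc
      by (rule klinear_add[OF G(1) _ kbilinearD(1)[OF kbilinear_tens k]])
    then show ?case
      using Suc.prems by (simp only: Suc.IH[OF Suc_leD] G(2)[OF k] sum.lessThan_Suc)
  qed
  then show "G t = ?L t"
    by (simp add: n(2) tensor_lift_sum[OF U V W F n(1)])
qed


section \<open>Hopf algebras\<close>

record ('k, 'v) hopf = "('k, 'v) vspace" +
  hmult :: "'v \<Rightarrow> 'v \<Rightarrow> 'v"
  hone :: 'v
  hcomult :: "'v \<Rightarrow> ('k, 'v, 'v) tensor"
  hcounit :: "'v \<Rightarrow> 'k"

abbreviation hmult_syntax :: "'v \<Rightarrow> ('k, 'v, 'm) hopf_scheme \<Rightarrow> 'v \<Rightarrow> 'v"
    ("_ \<cdot>\<^bsub>_\<^esub> _" [75, 0, 76] 75) where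
  "x \<cdot>\<^bsub>H\<^esub> y \<equiv> hmult H x y"

text \<open>
  Sweedler notation: for \<open>F\<close> multilinear, \<open>sweedler H h (\<lambda>h1 h2. F h1 h2)\<close> is the expression
  written with the components of the comultiplication of \<open>h\<close>, and \<open>sweedler3\<close>, \<open>sweedler4\<close> use the
  iterated comultiplication.
\<close>

definition sweedler :: "('k::field, 'v::ab_group_add, 'm) hopf_scheme \<Rightarrow> 'v \<Rightarrow>
    ('v \<Rightarrow> 'v \<Rightarrow> 'w::ab_group_add) \<Rightarrow> 'w" where
  "sweedler H h F = tensor_lift H H F (hcomult H h)"

definition sweedler3 :: "('k::field, 'v::ab_group_add, 'm) hopf_scheme \<Rightarrow> 'v \<Rightarrow>
    ('v \<Rightarrow> 'v \<Rightarrow> 'v \<Rightarrow> 'w::ab_group_add) \<Rightarrow> 'w" where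
  "sweedler3 H h F = sweedler H h (\<lambda>u h3. sweedler H u (\<lambda>h1 h2. F h1 h2 h3))"

definition sweedler4 :: "('k::field, 'v::ab_group_add, 'm) hopf_scheme \<Rightarrow> 'v \<Rightarrow>
    ('v \<Rightarrow> 'v \<Rightarrow> 'v \<Rightarrow> 'v \<Rightarrow> 'w::ab_group_add) \<Rightarrow> 'w" where
  "sweedler4 H h F = sweedler3 H h (\<lambda>u h3 h4. sweedler H u (\<lambda>h1 h2. F h1 h2 h3 h4))"

definition algebra :: "('k::field, 'v::ab_group_add, 'm) hopf_scheme \<Rightarrow> bool" where
  "algebra H \<longleftrightarrow>
     kspace H \<and> kbilinear H H H (hmult H) \<and> hone H \<in> vcarrier H \<and>
     (\<forall>x\<in>vcarrier H. \<forall>y\<in>vcarrier H. \<forall>z\<in>vcarrier H. (x \<cdot>\<^bsub>H\<^esub> y) \<cdot>\<^bsub>H\<^esub> z = x \<cdot>\<^bsub>H\<^esub> (y \<cdot>\<^bsub>H\<^esub> z)) \<and>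
     (\<forall>x\<in>vcarrier H. hone H \<cdot>\<^bsub>H\<^esub> x = x \<and> x \<cdot>\<^bsub>H\<^esub> hone H = x)"

definition coalgebra :: "('k::field, 'v::ab_group_add, 'm) hopf_scheme \<Rightarrow> bool" where
  "coalgebra H \<longleftrightarrow>
     kspace H \<and> klinear H (tensor_space H H) (hcomult H) \<and> klinear H base_field (hcounit H) \<and>
     (\<forall>h\<in>vcarrier H.
        sweedler H h (\<lambda>u h3. sweedler H u (\<lambda>h1 h2. (h1 \<otimes>\<^bsub>H,H\<^esub> h2) \<otimes>\<^bsub>tensor_space H H,H\<^esub> h3)) =
        sweedler H h (\<lambda>h1 u. sweedler H u (\<lambda>h2 h3. (h1 \<otimes>\<^bsub>H,H\<^esub> h2) \<otimes>\<^bsub>tensor_space H H,H\<^esub> h3))) \<and>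
     (\<forall>h\<in>vcarrier H.
        sweedler H h (\<lambda>h1 h2. vscale H (hcounit H h1) h2) = h \<and>
        sweedler H h (\<lambda>h1 h2. vscale H (hcounit H h2) h1) = h)"

definition bialgebra :: "('k::field, 'v::ab_group_add, 'm) hopf_scheme \<Rightarrow> bool" where
  "bialgebra H \<longleftrightarrow>
     algebra H \<and> coalgebra H \<and>
     hcomult H (hone H) = hone H \<otimes>\<^bsub>H,H\<^esub> hone H \<and>
     hcounit H (hone H) = 1 \<and>
     (\<forall>x\<in>vcarrier H. \<forall>y\<in>vcarrier H.
        hcomult H (x \<cdot>\<^bsub>H\<^esub> y) =
          sweedler H x (\<lambda>x1 x2. sweedler H y (\<lambda>y1 y2. (x1 \<cdot>\<^bsub>H\<^esub> y1) \<otimes>\<^bsub>H,H\<^esub> (x2 \<cdot>\<^bsub>H\<^esub> y2))) \<and>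
        hcounit H (x \<cdot>\<^bsub>H\<^esub> y) = hcounit H x * hcounit H y)"

definition is_antipode :: "('k::field, 'v::ab_group_add, 'm) hopf_scheme \<Rightarrow> ('v \<Rightarrow> 'v) \<Rightarrow> bool" where
  "is_antipode H S \<longleftrightarrow>
     klinear H H S \<and>
     (\<forall>h\<in>vcarrier H.
        sweedler H h (\<lambda>h1 h2. S h1 \<cdot>\<^bsub>H\<^esub> h2) = vscale H (hcounit H h) (hone H) \<and>
        sweedler H h (\<lambda>h1 h2. h1 \<cdot>\<^bsub>H\<^esub> S h2) = vscale H (hcounit H h) (hone H))"

definition hopf_algebra :: "('k::field, 'v::ab_group_add, 'm) hopf_scheme \<Rightarrow> bool" where
  "hopf_algebra H \<longleftrightarrow> bialgebra H \<and> (\<exists>S. is_antipode H S)"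

text \<open>The antipode is unique on the carrier; \<^const>\<open>extensional\<close> fixes its values elsewhere.\<close>

definition antipode :: "('k::field, 'v::ab_group_add, 'm) hopf_scheme \<Rightarrow> 'v \<Rightarrow> 'v" where
  "antipode H = (THE S. is_antipode H S \<and> S \<in> extensional (vcarrier H))"

definition central_primitives :: "('k::field, 'v::ab_group_add, 'm) hopf_scheme \<Rightarrow> 'v set" where
  "central_primitives H =
     {z \<in> vcarrier H. hcomult H z = z \<otimes>\<^bsub>H,H\<^esub> hone H + hone H \<otimes>\<^bsub>H,H\<^esub> z} \<inter>
     {z \<in> vcarrier H. \<forall>y\<in>vcarrier H. z \<cdot>\<^bsub>H\<^esub> y = y \<cdot>\<^bsub>H\<^esub> z}"

definition coalgebra_map :: "('k::field, 'v::ab_group_add, 'm) hopf_scheme \<Rightarrow>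
    ('k, 'w::ab_group_add, 'n) hopf_scheme \<Rightarrow> ('v \<Rightarrow> 'w) \<Rightarrow> bool" where
  "coalgebra_map H K \<phi> \<longleftrightarrow>
     klinear H K \<phi> \<and>
     (\<forall>h\<in>vcarrier H.
        hcomult K (\<phi> h) = sweedler H h (\<lambda>h1 h2. \<phi> h1 \<otimes>\<^bsub>K,K\<^esub> \<phi> h2) \<and> hcounit K (\<phi> h) = hcounit H h)"

definition hopf_iso :: "('k::field, 'v::ab_group_add, 'm) hopf_scheme \<Rightarrow>
    ('k, 'w::ab_group_add, 'n) hopf_scheme \<Rightarrow> bool" where
  "hopf_iso H K \<longleftrightarrow>
     (\<exists>\<phi>. bij_betw \<phi> (vcarrier H) (vcarrier K) \<and> coalgebra_map H K \<phi> \<and> \<phi> (hone H) = hone K \<and>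
        (\<forall>x\<in>vcarrier H. \<forall>y\<in>vcarrier H. \<phi> (x \<cdot>\<^bsub>H\<^esub> y) = \<phi> x \<cdot>\<^bsub>K\<^esub> \<phi> y))"

definition hopf_iso_rel :: "(('k::field, 'v::ab_group_add) hopf \<times> ('k, 'v) hopf) set" where
  "hopf_iso_rel = {(X, Y). hopf_algebra X \<and> hopf_algebra Y \<and> hopf_iso X Y}"


section \<open>Crossed products\<close>

definition tensor_comult :: "('k::field, 'a::ab_group_add, 'm) hopf_scheme \<Rightarrow>
    ('k, 'h::ab_group_add, 'n) hopf_scheme \<Rightarrow> ('k, 'a, 'h) tensor \<Rightarrow>
    ('k, ('k, 'a, 'h) tensor, ('k, 'a, 'h) tensor) tensor" where
  "tensor_comult A H = tensor_lift A H (\<lambda>a h. sweedler A a (\<lambda>a1 a2. sweedler H h (\<lambda>h1 h2.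
     (a1 \<otimes>\<^bsub>A,H\<^esub> h1) \<otimes>\<^bsub>tensor_space A H,tensor_space A H\<^esub> (a2 \<otimes>\<^bsub>A,H\<^esub> h2))))"

definition tensor_counit :: "('k::field, 'a::ab_group_add, 'm) hopf_scheme \<Rightarrow>
    ('k, 'h::ab_group_add, 'n) hopf_scheme \<Rightarrow> ('k, 'a, 'h) tensor \<Rightarrow> 'k" where
  "tensor_counit A H = tensor_lift A H (\<lambda>a h. hcounit A a * hcounit H h)"

definition tensor_hopf :: "('k::field, 'a::ab_group_add, 'm) hopf_scheme \<Rightarrow>
    ('k, 'h::ab_group_add, 'n) hopf_scheme \<Rightarrow> ('k, ('k, 'a, 'h) tensor) hopf" where
  "tensor_hopf A H =
     \<lparr>vcarrier = vcarrier (tensor_space A H), vscale = vscale (tensor_space A H),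
      hmult = tensor_lift2 A H (\<lambda>a h c g. (a \<cdot>\<^bsub>A\<^esub> c) \<otimes>\<^bsub>A,H\<^esub> (h \<cdot>\<^bsub>H\<^esub> g)),
      hone = hone A \<otimes>\<^bsub>A,H\<^esub> hone H,
      hcomult = tensor_comult A H, hcounit = tensor_counit A H\<rparr>"

text \<open>
  Linear maps from \<open>H \<otimes> A\<close> and \<open>H \<otimes> H\<close> to \<open>A\<close> are given as curried bilinear maps.
\<close>

definition crossed_product :: "('k::field, 'a::ab_group_add, 'm) hopf_scheme \<Rightarrow>
    ('k, 'h::ab_group_add, 'n) hopf_scheme \<Rightarrow> ('h \<Rightarrow> 'a \<Rightarrow> 'a) \<Rightarrow> ('h \<Rightarrow> 'h \<Rightarrow> 'a) \<Rightarrow>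
    ('k, ('k, 'a, 'h) tensor) hopf" where
  "crossed_product A H act f =
     \<lparr>vcarrier = vcarrier (tensor_space A H), vscale = vscale (tensor_space A H),
      hmult = tensor_lift2 A H (\<lambda>a h c g.
        sweedler3 H h (\<lambda>h1 h2 h3. sweedler H g (\<lambda>g1 g2.
          (a \<cdot>\<^bsub>A\<^esub> act h1 c \<cdot>\<^bsub>A\<^esub> f h2 g1) \<otimes>\<^bsub>A,H\<^esub> (h3 \<cdot>\<^bsub>H\<^esub> g2)))),
      hone = hone A \<otimes>\<^bsub>A,H\<^esub> hone H,
      hcomult = tensor_comult A H, hcounit = tensor_counit A H\<rparr>"

definition weak_action :: "('k::field, 'a::ab_group_add, 'm) hopf_scheme \<Rightarrow>
    ('k, 'h::ab_group_add, 'n) hopf_scheme \<Rightarrow> ('h \<Rightarrow> 'a \<Rightarrow> 'a) \<Rightarrow> bool" where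
  "weak_action A H act \<longleftrightarrow>
     kbilinear H A A act \<and>
     (\<forall>h\<in>vcarrier H. act h (hone A) = vscale A (hcounit H h) (hone A)) \<and>
     (\<forall>a\<in>vcarrier A. act (hone H) a = a) \<and>
     (\<forall>h\<in>vcarrier H. \<forall>a\<in>vcarrier A. \<forall>b\<in>vcarrier A.
        act h (a \<cdot>\<^bsub>A\<^esub> b) = sweedler H h (\<lambda>h1 h2. act h1 a \<cdot>\<^bsub>A\<^esub> act h2 b))"

text \<open>
  The extensional function spaces make two crossed systems equal as soon as their maps agree on the
  carriers.
\<close>

definition crossed_systems :: "('k::field, 'a::ab_group_add, 'm) hopf_scheme \<Rightarrow>
    ('k, 'h::ab_group_add, 'n) hopf_scheme \<Rightarrow> (('h \<Rightarrow> 'a \<Rightarrow> 'a) \<times> ('h \<Rightarrow> 'h \<Rightarrow> 'a)) set" where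
  "crossed_systems A H =
     {(act, f). act \<in> vcarrier H \<rightarrow>\<^sub>E vcarrier A \<rightarrow>\<^sub>E vcarrier A \<and>
        f \<in> vcarrier H \<rightarrow>\<^sub>E vcarrier H \<rightarrow>\<^sub>E vcarrier A \<and>
        weak_action A H act \<and> kbilinear H H A f \<and>
        hopf_algebra (crossed_product A H act f)}"

definition trivial_action :: "('k::field, 'a::ab_group_add, 'm) hopf_scheme \<Rightarrow>
    ('k, 'h::ab_group_add, 'n) hopf_scheme \<Rightarrow> 'h \<Rightarrow> 'a \<Rightarrow> 'a" where
  "trivial_action A H = (\<lambda>h\<in>vcarrier H. \<lambda>b\<in>vcarrier A. vscale A (hcounit H h) b)"

definition trivial_cocycle :: "('k::field, 'a::ab_group_add, 'm) hopf_scheme \<Rightarrow>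
    ('k, 'h::ab_group_add, 'n) hopf_scheme \<Rightarrow> 'h \<Rightarrow> 'h \<Rightarrow> 'a" where
  "trivial_cocycle A H =
     (\<lambda>h\<in>vcarrier H. \<lambda>g\<in>vcarrier H. vscale A (hcounit H h * hcounit H g) (hone A))"

definition crossed_products :: "('k::field, 'a::ab_group_add, 'm) hopf_scheme \<Rightarrow>
    ('k, 'h::ab_group_add, 'n) hopf_scheme \<Rightarrow> ('k, ('k, 'a, 'h) tensor) hopf set" where
  "crossed_products A H = {crossed_product A H act f | act f. (act, f) \<in> crossed_systems A H}"

definition Crp :: "('k::field, 'h::ab_group_add, 'n) hopf_scheme \<Rightarrow>
    ('k, 'a::ab_group_add, 'm) hopf_scheme \<Rightarrow> ('k, ('k, 'a, 'h) tensor) hopf set set" where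
  "Crp H A = crossed_products A H // hopf_iso_rel"

definition unitary_cocentral :: "('k::field, 'h::ab_group_add, 'n) hopf_scheme \<Rightarrow>
    ('k, 'a::ab_group_add, 'm) hopf_scheme \<Rightarrow> ('h \<Rightarrow> 'a) \<Rightarrow> bool" where
  "unitary_cocentral H A r \<longleftrightarrow>
     coalgebra_map H A r \<and> r (hone H) = hone A \<and>
     (\<forall>h\<in>vcarrier H. sweedler H h (\<lambda>h1 h2. r h1 \<otimes>\<^bsub>A,H\<^esub> h2) = sweedler H h (\<lambda>h1 h2. r h2 \<otimes>\<^bsub>A,H\<^esub> h1))"

definition crossed_system_equiv :: "('k::field, 'a::ab_group_add, 'm) hopf_scheme \<Rightarrow>
    ('k, 'h::ab_group_add, 'n) hopf_scheme \<Rightarrow>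
    (('h \<Rightarrow> 'a \<Rightarrow> 'a) \<times> ('h \<Rightarrow> 'h \<Rightarrow> 'a)) \<Rightarrow> (('h \<Rightarrow> 'a \<Rightarrow> 'a) \<times> ('h \<Rightarrow> 'h \<Rightarrow> 'a)) \<Rightarrow> bool" where
  "crossed_system_equiv A H = (\<lambda>(act, f) (act', f').
     \<exists>r. unitary_cocentral H A r \<and>
       (\<forall>h\<in>vcarrier H. \<forall>a\<in>vcarrier A.
          act' h a = sweedler3 H h (\<lambda>h1 h2 h3. r h1 \<cdot>\<^bsub>A\<^esub> act h2 a \<cdot>\<^bsub>A\<^esub> antipode A (r h3))) \<and>
       (\<forall>h\<in>vcarrier H. \<forall>g\<in>vcarrier H.
          f' h g = sweedler4 H h (\<lambda>h1 h2 h3 h4. sweedler3 H g (\<lambda>g1 g2 g3.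
            r h1 \<cdot>\<^bsub>A\<^esub> act h2 (r g1) \<cdot>\<^bsub>A\<^esub> f h3 g2 \<cdot>\<^bsub>A\<^esub> antipode A (r (h4 \<cdot>\<^bsub>H\<^esub> g3))))))"

definition H2 :: "('k::field, 'h::ab_group_add, 'n) hopf_scheme \<Rightarrow>
    ('k, 'a::ab_group_add, 'm) hopf_scheme \<Rightarrow>
    (('h \<Rightarrow> 'a \<Rightarrow> 'a) \<times> ('h \<Rightarrow> 'h \<Rightarrow> 'a)) set set" where
  "H2 H A = crossed_systems A H //
     {(p, q). p \<in> crossed_systems A H \<and> q \<in> crossed_systems A H \<and> crossed_system_equiv A H p q}"


section \<open>Sweedler's four-dimensional Hopf algebra\<close>

datatype h4_basis = B1 | Bg | Bx | Bgx

lemma UNIV_h4_basis: "UNIV = {B1, Bg, Bx, Bgx}"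
  using h4_basis.exhaust by blast

instance h4_basis :: finite
  by standard (simp add: UNIV_h4_basis)

type_synonym 'k h4 = "h4_basis \<Rightarrow> 'k"

definition h4_vec :: "h4_basis \<Rightarrow> 'k::field h4" where
  "h4_vec i = (\<lambda>j. if j = i then 1 else 0)"

definition h4_space :: "('k::field, 'k h4) vspace" where
  "h4_space = \<lparr>vcarrier = UNIV, vscale = (\<lambda>c v i. c * v i)\<rparr>"

fun h4_mult_table :: "h4_basis \<Rightarrow> h4_basis \<Rightarrow> 'k::field h4" where
  "h4_mult_table B1 j = h4_vec j"
| "h4_mult_table i B1 = h4_vec i"
| "h4_mult_table Bg Bg = h4_vec B1"
| "h4_mult_table Bg Bx = h4_vec Bgx"
| "h4_mult_table Bg Bgx = h4_vec Bx"
| "h4_mult_table Bx Bg = - h4_vec Bgx"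
| "h4_mult_table Bx Bx = 0"
| "h4_mult_table Bx Bgx = 0"
| "h4_mult_table Bgx Bg = - h4_vec Bx"
| "h4_mult_table Bgx Bx = 0"
| "h4_mult_table Bgx Bgx = 0"

fun h4_comult_table :: "h4_basis \<Rightarrow> ('k::field, 'k h4, 'k h4) tensor" where
  "h4_comult_table B1 = h4_vec B1 \<otimes>\<^bsub>h4_space,h4_space\<^esub> h4_vec B1"
| "h4_comult_table Bg = h4_vec Bg \<otimes>\<^bsub>h4_space,h4_space\<^esub> h4_vec Bg"
| "h4_comult_table Bx =
     h4_vec Bx \<otimes>\<^bsub>h4_space,h4_space\<^esub> h4_vec B1 + h4_vec Bg \<otimes>\<^bsub>h4_space,h4_space\<^esub> h4_vec Bx"
| "h4_comult_table Bgx =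
     h4_vec Bgx \<otimes>\<^bsub>h4_space,h4_space\<^esub> h4_vec Bg + h4_vec B1 \<otimes>\<^bsub>h4_space,h4_space\<^esub> h4_vec Bgx"

fun h4_counit_table :: "h4_basis \<Rightarrow> 'k::field" where
  "h4_counit_table B1 = 1"
| "h4_counit_table Bg = 1"
| "h4_counit_table Bx = 0"
| "h4_counit_table Bgx = 0"

definition H4 :: "('k::field, 'k h4) hopf" where
  "H4 =
     \<lparr>vcarrier = vcarrier h4_space, vscale = vscale h4_space,
      hmult = (\<lambda>s t. \<Sum>i\<in>UNIV. \<Sum>j\<in>UNIV. vscale h4_space (s i * t j) (h4_mult_table i j)),
      hone = h4_vec B1,
      hcomult = (\<lambda>s. \<Sum>i\<in>UNIV.
        vscale (tensor_space h4_space h4_space) (s i) (h4_comult_table i)),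
      hcounit = (\<lambda>s. \<Sum>i\<in>UNIV. s i * h4_counit_table i)\<rparr>"

lemma H4_relations:
  defines "g \<equiv> (h4_vec Bg :: 'k::field h4)" and "x \<equiv> (h4_vec Bx :: 'k h4)"
  shows "g \<cdot>\<^bsub>H4\<^esub> g = hone H4" and "x \<cdot>\<^bsub>H4\<^esub> x = 0" and "g \<cdot>\<^bsub>H4\<^esub> x = h4_vec Bgx"
    and "x \<cdot>\<^bsub>H4\<^esub> g = - (g \<cdot>\<^bsub>H4\<^esub> x)"
  by (auto simp: g_def x_def H4_def h4_space_def UNIV_h4_basis h4_vec_def fun_eq_iff)

lemma tens_H4: "x \<otimes>\<^bsub>H4,H4\<^esub> y = x \<otimes>\<^bsub>h4_space,h4_space\<^esub> y"
  by (simp add: tens_def kbilinear_def klinear_def H4_def)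

lemma H4_comult:
  defines "g \<equiv> (h4_vec Bg :: 'k::field h4)" and "x \<equiv> (h4_vec Bx :: 'k h4)"
  shows "hcomult H4 g = g \<otimes>\<^bsub>H4,H4\<^esub> g"
    and "hcomult H4 x = x \<otimes>\<^bsub>H4,H4\<^esub> hone H4 + g \<otimes>\<^bsub>H4,H4\<^esub> x"
  by (simp_all add: tens_H4)
     (simp_all add: H4_def g_def x_def h4_vec_def[of Bg] h4_vec_def[of Bx]
       UNIV_h4_basis vscale_tensor_space fun_eq_iff)

fun h4_cocycle_table :: "('k::field, 'a::ab_group_add, 'm) hopf_scheme \<Rightarrow> 'a \<Rightarrow>
    h4_basis \<Rightarrow> h4_basis \<Rightarrow> 'a" where
  "h4_cocycle_table A a B1 B1 = hone A"
| "h4_cocycle_table A a B1 Bg = hone A"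
| "h4_cocycle_table A a B1 Bx = 0"
| "h4_cocycle_table A a B1 Bgx = 0"
| "h4_cocycle_table A a Bg B1 = hone A"
| "h4_cocycle_table A a Bg Bg = hone A"
| "h4_cocycle_table A a Bg Bx = 0"
| "h4_cocycle_table A a Bg Bgx = 0"
| "h4_cocycle_table A a Bx B1 = 0"
| "h4_cocycle_table A a Bx Bg = 0"
| "h4_cocycle_table A a Bx Bx = a"
| "h4_cocycle_table A a Bx Bgx = - a"
| "h4_cocycle_table A a Bgx B1 = 0"
| "h4_cocycle_table A a Bgx Bg = 0"
| "h4_cocycle_table A a Bgx Bx = a"
| "h4_cocycle_table A a Bgx Bgx = - a"

definition h4_cocycle :: "('k::field, 'a::ab_group_add, 'm) hopf_scheme \<Rightarrow> 'a \<Rightarrow>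
    'k h4 \<Rightarrow> 'k h4 \<Rightarrow> 'a" where
  "h4_cocycle A a = (\<lambda>s t.
     \<Sum>i\<in>UNIV. \<Sum>j\<in>UNIV. vscale A (s i * t j) (h4_cocycle_table A a i j))"

end

theory Submission
  imports Defs
begin

text \<open>
  Let \<open>B\<close> be the space \<open>A \<otimes> H\<^sub>4\<close> with a crossed product multiplication, and write \<open>G = 1 # g\<close> and
  \<open>X = 1 # x\<close>. Only the multiplication depends on the action and the cocycle: the coalgebra structure
  is that of the tensor product, and this is what makes crossed systems so rigid.

  \<^emph>\<open>A crossed system is given by a central primitive element.\<close> For an element \<open>t\<close> of \<open>B\<close>, applying
  \<open>id \<otimes> \<epsilon>\<close> to one leg of the comultiplication of \<open>t\<close> and a coordinate of \<open>\<epsilon> \<otimes> id\<close> to the other gives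
  back that coordinate of \<open>t\<close>, whichever leg is used for which map. For a product \<open>t\<close>, whose
  comultiplication is a product as well, this is the cocentrality condition
  \<open>h\<^sub>1 \<otimes> (h\<^sub>2 \<triangleright> a) = h\<^sub>2 \<otimes> (h\<^sub>1 \<triangleright> a)\<close>, and a similar condition on \<open>f\<close> (\<open>cocentral\<close>). The
  comultiplication of \<open>x\<close> is \<open>x \<otimes> 1 + g \<otimes> x\<close>, and \<open>1\<close>, \<open>g\<close>, \<open>x\<close> are linearly independent, so
  comparing coordinates forces the action to be trivial (\<open>act_basis\<close>) and the values of \<open>f\<close> with an
  argument \<open>g\<close> to be those of \<open>\<epsilon> \<otimes> \<epsilon>\<close> (\<open>f_g\<close>). Hence \<open>G\<^sup>2 = 1\<close>, \<open>X G = - G X\<close> and \<open>X\<^sup>2 = z # 1\<close> for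
  \<open>z = f(x, x)\<close>, and associativity determines the three values of \<open>f\<close> that are left. The element \<open>X\<close>
  commutes with \<open>A\<close>, so its square \<open>z\<close> is central; and \<open>z\<close> is primitive because \<open>id \<otimes> \<epsilon>\<close> is a
  coalgebra map and takes \<open>X\<^sup>2\<close> to \<open>z\<close> (\<open>z_primitive\<close>).

  \<^emph>\<open>A central primitive element gives a crossed system.\<close> For the action and cocycle that belong to
  \<open>z\<close>, the multiplication of \<open>B\<close> is an affine function of \<open>z\<close> (\<open>crossed_mult_defect\<close>):
  \<open>(a # h) (c # g) = a c # h g + a c z # D(h, g)\<close>
  for a bilinear map \<open>D\<close> on \<open>H\<^sub>4\<close>. As \<open>z\<close> is central and primitive, every Hopf algebra axiom of \<open>B\<close>
  splits into the axioms of \<open>A\<close> and \<open>H\<^sub>4\<close> and a few identities for \<open>D\<close> on \<open>H\<^sub>4\<close>, which are checked on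
  basis elements. The antipode is the tensor product of the antipodes of \<open>A\<close> and \<open>H\<^sub>4\<close>.

  If \<open>0\<close> is the only central primitive element, then \<open>D\<close> is multiplied by \<open>0\<close>, the only crossed product
  is the tensor product, and both classifying sets are quotients of one-element sets.
\<close>


section \<open>Linear and bilinear maps\<close>

lemma kspace_closed:
  assumes "kspace V"
  shows "0 \<in> vcarrier V"
    and "x \<in> vcarrier V \<Longrightarrow> y \<in> vcarrier V \<Longrightarrow> x + y \<in> vcarrier V"
    and "x \<in> vcarrier V \<Longrightarrow> vscale V c x \<in> vcarrier V"
    and "x \<in> vcarrier V \<Longrightarrow> - x \<in> vcarrier V"
    and "(\<And>i. i \<in> I \<Longrightarrow> u i \<in> vcarrier V) \<Longrightarrow> (\<Sum>i\<in>I. u i) \<in> vcarrier V"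
proof -
  have m: "module (vscale V)" and s: "module.subspace (vscale V) (vcarrier V)"
    using assms by (auto simp: kspace_def module_iff_vector_space)
  note c = module.subspace_0[OF m s] module.subspace_add[OF m s] module.subspace_scale[OF m s]
    module.subspace_neg[OF m s] module.subspace_sum[OF m s]
  show "0 \<in> vcarrier V"
    "x \<in> vcarrier V \<Longrightarrow> y \<in> vcarrier V \<Longrightarrow> x + y \<in> vcarrier V"
    "x \<in> vcarrier V \<Longrightarrow> vscale V c x \<in> vcarrier V"
    "x \<in> vcarrier V \<Longrightarrow> - x \<in> vcarrier V"
    "(\<And>i. i \<in> I \<Longrightarrow> u i \<in> vcarrier V) \<Longrightarrow> (\<Sum>i\<in>I. u i) \<in> vcarrier V"
    by (rule c; assumption)+
qed

lemma kspace_scale: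
  assumes "kspace V"
  shows "vscale V c (x + y) = vscale V c x + vscale V c y"
    and "vscale V (c + d) x = vscale V c x + vscale V d x"
    and "vscale V c (vscale V d x) = vscale V (c * d) x"
    and "vscale V 1 x = x"
    and "vscale V 0 x = 0" and "vscale V c 0 = 0"
    and "vscale V (- c) x = - vscale V c x" and "vscale V c (- x) = - vscale V c x"
    and "vscale V c (\<Sum>i\<in>I. u i) = (\<Sum>i\<in>I. vscale V c (u i))"
proof -
  have m: "module (vscale V)"
    using assms by (auto simp: kspace_def module_iff_vector_space)
  interpret module "vscale V" by (rule m)
  show "vscale V c (x + y) = vscale V c x + vscale V c y"
    "vscale V (c + d) x = vscale V c x + vscale V d x"
    "vscale V c (vscale V d x) = vscale V (c * d) x"
    "vscale V 1 x = x"
    "vscale V 0 x = 0" "vscale V c 0 = 0"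
    "vscale V (- c) x = - vscale V c x" "vscale V c (- x) = - vscale V c x"
    "vscale V c (\<Sum>i\<in>I. u i) = (\<Sum>i\<in>I. vscale V c (u i))"
    by (simp_all add: scale_right_distrib scale_left_distrib scale_sum_right)
qed

lemma kspace_base_field: "kspace (base_field :: ('k::field, 'k) vspace)"
proof -
  have v: "vector_space ((*) :: 'k \<Rightarrow> 'k \<Rightarrow> 'k)" by unfold_locales (auto simp: algebra_simps)
  then show ?thesis
    by (simp add: kspace_def base_field_def module.subspace_UNIV module_iff_vector_space)
qed

lemma klinearI:
  assumes "\<And>x. x \<in> vcarrier V \<Longrightarrow> f x \<in> vcarrier W"
    and "\<And>x y. x \<in> vcarrier V \<Longrightarrow> y \<in> vcarrier V \<Longrightarrow> f (x + y) = f x + f y"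
    and "\<And>c x. x \<in> vcarrier V \<Longrightarrow> f (vscale V c x) = vscale W c (f x)"
  shows "klinear V W f"
  using assms by (auto simp: klinear_def)

lemma kbilinearI:
  assumes "\<And>x. x \<in> vcarrier U \<Longrightarrow> klinear V W (\<lambda>y. F x y)"
    and "\<And>y. y \<in> vcarrier V \<Longrightarrow> klinear U W (\<lambda>x. F x y)"
  shows "kbilinear U V W F"
  using assms by (auto simp: kbilinear_def)

lemma klinear_simps:
  assumes "klinear V W f" "kspace V"
  shows "f 0 = 0" and "x \<in> vcarrier V \<Longrightarrow> f (- x) = - f x"
    and "finite I \<Longrightarrow> (\<And>i. i \<in> I \<Longrightarrow> u i \<in> vcarrier V) \<Longrightarrow> f (\<Sum>i\<in>I. u i) = (\<Sum>i\<in>I. f (u i))"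
proof -
  have "f (0 + 0) = f 0 + f 0"
    by (rule klinear_add[OF assms(1)]) (simp_all add: kspace_closed assms(2))
  then show 0: "f 0 = 0" by simp
  {
    assume "x \<in> vcarrier V"
    then have "f (x + - x) = f x + f (- x)"
      by (intro klinear_add[OF assms(1)] kspace_closed assms(2))
    then show "f (- x) = - f x"
      by (metis 0 add.right_inverse add_eq_0_iff)
  }
  show "f (\<Sum>i\<in>I. u i) = (\<Sum>i\<in>I. f (u i))"
    if "finite I" "\<And>i. i \<in> I \<Longrightarrow> u i \<in> vcarrier V"
    using that
    by (induction I rule: finite_induct)
      (simp_all add: 0 klinear_add[OF assms(1)] kspace_closed[OF assms(2)])
qed

lemma kbilinear_simps:
  assumes "kbilinear U V W F" "kspace U" "kspace V"
  shows "y \<in> vcarrier V \<Longrightarrow> F 0 y = 0" and "x \<in> vcarrier U \<Longrightarrow> F x 0 = 0"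
    and "x \<in> vcarrier U \<Longrightarrow> y \<in> vcarrier V \<Longrightarrow> F (- x) y = - F x y"
    and "x \<in> vcarrier U \<Longrightarrow> y \<in> vcarrier V \<Longrightarrow> F x (- y) = - F x y"
proof -
  have l: "y \<in> vcarrier V \<Longrightarrow> klinear U W (\<lambda>x. F x y)" "x \<in> vcarrier U \<Longrightarrow> klinear V W (F x)" for x y
    using assms(1) by (auto simp: kbilinear_def)
  show "y \<in> vcarrier V \<Longrightarrow> F 0 y = 0" "x \<in> vcarrier U \<Longrightarrow> F x 0 = 0"
    "x \<in> vcarrier U \<Longrightarrow> y \<in> vcarrier V \<Longrightarrow> F (- x) y = - F x y"
    "x \<in> vcarrier U \<Longrightarrow> y \<in> vcarrier V \<Longrightarrow> F x (- y) = - F x y"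
    using klinear_simps(1,2)[OF l(1) assms(2)] klinear_simps(1,2)[OF l(2) assms(3)] by blast+
qed

lemma klinear_id: "klinear V V (\<lambda>x. x)"
  by (simp add: klinear_def)

lemma klinear_comp: "klinear V W L \<Longrightarrow> klinear U V f \<Longrightarrow> klinear U W (\<lambda>x. L (f x))"
  by (auto simp: klinear_def Pi_iff)

lemma klinear_plus:
  "kspace W \<Longrightarrow> klinear U W f \<Longrightarrow> klinear U W g \<Longrightarrow> klinear U W (\<lambda>x. f x + g x)"
  by (rule klinearI) (simp_all add: klinear_in klinear_add klinear_scale kspace_closed kspace_scale
      algebra_simps)

lemma klinear_uminus:
  "kspace W \<Longrightarrow> klinear U W f \<Longrightarrow> klinear U W (\<lambda>x. - f x)"
  by (rule klinearI) (simp_all add: klinear_in klinear_add klinear_scale kspace_closed kspace_scale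
      algebra_simps)

lemma klinear_zero: "kspace W \<Longrightarrow> klinear U W (\<lambda>x. 0)"
  by (rule klinearI) (simp_all add: kspace_closed kspace_scale)

lemma klinear_scale_right:
  "kspace W \<Longrightarrow> klinear U W f \<Longrightarrow> klinear U W (\<lambda>x. vscale W c (f x))"
  by (rule klinearI) (simp_all add: klinear_in klinear_add klinear_scale kspace_closed kspace_scale
      mult.commute)

lemma klinear_scale_left:
  "kspace W \<Longrightarrow> w \<in> vcarrier W \<Longrightarrow> klinear U base_field \<phi> \<Longrightarrow> klinear U W (\<lambda>x. vscale W (\<phi> x) w)"
  by (rule klinearI) (simp_all add: klinear_add klinear_scale kspace_closed kspace_scale base_field_def)

lemma klinear_base_mult_left:
  "klinear U base_field \<phi> \<Longrightarrow> klinear U base_field (\<lambda>x. \<phi> x * c)"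
  by (rule klinearI) (simp_all add: klinear_add klinear_scale base_field_def algebra_simps)

lemma klinear_base_mult_right:
  "klinear U base_field \<phi> \<Longrightarrow> klinear U base_field (\<lambda>x. c * \<phi> x)"
  by (rule klinearI) (simp_all add: klinear_add klinear_scale base_field_def algebra_simps)

lemma klinear_bilinear_left:
  "kbilinear U V W F \<Longrightarrow> klinear X U f \<Longrightarrow> y \<in> vcarrier V \<Longrightarrow> klinear X W (\<lambda>x. F (f x) y)"
  by (rule klinear_comp[of U W "\<lambda>x. F x y"]) (auto simp: kbilinear_def)

lemma klinear_bilinear_right:
  "kbilinear U V W F \<Longrightarrow> klinear X V f \<Longrightarrow> y \<in> vcarrier U \<Longrightarrow> klinear X W (\<lambda>x. F y (f x))"
  by (rule klinear_comp[of V W "F y"]) (auto simp: kbilinear_def)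

lemmas tens_closed = kbilinearD(1)[OF kbilinear_tens]
lemmas klinear_tens = klinear_bilinear_left[OF kbilinear_tens] klinear_bilinear_right[OF kbilinear_tens]

text \<open>
  Linearity of a nested expression in one of its variables is decided by its outermost operation, so
  it can be derived by resolution with a list of rules, one for each operation. Bilinearity reduces to
  linearity in each variable by \<open>kbilinearI\<close>. The later collections extend this list.
\<close>

lemmas klin = klinear_id klinear_plus klinear_uminus klinear_zero klinear_scale_right
  klinear_scale_left klinear_base_mult_left klinear_base_mult_right klinear_tens kbilinearI
  kspace_tensor_space kspace_base_field tens_closed


section \<open>Maps out of a tensor product\<close>

lemma tensor_lift_cong:
  assumes "\<And>x y. x \<in> vcarrier U \<Longrightarrow> y \<in> vcarrier V \<Longrightarrow> F x y = G x y"
  shows "tensor_lift U V F t = tensor_lift U V G t"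
proof -
  have "(\<Sum>i<n. F (x i) (y i)) = (\<Sum>i<n. G (x i) (y i))"
    if "\<forall>i<n. x i \<in> vcarrier U \<and> y i \<in> vcarrier V" for n :: nat and x y
    using that assms by (intro sum.cong) auto
  then show ?thesis
    unfolding tensor_lift_def
    by (intro arg_cong[where f = The] ext iff_exI conj_cong refl) simp
qed

text \<open>
  Pure tensors determine a linear map: both maps are the unique one that extends the same bilinear
  map.
\<close>

lemma klinear_tensor_eqI:
  assumes "kspace U" "kspace V" "kspace W"
    and "klinear (tensor_space U V) W f" "klinear (tensor_space U V) W g"
    and "\<And>x y. x \<in> vcarrier U \<Longrightarrow> y \<in> vcarrier V \<Longrightarrow> f (x \<otimes>\<^bsub>U,V\<^esub> y) = g (x \<otimes>\<^bsub>U,V\<^esub> y)"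
    and "t \<in> vcarrier (tensor_space U V)"
  shows "f t = g t"
proof -
  have "kbilinear U V W (\<lambda>x y. g (x \<otimes>\<^bsub>U,V\<^esub> y))"
    by (intro kbilinearI klinear_comp[OF assms(5)] klinear_tens klinear_id)
  note u = tensor_lift_universal(2)[OF assms(1-3) this _ _ assms(7)]
  have "f t = tensor_lift U V (\<lambda>x y. g (x \<otimes>\<^bsub>U,V\<^esub> y)) t"
    by (rule u[OF assms(4)]) (rule assms(6))
  also have "\<dots> = g t"
    by (rule u[OF assms(5), symmetric]) (rule refl)
  finally show ?thesis .
qed

lemma klinear_tensor_lift:
  "kspace U \<Longrightarrow> kspace V \<Longrightarrow> kspace W \<Longrightarrow> kbilinear U V W F \<Longrightarrow> klinear X (tensor_space U V) f \<Longrightarrow>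
    klinear X W (\<lambda>x. tensor_lift U V F (f x))"
  by (rule klinear_comp[OF tensor_lift_universal(1)])

lemma tensor_lift_closed:
  "kspace U \<Longrightarrow> kspace V \<Longrightarrow> kspace W \<Longrightarrow> kbilinear U V W F \<Longrightarrow> t \<in> vcarrier (tensor_space U V) \<Longrightarrow>
    tensor_lift U V F t \<in> vcarrier W"
  by (rule klinear_in[OF tensor_lift_universal(1)])

text \<open>
  A linear map commutes with the formation of induced maps; this is the form in which uniqueness in
  the universal property is used throughout.
\<close>

lemma klinear_tensor_lift_push:
  assumes "kspace U" "kspace V" "kspace W" "kspace W'" "kbilinear U V W F" "klinear W W' L"
    "t \<in> vcarrier (tensor_space U V)"
  shows "L (tensor_lift U V F t) = tensor_lift U V (\<lambda>x y. L (F x y)) t"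
proof (rule tensor_lift_universal(2)[OF assms(1,2,4)])
  show "kbilinear U V W' (\<lambda>x y. L (F x y))"
    using assms(5) by (auto intro!: kbilinearI klinear_comp[OF assms(6)] simp: kbilinear_def)
  show "klinear (tensor_space U V) W' (\<lambda>t. L (tensor_lift U V F t))"
    by (intro klinear_comp[OF assms(6)] tensor_lift_universal(1) assms)
qed (simp_all add: tensor_lift_tens[OF assms(1-3,5)] assms(7))

text \<open>
  Here the tensor is fixed and the bilinear map varies. A decomposition of the tensor into pure tensors
  can be chosen once for all parameters, and it turns the induced map into a finite sum.
\<close>

lemma klinear_tensor_lift_param:
  assumes "kspace U" "kspace V" "kspace W" "t \<in> vcarrier (tensor_space U V)"
    and bil: "\<And>x. x \<in> vcarrier X \<Longrightarrow> kbilinear U V W (G x)"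
    and lin: "\<And>p q. p \<in> vcarrier U \<Longrightarrow> q \<in> vcarrier V \<Longrightarrow> klinear X W (\<lambda>x. G x p q)"
    and X: "kspace X"
  shows "klinear X W (\<lambda>x. tensor_lift U V (G x) t)"
proof -
  obtain n :: nat and p q where n: "\<forall>i<n. p i \<in> vcarrier U \<and> q i \<in> vcarrier V"
    and t: "t = (\<Sum>i<n. p i \<otimes>\<^bsub>U,V\<^esub> q i)" by (rule tensor_space_sum[OF assms(1,4)])
  have e: "tensor_lift U V (G x) t = (\<Sum>i<n. G x (p i) (q i))" if "x \<in> vcarrier X" for x
    unfolding t by (rule tensor_lift_sum[OF assms(1-3) bil[OF that] n])
  have l: "i < n \<Longrightarrow> klinear X W (\<lambda>x. G x (p i) (q i))" for i
    using n lin by blast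
  show ?thesis
  proof (rule klinearI)
    show "x \<in> vcarrier X \<Longrightarrow> tensor_lift U V (G x) t \<in> vcarrier W" for x
      by (rule tensor_lift_closed[OF assms(1-3) bil assms(4)])
    show "tensor_lift U V (G (x + y)) t = tensor_lift U V (G x) t + tensor_lift U V (G y) t"
      if "x \<in> vcarrier X" "y \<in> vcarrier X" for x y
      using that by (simp add: e kspace_closed[OF X] klinear_add[OF l] flip: sum.distrib)
    show "tensor_lift U V (G (vscale X c x)) t = vscale W c (tensor_lift U V (G x) t)"
      if "x \<in> vcarrier X" for x c
      using that by (simp add: e kspace_closed[OF X] klinear_scale[OF l] kspace_scale[OF assms(3)])
  qed
qed

lemma tensor_lift_plus:
  assumes "kspace U" "kspace V" "kspace W" "kbilinear U V W F" "kbilinear U V W G"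
    "t \<in> vcarrier (tensor_space U V)"
  shows "tensor_lift U V (\<lambda>x y. F x y + G x y) t = tensor_lift U V F t + tensor_lift U V G t"
proof -
  have b: "kbilinear U V W (\<lambda>x y. F x y + G x y)"
    using assms by (auto intro!: kbilinearI klinear_plus simp: kbilinear_def)
  obtain n :: nat and p q where n: "\<forall>i<n. p i \<in> vcarrier U \<and> q i \<in> vcarrier V"
    and t: "t = (\<Sum>i<n. p i \<otimes>\<^bsub>U,V\<^esub> q i)" by (rule tensor_space_sum[OF assms(1,6)])
  show ?thesis
    unfolding t tensor_lift_sum[OF assms(1-3) b n] tensor_lift_sum[OF assms(1-3,4) n]
      tensor_lift_sum[OF assms(1-3,5) n] by (rule sum.distrib)
qed

text \<open>
  After decomposing both tensors, this is the exchange of two finite sums.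
\<close>

lemma tensor_lift_swap:
  assumes "kspace U" "kspace V" "kspace U'" "kspace V'" "kspace W"
    and t: "t \<in> vcarrier (tensor_space U V)" and s: "s \<in> vcarrier (tensor_space U' V')"
    and l1: "\<And>y p q. y \<in> vcarrier V \<Longrightarrow> p \<in> vcarrier U' \<Longrightarrow> q \<in> vcarrier V' \<Longrightarrow> klinear U W (\<lambda>x. F x y p q)"
    and l2: "\<And>x p q. x \<in> vcarrier U \<Longrightarrow> p \<in> vcarrier U' \<Longrightarrow> q \<in> vcarrier V' \<Longrightarrow> klinear V W (\<lambda>y. F x y p q)"
    and l3: "\<And>x y q. x \<in> vcarrier U \<Longrightarrow> y \<in> vcarrier V \<Longrightarrow> q \<in> vcarrier V' \<Longrightarrow> klinear U' W (\<lambda>p. F x y p q)"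
    and l4: "\<And>x y p. x \<in> vcarrier U \<Longrightarrow> y \<in> vcarrier V \<Longrightarrow> p \<in> vcarrier U' \<Longrightarrow> klinear V' W (\<lambda>q. F x y p q)"
  shows "tensor_lift U V (\<lambda>x y. tensor_lift U' V' (\<lambda>p q. F x y p q) s) t =
    tensor_lift U' V' (\<lambda>p q. tensor_lift U V (\<lambda>x y. F x y p q) t) s"
proof -
  obtain n :: nat and x y where n: "\<forall>i<n. x i \<in> vcarrier U \<and> y i \<in> vcarrier V"
    and t': "t = (\<Sum>i<n. x i \<otimes>\<^bsub>U,V\<^esub> y i)" by (rule tensor_space_sum[OF assms(1) t])
  obtain m :: nat and p q where m: "\<forall>i<m. p i \<in> vcarrier U' \<and> q i \<in> vcarrier V'"
    and s': "s = (\<Sum>i<m. p i \<otimes>\<^bsub>U',V'\<^esub> q i)" by (rule tensor_space_sum[OF assms(3) s])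
  have b1: "kbilinear U V W (\<lambda>x y. tensor_lift U' V' (\<lambda>p q. F x y p q) s)"
    by (intro kbilinearI klinear_tensor_lift_param assms(1-5) s l1 l2 l3 l4)
  have b2: "kbilinear U' V' W (\<lambda>p q. tensor_lift U V (\<lambda>x y. F x y p q) t)"
    by (intro kbilinearI klinear_tensor_lift_param assms(1-5) t l1 l2 l3 l4)
  have b3: "kbilinear U' V' W (\<lambda>p q. F x y p q)" if "x \<in> vcarrier U" "y \<in> vcarrier V" for x y
    by (intro kbilinearI that l3 l4)
  have b4: "kbilinear U V W (\<lambda>x y. F x y p q)" if "p \<in> vcarrier U'" "q \<in> vcarrier V'" for p q
    by (intro kbilinearI that l1 l2)
  have "tensor_lift U V (\<lambda>x y. tensor_lift U' V' (\<lambda>p q. F x y p q) s) t =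
      (\<Sum>i<n. \<Sum>j<m. F (x i) (y i) (p j) (q j))"
    unfolding t' tensor_lift_sum[OF assms(1,2,5) b1 n]
  proof (intro sum.cong refl)
    fix i assume "i \<in> {..<n}"
    then show "tensor_lift U' V' (\<lambda>p q. F (x i) (y i) p q) s = (\<Sum>j<m. F (x i) (y i) (p j) (q j))"
      unfolding s' using n by (intro tensor_lift_sum[OF assms(3,4,5) b3 m]) auto
  qed
  also have "\<dots> = (\<Sum>j<m. \<Sum>i<n. F (x i) (y i) (p j) (q j))"
    by (rule sum.swap)
  also have "\<dots> = tensor_lift U' V' (\<lambda>p q. tensor_lift U V (\<lambda>x y. F x y p q) t) s"
    unfolding s' tensor_lift_sum[OF assms(3,4,5) b2 m]
  proof (intro sum.cong refl)
    fix j assume "j \<in> {..<m}"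
    then show "(\<Sum>i<n. F (x i) (y i) (p j) (q j)) = tensor_lift U V (\<lambda>x y. F x y (p j) (q j)) t"
      unfolding t' using m by (intro tensor_lift_sum[OF assms(1,2,5) b4 n, symmetric]) auto
  qed
  finally show ?thesis .
qed


section \<open>Coalgebras and Sweedler notation\<close>

lemma coalgebraD:
  assumes "coalgebra H"
  shows "kspace H" and "klinear H (tensor_space H H) (hcomult H)" and "klinear H base_field (hcounit H)"
    and "h \<in> vcarrier H \<Longrightarrow> hcomult H h \<in> vcarrier (tensor_space H H)"
  using assms by (auto simp: coalgebra_def intro: klinear_in)

lemma sweedler_cong:
  assumes "\<And>p q. p \<in> vcarrier H \<Longrightarrow> q \<in> vcarrier H \<Longrightarrow> F p q = G p q"
  shows "sweedler H h F = sweedler H h G"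
  unfolding sweedler_def by (rule tensor_lift_cong) (rule assms)

lemma sweedler_closed:
  assumes "coalgebra H" "kspace W" "h \<in> vcarrier H" "kbilinear H H W F"
  shows "sweedler H h F \<in> vcarrier W"
  unfolding sweedler_def by (intro tensor_lift_closed coalgebraD assms)

lemma klinear_counit: "coalgebra H \<Longrightarrow> klinear X H u \<Longrightarrow> klinear X base_field (\<lambda>x. hcounit H (u x))"
  by (rule klinear_comp[OF coalgebraD(3)])

lemma klinear_sweedler:
  assumes "coalgebra H" "kspace W" "klinear X H u" "kbilinear H H W F"
  shows "klinear X W (\<lambda>x. sweedler H (u x) F)"
  unfolding sweedler_def
  by (intro klinear_tensor_lift klinear_comp[OF coalgebraD(2)] coalgebraD(1) assms)

lemma klinear_sweedler_param:
  assumes "coalgebra H" "kspace W" "kspace X" "h \<in> vcarrier H"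
    and "\<And>x. x \<in> vcarrier X \<Longrightarrow> kbilinear H H W (G x)"
    and "\<And>p q. p \<in> vcarrier H \<Longrightarrow> q \<in> vcarrier H \<Longrightarrow> klinear X W (\<lambda>x. G x p q)"
  shows "klinear X W (\<lambda>x. sweedler H h (G x))"
  unfolding sweedler_def by (intro klinear_tensor_lift_param coalgebraD assms)

lemma sweedler_tens:
  assumes C: "coalgebra H" and h: "h \<in> vcarrier H"
  shows "sweedler H h (\<lambda>p q. p \<otimes>\<^bsub>H,H\<^esub> q) = hcomult H h"
  unfolding sweedler_def
  by (rule tensor_lift_universal(2)[OF coalgebraD(1)[OF C] coalgebraD(1)[OF C] kspace_tensor_space
        kbilinear_tens klinear_id refl coalgebraD(4)[OF C h], symmetric])

lemma sweedler_push:
  assumes "coalgebra H" "kspace W" "kspace W'" "h \<in> vcarrier H" "kbilinear H H W F" "klinear W W' L"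
  shows "L (sweedler H h F) = sweedler H h (\<lambda>p q. L (F p q))"
  unfolding sweedler_def
  by (rule klinear_tensor_lift_push[where W = W and W' = W']) (intro coalgebraD assms)+

lemma sweedler_plus:
  assumes "coalgebra H" "kspace W" "h \<in> vcarrier H" "kbilinear H H W F" "kbilinear H H W G"
  shows "sweedler H h (\<lambda>p q. F p q + G p q) = sweedler H h F + sweedler H h G"
  unfolding sweedler_def
  by (rule tensor_lift_plus[where W = W]) (intro coalgebraD assms)+

lemma sweedler_swap:
  assumes "coalgebra H" "coalgebra K" "kspace W" "h \<in> vcarrier H" "k \<in> vcarrier K"
    and "\<And>y p q. y \<in> vcarrier H \<Longrightarrow> p \<in> vcarrier K \<Longrightarrow> q \<in> vcarrier K \<Longrightarrow> klinear H W (\<lambda>x. F x y p q)"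
    and "\<And>x p q. x \<in> vcarrier H \<Longrightarrow> p \<in> vcarrier K \<Longrightarrow> q \<in> vcarrier K \<Longrightarrow> klinear H W (\<lambda>y. F x y p q)"
    and "\<And>x y q. x \<in> vcarrier H \<Longrightarrow> y \<in> vcarrier H \<Longrightarrow> q \<in> vcarrier K \<Longrightarrow> klinear K W (\<lambda>p. F x y p q)"
    and "\<And>x y p. x \<in> vcarrier H \<Longrightarrow> y \<in> vcarrier H \<Longrightarrow> p \<in> vcarrier K \<Longrightarrow> klinear K W (\<lambda>q. F x y p q)"
  shows "sweedler H h (\<lambda>x y. sweedler K k (F x y)) = sweedler K k (\<lambda>p q. sweedler H h (\<lambda>x y. F x y p q))"
  unfolding sweedler_def
  using tensor_lift_swap[where W = W, OF coalgebraD(1)[OF assms(1)] coalgebraD(1)[OF assms(1)]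
      coalgebraD(1)[OF assms(2)] coalgebraD(1)[OF assms(2)] assms(3) coalgebraD(4)[OF assms(1,4)]
      coalgebraD(4)[OF assms(2,5)], of F] assms(6-9) by simp

text \<open>
  The rules of \<open>klin\<close> together with those for expressions in Sweedler notation.
\<close>

lemmas slin = klin klinear_counit klinear_sweedler klinear_sweedler_param sweedler_closed coalgebraD(1)

text \<open>
  The coassociativity axiom of a coalgebra is the case of the universal trilinear map, with values in
  the triple tensor product. The linear map induced by \<open>K\<close> carries it to arbitrary trilinear maps.
\<close>

lemma sweedler_coassoc:
  assumes C: "coalgebra H" and W: "kspace W" and h: "h \<in> vcarrier H"
    and K1: "\<And>q r. q \<in> vcarrier H \<Longrightarrow> r \<in> vcarrier H \<Longrightarrow> klinear H W (\<lambda>p. K p q r)"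
    and K2: "\<And>p r. p \<in> vcarrier H \<Longrightarrow> r \<in> vcarrier H \<Longrightarrow> klinear H W (\<lambda>q. K p q r)"
    and K3: "\<And>p q. p \<in> vcarrier H \<Longrightarrow> q \<in> vcarrier H \<Longrightarrow> klinear H W (\<lambda>r. K p q r)"
  shows "sweedler H h (\<lambda>u r. sweedler H u (\<lambda>p q. K p q r)) =
    sweedler H h (\<lambda>p u. sweedler H u (\<lambda>q r. K p q r))"
proof -
  note kH = coalgebraD(1)[OF C]
  let ?T2 = "tensor_space H H" and ?T3 = "tensor_space (tensor_space H H) H"
  have b2: "kbilinear H H W (\<lambda>p q. K p q r)" if "r \<in> vcarrier H" for r
    by (intro kbilinearI K1 K2 that)
  have b3: "kbilinear ?T2 H W (\<lambda>t r. tensor_lift H H (\<lambda>p q. K p q r) t)"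
    by (intro kbilinearI klinear_tensor_lift_param klinear_tensor_lift klinear_id kH W b2 K3)
  define L where "L = tensor_lift ?T2 H (\<lambda>t r. tensor_lift H H (\<lambda>p q. K p q r) t)"
  have L: "klinear ?T3 W L"
    unfolding L_def by (intro tensor_lift_universal(1) kspace_tensor_space kH W b3)
  have Lt: "L ((p \<otimes>\<^bsub>H,H\<^esub> q) \<otimes>\<^bsub>?T2,H\<^esub> r) = K p q r"
    if "p \<in> vcarrier H" "q \<in> vcarrier H" "r \<in> vcarrier H" for p q r
    unfolding L_def using that
    by (simp add: tensor_lift_tens[OF kspace_tensor_space kH W b3] tens_closed
        tensor_lift_tens[OF kH kH W b2])
  have left: "L (sweedler H h (\<lambda>u r. sweedler H u (\<lambda>p q. (p \<otimes>\<^bsub>H,H\<^esub> q) \<otimes>\<^bsub>?T2,H\<^esub> r))) =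
      sweedler H h (\<lambda>u r. L (sweedler H u (\<lambda>p q. (p \<otimes>\<^bsub>H,H\<^esub> q) \<otimes>\<^bsub>?T2,H\<^esub> r)))"
    by (rule sweedler_push[OF C _ W h _ L]) (rule slin C | assumption)+
  have right: "L (sweedler H h (\<lambda>p u. sweedler H u (\<lambda>q r. (p \<otimes>\<^bsub>H,H\<^esub> q) \<otimes>\<^bsub>?T2,H\<^esub> r))) =
      sweedler H h (\<lambda>p u. L (sweedler H u (\<lambda>q r. (p \<otimes>\<^bsub>H,H\<^esub> q) \<otimes>\<^bsub>?T2,H\<^esub> r)))"
    by (rule sweedler_push[OF C _ W h _ L]) (rule slin C | assumption)+
  have left': "L (sweedler H u (\<lambda>p q. (p \<otimes>\<^bsub>H,H\<^esub> q) \<otimes>\<^bsub>?T2,H\<^esub> r)) = sweedler H u (\<lambda>p q. K p q r)"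
    if "u \<in> vcarrier H" "r \<in> vcarrier H" for u r
  proof -
    have "L (sweedler H u (\<lambda>p q. (p \<otimes>\<^bsub>H,H\<^esub> q) \<otimes>\<^bsub>?T2,H\<^esub> r)) =
        sweedler H u (\<lambda>p q. L ((p \<otimes>\<^bsub>H,H\<^esub> q) \<otimes>\<^bsub>?T2,H\<^esub> r))"
      by (rule sweedler_push[OF C _ W that(1) _ L]) (rule slin C that | assumption)+
    then show ?thesis
      using that by (simp add: Lt cong: sweedler_cong)
  qed
  have right': "L (sweedler H u (\<lambda>q r. (p \<otimes>\<^bsub>H,H\<^esub> q) \<otimes>\<^bsub>?T2,H\<^esub> r)) = sweedler H u (\<lambda>q r. K p q r)"
    if "u \<in> vcarrier H" "p \<in> vcarrier H" for u p
  proof -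
    have "L (sweedler H u (\<lambda>q r. (p \<otimes>\<^bsub>H,H\<^esub> q) \<otimes>\<^bsub>?T2,H\<^esub> r)) =
        sweedler H u (\<lambda>q r. L ((p \<otimes>\<^bsub>H,H\<^esub> q) \<otimes>\<^bsub>?T2,H\<^esub> r))"
      by (rule sweedler_push[OF C _ W that(1) _ L]) (rule slin C that | assumption)+
    then show ?thesis
      using that by (simp add: Lt cong: sweedler_cong)
  qed
  have "L (sweedler H h (\<lambda>u r. sweedler H u (\<lambda>p q. (p \<otimes>\<^bsub>H,H\<^esub> q) \<otimes>\<^bsub>?T2,H\<^esub> r))) =
      L (sweedler H h (\<lambda>p u. sweedler H u (\<lambda>q r. (p \<otimes>\<^bsub>H,H\<^esub> q) \<otimes>\<^bsub>?T2,H\<^esub> r)))"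
    using C h by (simp add: coalgebra_def)
  then show ?thesis
    unfolding left right by (simp add: left' right' cong: sweedler_cong)
qed

text \<open>
  A linear map \<open>L\<close> may be moved inside the counit axioms.
\<close>

lemma sweedler_counit:
  assumes C: "coalgebra H" and W: "kspace W" and h: "h \<in> vcarrier H" and L: "klinear H W L"
  shows "sweedler H h (\<lambda>p q. vscale W (hcounit H p) (L q)) = L h"
    and "sweedler H h (\<lambda>p q. vscale W (hcounit H q) (L p)) = L h"
proof -
  note kH = coalgebraD(1)[OF C]
  have "L (sweedler H h (\<lambda>p q. vscale H (hcounit H p) q)) =
      sweedler H h (\<lambda>p q. L (vscale H (hcounit H p) q))"
    by (rule sweedler_push[OF C _ W h _ L]) (rule slin C | assumption)+
  moreover have "L (sweedler H h (\<lambda>p q. vscale H (hcounit H q) p)) =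
      sweedler H h (\<lambda>p q. L (vscale H (hcounit H q) p))"
    by (rule sweedler_push[OF C _ W h _ L]) (rule slin C | assumption)+
  ultimately show "sweedler H h (\<lambda>p q. vscale W (hcounit H p) (L q)) = L h"
    "sweedler H h (\<lambda>p q. vscale W (hcounit H q) (L p)) = L h"
    using C h by (simp_all add: coalgebra_def klinear_scale[OF L] cong: sweedler_cong)
qed

lemma bialgebraD:
  assumes "bialgebra H"
  shows "algebra H" "coalgebra H" "kspace H" "kbilinear H H H (hmult H)" "hone H \<in> vcarrier H"
    "hcomult H (hone H) = hone H \<otimes>\<^bsub>H,H\<^esub> hone H" "hcounit H (hone H) = 1"
    "x \<in> vcarrier H \<Longrightarrow> y \<in> vcarrier H \<Longrightarrow> hmult H x y \<in> vcarrier H"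
    "x \<in> vcarrier H \<Longrightarrow> y \<in> vcarrier H \<Longrightarrow> hcounit H (x \<cdot>\<^bsub>H\<^esub> y) = hcounit H x * hcounit H y"
    "x \<in> vcarrier H \<Longrightarrow> y \<in> vcarrier H \<Longrightarrow> z \<in> vcarrier H \<Longrightarrow> x \<cdot>\<^bsub>H\<^esub> (y \<cdot>\<^bsub>H\<^esub> z) = (x \<cdot>\<^bsub>H\<^esub> y) \<cdot>\<^bsub>H\<^esub> z"
    "x \<in> vcarrier H \<Longrightarrow> hone H \<cdot>\<^bsub>H\<^esub> x = x"
    "x \<in> vcarrier H \<Longrightarrow> x \<cdot>\<^bsub>H\<^esub> hone H = x"
  using assms by (auto simp: bialgebra_def algebra_def kbilinearD)

text \<open>
  The multiplicativity of the comultiplication, transported along the linear map that \<open>F\<close> induces on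
  the tensor square.
\<close>

lemma sweedler_mult:
  assumes B: "bialgebra H" and W: "kspace W" and x: "x \<in> vcarrier H" and y: "y \<in> vcarrier H"
    and F: "kbilinear H H W F"
  shows "sweedler H (x \<cdot>\<^bsub>H\<^esub> y) F =
    sweedler H x (\<lambda>x1 x2. sweedler H y (\<lambda>y1 y2. F (x1 \<cdot>\<^bsub>H\<^esub> y1) (x2 \<cdot>\<^bsub>H\<^esub> y2)))"
proof -
  note C = bialgebraD(2)[OF B] and k = bialgebraD(3)[OF B]
  note m = klinear_bilinear_left[OF bialgebraD(4)[OF B]] klinear_bilinear_right[OF bialgebraD(4)[OF B]]
    bialgebraD(8)[OF B]
  have L: "klinear (tensor_space H H) W (tensor_lift H H F)"
    by (rule tensor_lift_universal(1)[OF k k W F])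
  have 1: "tensor_lift H H F (sweedler H x (\<lambda>x1 x2. sweedler H y (\<lambda>y1 y2. (x1 \<cdot>\<^bsub>H\<^esub> y1) \<otimes>\<^bsub>H,H\<^esub> (x2 \<cdot>\<^bsub>H\<^esub> y2)))) =
      sweedler H x (\<lambda>x1 x2. tensor_lift H H F (sweedler H y (\<lambda>y1 y2. (x1 \<cdot>\<^bsub>H\<^esub> y1) \<otimes>\<^bsub>H,H\<^esub> (x2 \<cdot>\<^bsub>H\<^esub> y2))))"
    by (rule sweedler_push[OF C _ W x _ L]) (rule slin C m y | assumption)+
  have 2: "tensor_lift H H F (sweedler H y (\<lambda>y1 y2. (x1 \<cdot>\<^bsub>H\<^esub> y1) \<otimes>\<^bsub>H,H\<^esub> (x2 \<cdot>\<^bsub>H\<^esub> y2))) =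
      sweedler H y (\<lambda>y1 y2. F (x1 \<cdot>\<^bsub>H\<^esub> y1) (x2 \<cdot>\<^bsub>H\<^esub> y2))"
    if "x1 \<in> vcarrier H" "x2 \<in> vcarrier H" for x1 x2
  proof -
    have "tensor_lift H H F (sweedler H y (\<lambda>y1 y2. (x1 \<cdot>\<^bsub>H\<^esub> y1) \<otimes>\<^bsub>H,H\<^esub> (x2 \<cdot>\<^bsub>H\<^esub> y2))) =
        sweedler H y (\<lambda>y1 y2. tensor_lift H H F ((x1 \<cdot>\<^bsub>H\<^esub> y1) \<otimes>\<^bsub>H,H\<^esub> (x2 \<cdot>\<^bsub>H\<^esub> y2)))"
      by (rule sweedler_push[OF C _ W y _ L]) (rule slin C m that | assumption)+
    then show ?thesis
      using that by (simp add: tensor_lift_tens[OF k k W F] m cong: sweedler_cong)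
  qed
  have "sweedler H (x \<cdot>\<^bsub>H\<^esub> y) F = tensor_lift H H F
      (sweedler H x (\<lambda>x1 x2. sweedler H y (\<lambda>y1 y2. (x1 \<cdot>\<^bsub>H\<^esub> y1) \<otimes>\<^bsub>H,H\<^esub> (x2 \<cdot>\<^bsub>H\<^esub> y2))))"
    using B x y by (simp add: sweedler_def[of H "x \<cdot>\<^bsub>H\<^esub> y"] bialgebra_def)
  then show ?thesis
    by (simp add: 1 2 cong: sweedler_cong)
qed


section \<open>The tensor product coalgebra\<close>

text \<open>
  A Hopf algebra record and the underlying vector space record have different types but the same carrier
  and scalar multiplication. Linear notions depend on these two components only, so crossed products can
  be treated as the vector space \<open>A \<otimes> H\<close>.
\<close>

lemma space_cong:
  fixes X :: "('k::field, 'v::ab_group_add, 'm) vspace_scheme"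
    and Y :: "('k, 'v, 'n) vspace_scheme"
  assumes "vcarrier X = vcarrier Y" "vscale X = vscale Y"
  shows "kspace X = kspace Y"
    and "klinear X V f = klinear Y V f" and "klinear V X f' = klinear V Y f'"
    and "kbilinear X V W g = kbilinear Y V W g" and "kbilinear V X W g' = kbilinear V Y W g'"
    and "kbilinear V W X g'' = kbilinear V W Y g''"
  using assms by (simp_all add: kspace_def klinear_def kbilinear_def)

lemma tensor_space_cong:
  fixes X :: "('k::field, 'v::ab_group_add, 'm) vspace_scheme"
    and Y :: "('k, 'v, 'n) vspace_scheme"
  assumes "vcarrier X = vcarrier Y" "vscale X = vscale Y"
  shows "tens a X V b = tens a Y V b" and "tens c V X d = tens c V Y d"
    and "tensor_space X V = tensor_space Y V" and "tensor_space V X = tensor_space V Y"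
    and "tensor_lift X V F = tensor_lift Y V F" and "tensor_lift V X G = tensor_lift V Y G"
proof -
  note c = space_cong[OF assms]
  have t: "tens a X V b = tens a Y V b" "tens c V X d = tens c V Y d" for a b c d
    by (simp_all add: tens_def c)
  then show "tens a X V b = tens a Y V b" "tens c V X d = tens c V Y d" by auto
  show "tensor_space X V = tensor_space Y V" "tensor_space V X = tensor_space V Y"
    by (simp_all add: tensor_space_def t assms)
  show "tensor_lift X V F = tensor_lift Y V F" "tensor_lift V X G = tensor_lift V Y G"
    by (simp_all add: tensor_lift_def[abs_def] t assms)
qed

lemma kbilinear_tensor_comult:
  assumes "coalgebra A" "coalgebra H"
  shows "kbilinear A H (tensor_space (tensor_space A H) (tensor_space A H))
    (\<lambda>a h. sweedler A a (\<lambda>a1 a2. sweedler H h (\<lambda>h1 h2.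
     (a1 \<otimes>\<^bsub>A,H\<^esub> h1) \<otimes>\<^bsub>tensor_space A H,tensor_space A H\<^esub> (a2 \<otimes>\<^bsub>A,H\<^esub> h2))))"
  by (rule slin assms | assumption)+

lemma klinear_tensor_comult:
  assumes "coalgebra A" "coalgebra H"
  shows "klinear (tensor_space A H) (tensor_space (tensor_space A H) (tensor_space A H))
    (tensor_comult A H)"
  unfolding tensor_comult_def
  by (intro tensor_lift_universal(1) coalgebraD assms kspace_tensor_space
      kbilinear_tensor_comult)

lemma klinear_tensor_counit:
  assumes "coalgebra A" "coalgebra H"
  shows "klinear (tensor_space A H) base_field (tensor_counit A H)"
  unfolding tensor_counit_def
  by (intro tensor_lift_universal(1) coalgebraD assms) (rule slin assms | assumption)+

lemma tensor_counit_tens: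
  assumes "coalgebra A" "coalgebra H" "a \<in> vcarrier A" "h \<in> vcarrier H"
  shows "tensor_counit A H (a \<otimes>\<^bsub>A,H\<^esub> h) = hcounit A a * hcounit H h"
  unfolding tensor_counit_def
  by (rule tensor_lift_tens[OF _ _ kspace_base_field]) (rule slin assms | assumption)+

text \<open>
  All crossed products of \<open>A\<close> and \<open>H\<close> satisfy this condition, as does their tensor product. Facts about
  the comultiplication are derived from it, independently of any multiplication.
\<close>

definition has_tensor_coalgebra :: "('k::field, 'a::ab_group_add, 'm) hopf_scheme \<Rightarrow>
    ('k, 'h::ab_group_add, 'n) hopf_scheme \<Rightarrow> ('k, ('k, 'a, 'h) tensor) hopf \<Rightarrow> bool" where
  "has_tensor_coalgebra A H X \<longleftrightarrow>
     vcarrier X = vcarrier (tensor_space A H) \<and> vscale X = vscale (tensor_space A H) \<and>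
     hcomult X = tensor_comult A H \<and> hcounit X = tensor_counit A H"

lemma has_tensor_coalgebraD:
  assumes "has_tensor_coalgebra A H X"
  shows "vcarrier X = vcarrier (tensor_space A H)" "vscale X = vscale (tensor_space A H)"
    "hcomult X = tensor_comult A H" "hcounit X = tensor_counit A H"
  using assms by (auto simp: has_tensor_coalgebra_def)

lemma sweedler_tensor_coalgebra:
  assumes X: "has_tensor_coalgebra A H X" and A: "coalgebra A" and H: "coalgebra H"
    and W: "kspace W" and a: "a \<in> vcarrier A" and h: "h \<in> vcarrier H"
    and F: "kbilinear (tensor_space A H) (tensor_space A H) W F"
  shows "sweedler X (a \<otimes>\<^bsub>A,H\<^esub> h) F =
    sweedler A a (\<lambda>a1 a2. sweedler H h (\<lambda>h1 h2. F (a1 \<otimes>\<^bsub>A,H\<^esub> h1) (a2 \<otimes>\<^bsub>A,H\<^esub> h2)))"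
proof -
  let ?T = "tensor_space A H"
  note XT = has_tensor_coalgebraD[OF X]
  note c = tensor_space_cong[OF XT(1,2)]
  have L: "klinear (tensor_space ?T ?T) W (tensor_lift ?T ?T F)"
    by (intro tensor_lift_universal(1) kspace_tensor_space W F)
  have 1: "tensor_comult A H (a \<otimes>\<^bsub>A,H\<^esub> h) = sweedler A a (\<lambda>a1 a2. sweedler H h (\<lambda>h1 h2.
     (a1 \<otimes>\<^bsub>A,H\<^esub> h1) \<otimes>\<^bsub>?T,?T\<^esub> (a2 \<otimes>\<^bsub>A,H\<^esub> h2)))"
    unfolding tensor_comult_def
    by (rule tensor_lift_tens[OF coalgebraD(1)[OF A] coalgebraD(1)[OF H] kspace_tensor_space
          kbilinear_tensor_comult[OF A H] a h])
  have 2: "tensor_lift ?T ?T F (sweedler A a (\<lambda>a1 a2. sweedler H h (\<lambda>h1 h2.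
     (a1 \<otimes>\<^bsub>A,H\<^esub> h1) \<otimes>\<^bsub>?T,?T\<^esub> (a2 \<otimes>\<^bsub>A,H\<^esub> h2)))) =
     sweedler A a (\<lambda>a1 a2. tensor_lift ?T ?T F (sweedler H h (\<lambda>h1 h2.
     (a1 \<otimes>\<^bsub>A,H\<^esub> h1) \<otimes>\<^bsub>?T,?T\<^esub> (a2 \<otimes>\<^bsub>A,H\<^esub> h2))))"
    by (rule sweedler_push[OF A _ W a _ L]) (rule slin A H h | assumption)+
  have 3: "tensor_lift ?T ?T F (sweedler H h (\<lambda>h1 h2.
     (a1 \<otimes>\<^bsub>A,H\<^esub> h1) \<otimes>\<^bsub>?T,?T\<^esub> (a2 \<otimes>\<^bsub>A,H\<^esub> h2))) =
     sweedler H h (\<lambda>h1 h2. F (a1 \<otimes>\<^bsub>A,H\<^esub> h1) (a2 \<otimes>\<^bsub>A,H\<^esub> h2))"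
    if "a1 \<in> vcarrier A" "a2 \<in> vcarrier A" for a1 a2
  proof -
    have "tensor_lift ?T ?T F (sweedler H h (\<lambda>h1 h2.
       (a1 \<otimes>\<^bsub>A,H\<^esub> h1) \<otimes>\<^bsub>?T,?T\<^esub> (a2 \<otimes>\<^bsub>A,H\<^esub> h2))) =
       sweedler H h (\<lambda>h1 h2. tensor_lift ?T ?T F ((a1 \<otimes>\<^bsub>A,H\<^esub> h1) \<otimes>\<^bsub>?T,?T\<^esub> (a2 \<otimes>\<^bsub>A,H\<^esub> h2)))"
      by (rule sweedler_push[OF H _ W h _ L]) (rule slin A H that | assumption)+
    then show ?thesis
      using that by (simp add: tensor_lift_tens[OF kspace_tensor_space kspace_tensor_space W F]
          tens_closed cong: sweedler_cong)
  qed
  have "sweedler X (a \<otimes>\<^bsub>A,H\<^esub> h) F = tensor_lift ?T ?T F (tensor_comult A H (a \<otimes>\<^bsub>A,H\<^esub> h))"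
    by (simp add: sweedler_def XT c)
  then show ?thesis
    by (simp add: 1 2 3 cong: sweedler_cong)
qed

lemma klinear_sweedler_tensor_coalgebra:
  assumes X: "has_tensor_coalgebra A H X" and A: "coalgebra A" and H: "coalgebra H"
    and W: "kspace W" and "klinear Y (tensor_space A H) u" "kbilinear (tensor_space A H) (tensor_space A H) W F"
  shows "klinear Y W (\<lambda>x. sweedler X (u x) F)"
proof -
  note XT = has_tensor_coalgebraD[OF X]
  show ?thesis
    unfolding sweedler_def tensor_space_cong[OF XT(1,2)] XT(3)
    by (intro klinear_tensor_lift kspace_tensor_space W assms
        klinear_comp[OF klinear_tensor_comult])
qed

lemma klinear_sweedler_tensor_coalgebra_param:
  assumes X: "has_tensor_coalgebra A H X" and A: "coalgebra A" and H: "coalgebra H"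
    and W: "kspace W" and "kspace Y" and "t \<in> vcarrier (tensor_space A H)"
    and "\<And>x. x \<in> vcarrier Y \<Longrightarrow> kbilinear (tensor_space A H) (tensor_space A H) W (G x)"
    and "\<And>p q. p \<in> vcarrier (tensor_space A H) \<Longrightarrow> q \<in> vcarrier (tensor_space A H) \<Longrightarrow>
      klinear Y W (\<lambda>x. G x p q)"
  shows "klinear Y W (\<lambda>x. sweedler X t (G x))"
proof -
  note XT = has_tensor_coalgebraD[OF X]
  show ?thesis
    unfolding sweedler_def tensor_space_cong[OF XT(1,2)] XT(3)
    by (intro klinear_tensor_lift_param kspace_tensor_space assms
        klinear_in[OF klinear_tensor_comult])
qed

text \<open>
  Coassociativity: on a pure tensor, the iterated comultiplication is an iterated expression in
  Sweedler notation over \<open>A\<close> and \<open>H\<close>. Once the sums over \<open>A\<close> are moved to the outside, coassociativity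
  of \<open>A\<close> and of \<open>H\<close> apply separately.
\<close>

theorem coalgebra_tensor:
  assumes X: "has_tensor_coalgebra A H X" and A: "coalgebra A" and H: "coalgebra H"
  shows "coalgebra X"
proof -
  let ?T = "tensor_space A H"
  let ?T2 = "tensor_space ?T ?T"
  let ?T3 = "tensor_space ?T2 ?T"
  note XT = has_tensor_coalgebraD[OF X]
  note c = space_cong[OF XT(1,2)] tensor_space_cong[OF XT(1,2)]
  note kA = coalgebraD(1)[OF A] and kH = coalgebraD(1)[OF H]
  note tlin = klinear_sweedler_tensor_coalgebra[OF X A H]
    klinear_sweedler_tensor_coalgebra_param[OF X A H]
  note cong = sweedler_cong[where H = A] sweedler_cong[where H = H]
  let ?L = "\<lambda>t. sweedler X t (\<lambda>u t3. sweedler X u (\<lambda>t1 t2. (t1 \<otimes>\<^bsub>?T,?T\<^esub> t2) \<otimes>\<^bsub>?T2,?T\<^esub> t3))"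
  let ?R = "\<lambda>t. sweedler X t (\<lambda>t1 u. sweedler X u (\<lambda>t2 t3. (t1 \<otimes>\<^bsub>?T,?T\<^esub> t2) \<otimes>\<^bsub>?T2,?T\<^esub> t3))"
  have coassoc: "?L t = ?R t" if t: "t \<in> vcarrier ?T" for t
  proof (rule klinear_tensor_eqI[where f = ?L and g = ?R, OF kA kH _ _ _ _ t])
    show "kspace ?T3" by (rule kspace_tensor_space)
    show "klinear ?T ?T3 ?L" "klinear ?T ?T3 ?R"
      by (rule slin tlin | assumption)+
    fix a h assume a: "a \<in> vcarrier A" and h: "h \<in> vcarrier H"
    let ?K = "\<lambda>a1 h1 a2 h2 a3 h3. ((a1 \<otimes>\<^bsub>A,H\<^esub> h1) \<otimes>\<^bsub>?T,?T\<^esub> (a2 \<otimes>\<^bsub>A,H\<^esub> h2)) \<otimes>\<^bsub>?T2,?T\<^esub> (a3 \<otimes>\<^bsub>A,H\<^esub> h3)"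
    have "?L (a \<otimes>\<^bsub>A,H\<^esub> h) = sweedler A a (\<lambda>a' a3. sweedler H h (\<lambda>h' h3.
        sweedler X (a' \<otimes>\<^bsub>A,H\<^esub> h') (\<lambda>t1 t2. (t1 \<otimes>\<^bsub>?T,?T\<^esub> t2) \<otimes>\<^bsub>?T2,?T\<^esub> (a3 \<otimes>\<^bsub>A,H\<^esub> h3))))"
      by (rule sweedler_tensor_coalgebra[OF X A H _ a h]) (rule slin tlin | assumption)+
    also have "\<dots> = sweedler A a (\<lambda>a' a3. sweedler H h (\<lambda>h' h3.
        sweedler A a' (\<lambda>a1 a2. sweedler H h' (\<lambda>h1 h2. ?K a1 h1 a2 h2 a3 h3))))"
      by (rule cong sweedler_tensor_coalgebra[OF X A H] slin tlin | assumption)+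
    also have "\<dots> = sweedler A a (\<lambda>a' a3. sweedler A a' (\<lambda>a1 a2.
        sweedler H h (\<lambda>h' h3. sweedler H h' (\<lambda>h1 h2. ?K a1 h1 a2 h2 a3 h3))))"
      by (rule sweedler_cong, rule sweedler_swap[where W = ?T3])
        (rule A H slin tlin h | assumption)+
    also have "\<dots> = sweedler A a (\<lambda>a1 a'. sweedler A a' (\<lambda>a2 a3.
        sweedler H h (\<lambda>h' h3. sweedler H h' (\<lambda>h1 h2. ?K a1 h1 a2 h2 a3 h3))))"
      by (rule sweedler_coassoc[where W = ?T3]) (rule A H slin tlin a h | assumption)+
    also have "\<dots> = sweedler A a (\<lambda>a1 a'. sweedler A a' (\<lambda>a2 a3.
        sweedler H h (\<lambda>h1 h'. sweedler H h' (\<lambda>h2 h3. ?K a1 h1 a2 h2 a3 h3))))"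
      by (rule sweedler_cong, rule sweedler_cong, rule sweedler_coassoc[where W = ?T3])
        (rule A H slin tlin h | assumption)+
    also have "\<dots> = sweedler A a (\<lambda>a1 a'. sweedler H h (\<lambda>h1 h'.
        sweedler A a' (\<lambda>a2 a3. sweedler H h' (\<lambda>h2 h3. ?K a1 h1 a2 h2 a3 h3))))"
      by (rule sweedler_cong, rule sweedler_swap[where W = ?T3, symmetric])
        (rule A H slin tlin h | assumption)+
    also have "\<dots> = sweedler A a (\<lambda>a1 a'. sweedler H h (\<lambda>h1 h'.
        sweedler X (a' \<otimes>\<^bsub>A,H\<^esub> h') (\<lambda>t2 t3. ((a1 \<otimes>\<^bsub>A,H\<^esub> h1) \<otimes>\<^bsub>?T,?T\<^esub> t2) \<otimes>\<^bsub>?T2,?T\<^esub> t3)))"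
      by (rule cong sweedler_tensor_coalgebra[OF X A H, symmetric] slin tlin | assumption)+
    also have "\<dots> = ?R (a \<otimes>\<^bsub>A,H\<^esub> h)"
      by (rule sweedler_tensor_coalgebra[OF X A H _ a h, symmetric]) (rule slin tlin | assumption)+
    finally show "?L (a \<otimes>\<^bsub>A,H\<^esub> h) = ?R (a \<otimes>\<^bsub>A,H\<^esub> h)" .
  qed
  note cl = klinear_comp[OF klinear_tensor_counit[OF A H]]
  have counit: "sweedler X t (\<lambda>p q. vscale ?T (tensor_counit A H p) q) = t"
      "sweedler X t (\<lambda>p q. vscale ?T (tensor_counit A H q) p) = t" if t: "t \<in> vcarrier ?T" for t
  proof -
    have lin: "klinear ?T ?T (\<lambda>t. sweedler X t (\<lambda>p q. vscale ?T (tensor_counit A H p) q))"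
      "klinear ?T ?T (\<lambda>t. sweedler X t (\<lambda>p q. vscale ?T (tensor_counit A H q) p))"
      by (rule slin tlin cl | assumption)+
    have val: "sweedler X (a \<otimes>\<^bsub>A,H\<^esub> h) (\<lambda>p q. vscale ?T (tensor_counit A H p) q) = a \<otimes>\<^bsub>A,H\<^esub> h"
      "sweedler X (a \<otimes>\<^bsub>A,H\<^esub> h) (\<lambda>p q. vscale ?T (tensor_counit A H q) p) = a \<otimes>\<^bsub>A,H\<^esub> h"
      if a: "a \<in> vcarrier A" and h: "h \<in> vcarrier H" for a h
    proof -
      have s: "vscale ?T (c * d) (x \<otimes>\<^bsub>A,H\<^esub> y) = vscale ?T c (x \<otimes>\<^bsub>A,H\<^esub> vscale H d y)"
        if "x \<in> vcarrier A" "y \<in> vcarrier H" for c d x y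
        using that by (simp add: kbilinearD(5)[OF kbilinear_tens] kspace_scale[OF kspace_tensor_space])
      have "sweedler X (a \<otimes>\<^bsub>A,H\<^esub> h) (\<lambda>p q. vscale ?T (tensor_counit A H p) q) =
          sweedler A a (\<lambda>a1 a2. sweedler H h (\<lambda>h1 h2.
            vscale ?T (tensor_counit A H (a1 \<otimes>\<^bsub>A,H\<^esub> h1)) (a2 \<otimes>\<^bsub>A,H\<^esub> h2)))"
        by (rule sweedler_tensor_coalgebra[OF X A H _ a h]) (rule slin tlin cl | assumption)+
      also have "\<dots> = sweedler A a (\<lambda>a1 a2. sweedler H h (\<lambda>h1 h2.
            vscale ?T (hcounit H h1) (vscale ?T (hcounit A a1) (a2 \<otimes>\<^bsub>A,H\<^esub> h2))))"
        by (intro cong) (simp add: tensor_counit_tens[OF A H] kspace_scale[OF kspace_tensor_space]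
            mult.commute)
      also have "\<dots> = sweedler A a (\<lambda>a1 a2. vscale ?T (hcounit A a1) (a2 \<otimes>\<^bsub>A,H\<^esub> h))"
        by (rule cong, rule sweedler_counit(1)[OF H _ h, where W = ?T])
          (rule slin tlin cl | assumption)+
      also have "\<dots> = a \<otimes>\<^bsub>A,H\<^esub> h"
        by (rule sweedler_counit(1)[OF A _ a, where W = ?T]) (rule slin tlin h | assumption)+
      finally show "sweedler X (a \<otimes>\<^bsub>A,H\<^esub> h) (\<lambda>p q. vscale ?T (tensor_counit A H p) q) = a \<otimes>\<^bsub>A,H\<^esub> h" .
      have "sweedler X (a \<otimes>\<^bsub>A,H\<^esub> h) (\<lambda>p q. vscale ?T (tensor_counit A H q) p) =
          sweedler A a (\<lambda>a1 a2. sweedler H h (\<lambda>h1 h2.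
            vscale ?T (tensor_counit A H (a2 \<otimes>\<^bsub>A,H\<^esub> h2)) (a1 \<otimes>\<^bsub>A,H\<^esub> h1)))"
        by (rule sweedler_tensor_coalgebra[OF X A H _ a h]) (rule slin tlin cl | assumption)+
      also have "\<dots> = sweedler A a (\<lambda>a1 a2. sweedler H h (\<lambda>h1 h2.
            vscale ?T (hcounit H h2) (vscale ?T (hcounit A a2) (a1 \<otimes>\<^bsub>A,H\<^esub> h1))))"
        by (intro cong) (simp add: tensor_counit_tens[OF A H] kspace_scale[OF kspace_tensor_space]
            mult.commute)
      also have "\<dots> = sweedler A a (\<lambda>a1 a2. vscale ?T (hcounit A a2) (a1 \<otimes>\<^bsub>A,H\<^esub> h))"
        by (rule cong, rule sweedler_counit(2)[OF H _ h, where W = ?T])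
          (rule slin tlin cl | assumption)+
      also have "\<dots> = a \<otimes>\<^bsub>A,H\<^esub> h"
        by (rule sweedler_counit(2)[OF A _ a, where W = ?T]) (rule slin tlin h | assumption)+
      finally show "sweedler X (a \<otimes>\<^bsub>A,H\<^esub> h) (\<lambda>p q. vscale ?T (tensor_counit A H q) p) = a \<otimes>\<^bsub>A,H\<^esub> h" .
    qed
    show "sweedler X t (\<lambda>p q. vscale ?T (tensor_counit A H p) q) = t"
      by (rule klinear_tensor_eqI[OF kA kH kspace_tensor_space lin(1) klinear_id val(1) t])
    show "sweedler X t (\<lambda>p q. vscale ?T (tensor_counit A H q) p) = t"
      by (rule klinear_tensor_eqI[OF kA kH kspace_tensor_space lin(2) klinear_id val(2) t])
  qed
  show ?thesis
    unfolding coalgebra_def c XT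
    using coassoc counit klinear_tensor_comult[OF A H] klinear_tensor_counit[OF A H]
      kspace_tensor_space[of A H] by simp
qed


section \<open>Sweedler's Hopf algebra\<close>

lemma h4_space_simps: "vcarrier h4_space = UNIV" "vscale h4_space c v = (\<lambda>i. c * v i)"
  by (simp_all add: h4_space_def)

lemma H4_simps: "vcarrier H4 = UNIV" "vscale H4 c v = (\<lambda>i. c * v i)" "hone H4 = h4_vec B1"
  by (simp_all add: H4_def h4_space_def)

lemma kspace_H4: "kspace (H4 :: ('k::field, 'k h4) hopf)"
proof -
  have "vector_space (vscale (H4 :: ('k, 'k h4) hopf))"
    by unfold_locales (auto simp: H4_simps fun_eq_iff algebra_simps)
  then show ?thesis
    by (simp add: kspace_def H4_simps module.subspace_UNIV module_iff_vector_space)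
qed

lemma sum_h4_basis: "(\<Sum>i\<in>UNIV. u i) = u B1 + u Bg + u Bx + u Bgx"
  for u :: "h4_basis \<Rightarrow> 'w::comm_monoid_add"
  by (simp add: UNIV_h4_basis add.assoc)

lemma all_h4_basis: "(\<forall>i. P i) \<longleftrightarrow> P B1 \<and> P Bg \<and> P Bx \<and> P Bgx"
proof -
  have "(\<forall>i. P i) \<longleftrightarrow> (\<forall>i\<in>UNIV. P i)" by blast
  then show ?thesis unfolding UNIV_h4_basis by blast
qed

lemma h4_vec_apply: "h4_vec i j = (if j = i then 1 else 0)"
  by (simp add: h4_vec_def)

lemma h4_expand: "s = (\<Sum>i\<in>UNIV. vscale H4 (s i) (h4_vec i))" for s :: "'k::field h4"
  by (simp add: fun_eq_iff all_h4_basis sum_h4_basis H4_simps h4_vec_apply)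

lemma klinear_H4_expand:
  assumes "klinear H4 W f"
  shows "f s = (\<Sum>i\<in>UNIV. vscale W (s i) (f (h4_vec i)))"
proof -
  have "f s = f (\<Sum>i\<in>UNIV. vscale H4 (s i) (h4_vec i))"
    by (rule arg_cong[OF h4_expand])
  also have "\<dots> = (\<Sum>i\<in>UNIV. f (vscale H4 (s i) (h4_vec i)))"
    by (rule klinear_simps(3)[OF assms kspace_H4]) (simp_all add: H4_simps)
  also have "\<dots> = (\<Sum>i\<in>UNIV. vscale W (s i) (f (h4_vec i)))"
    by (intro sum.cong refl klinear_scale[OF assms]) (simp add: H4_simps)
  finally show ?thesis .
qed

text \<open>
  Together with its bilinear version, this reduces identities in \<open>H\<^sub>4\<close> to a case distinction on basis
  elements.
\<close>

lemma klinear_H4_eqI: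
  assumes "klinear H4 W f" "klinear H4 W g" "\<And>i. f (h4_vec i) = g (h4_vec i)"
  shows "f s = g s"
  by (simp add: klinear_H4_expand[OF assms(1), of s] klinear_H4_expand[OF assms(2), of s] assms(3))

lemma kbilinear_H4_eqI:
  assumes F: "\<And>t. klinear H4 W (\<lambda>s. F s t)" "\<And>s. klinear H4 W (\<lambda>t. F s t)"
    and G: "\<And>t. klinear H4 W (\<lambda>s. G s t)" "\<And>s. klinear H4 W (\<lambda>t. G s t)"
    and eq: "\<And>i j. F (h4_vec i) (h4_vec j) = G (h4_vec i) (h4_vec j)"
  shows "F s t = G s t"
proof (rule klinear_H4_eqI[OF F(1) G(1)])
  show "F (h4_vec i) t = G (h4_vec i) t" for i
    by (rule klinear_H4_eqI[OF F(2) G(2)]) (rule eq)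
qed

lemma klinear_sum:
  assumes "kspace W" "\<And>i. i \<in> I \<Longrightarrow> klinear U W (f i)"
  shows "klinear U W (\<lambda>x. \<Sum>i\<in>I. f i x)"
  using assms(2)
  by (induction I rule: infinite_finite_induct)
    (simp_all add: klinear_zero klinear_plus assms(1))

lemma klinear_H4_coord: "klinear H4 base_field (\<lambda>s. s i)"
  by (simp add: klinear_def H4_simps base_field_def)

lemma kbilinear_H4_table:
  assumes "kspace W" "\<And>i j. w i j \<in> vcarrier W"
  shows "kbilinear H4 H4 W (\<lambda>s t. \<Sum>i\<in>UNIV. \<Sum>j\<in>UNIV. vscale W (s i * t j) (w i j))"
  by (rule klin klinear_sum klinear_H4_coord assms)+

lemma klinear_H4_table:
  assumes "kspace W" "\<And>i. w i \<in> vcarrier W"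
  shows "klinear H4 W (\<lambda>s. \<Sum>i\<in>UNIV. vscale W (s i) (w i))"
  by (rule klin klinear_sum klinear_H4_coord assms)+

lemma H4_table_basis:
  assumes "kspace W"
  shows "(\<Sum>i\<in>UNIV. vscale W (h4_vec k i) (w i)) = w k"
    and "(\<Sum>i\<in>UNIV. \<Sum>j\<in>UNIV. vscale W (h4_vec k i * h4_vec l j) (w' i j)) = w' k l"
proof -
  show 1: "(\<Sum>i\<in>UNIV. vscale W (h4_vec k i) (w i)) = w k" for k w
    by (cases k) (simp_all add: sum_h4_basis h4_vec_apply kspace_scale[OF assms])
  have "(\<Sum>i\<in>UNIV. \<Sum>j\<in>UNIV. vscale W (h4_vec k i * h4_vec l j) (w' i j)) =
      (\<Sum>i\<in>UNIV. vscale W (h4_vec k i) (\<Sum>j\<in>UNIV. vscale W (h4_vec l j) (w' i j)))"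
    by (simp add: kspace_scale[OF assms])
  then show "(\<Sum>i\<in>UNIV. \<Sum>j\<in>UNIV. vscale W (h4_vec k i * h4_vec l j) (w' i j)) = w' k l"
    by (simp add: 1)
qed

text \<open>
  The comultiplication of a basis element is a sum of pure tensors of basis elements in which every
  coefficient is 1, so a list of pairs describes it. Sums over these lists are unfolded by
  simplification.
\<close>

fun h4_copairs :: "h4_basis \<Rightarrow> (h4_basis \<times> h4_basis) list" where
  "h4_copairs B1 = [(B1, B1)]"
| "h4_copairs Bg = [(Bg, Bg)]"
| "h4_copairs Bx = [(Bx, B1), (Bg, Bx)]"
| "h4_copairs Bgx = [(Bgx, Bg), (B1, Bgx)]"

lemma H4_tensor_space: "tensor_space h4_space h4_space = tensor_space H4 H4"
  and H4_tens: "x \<otimes>\<^bsub>h4_space,h4_space\<^esub> y = x \<otimes>\<^bsub>H4,H4\<^esub> y"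
proof -
  have "vcarrier h4_space = vcarrier H4" "vscale h4_space = vscale H4"
    by (simp_all add: fun_eq_iff H4_simps h4_space_simps)
  note c = tensor_space_cong[OF this]
  show "tensor_space h4_space h4_space = tensor_space H4 H4"
    "x \<otimes>\<^bsub>h4_space,h4_space\<^esub> y = x \<otimes>\<^bsub>H4,H4\<^esub> y" by (simp_all only: c)
qed

lemma h4_comult_table_copairs:
  "h4_comult_table i = (\<Sum>(p, q)\<leftarrow>h4_copairs i. h4_vec p \<otimes>\<^bsub>H4,H4\<^esub> h4_vec q)"
  by (cases i) (simp_all add: H4_tens)

lemma klinear_H4_comult:
  "klinear H4 (tensor_space H4 H4) (hcomult H4 :: 'k::field h4 \<Rightarrow> _)"
proof -
  have "klinear H4 (tensor_space H4 H4)
      (\<lambda>s :: 'k h4. \<Sum>i\<in>UNIV. vscale (tensor_space H4 H4) (s i) (h4_comult_table i))"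
  proof (rule klinear_H4_table[OF kspace_tensor_space])
    fix i show "h4_comult_table i \<in> vcarrier (tensor_space H4 H4)"
      by (cases i) (auto simp: H4_tens H4_simps intro!: kspace_closed[OF kspace_tensor_space] tens_closed)
  qed
  moreover have "hcomult H4 =
      (\<lambda>s :: 'k h4. \<Sum>i\<in>UNIV. vscale (tensor_space h4_space h4_space) (s i) (h4_comult_table i))"
    by (simp add: H4_def)
  ultimately show ?thesis by (simp only: H4_tensor_space)
qed

lemma hcomult_H4_basis:
  "hcomult H4 (h4_vec i) = (\<Sum>(p, q)\<leftarrow>h4_copairs i. h4_vec p \<otimes>\<^bsub>H4,H4\<^esub> h4_vec q)"
  unfolding h4_comult_table_copairs[symmetric]
  using H4_table_basis(1)[OF kspace_tensor_space, of h4_space h4_space i h4_comult_table]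
  by (simp add: H4_def)

lemma hcounit_H4_basis: "hcounit H4 (h4_vec i) = h4_counit_table i"
  by (cases i) (simp_all add: H4_def sum_h4_basis h4_vec_apply)

lemma hmult_H4_basis: "h4_vec i \<cdot>\<^bsub>H4\<^esub> h4_vec j = h4_mult_table i j"
  using H4_table_basis(2)[OF kspace_H4, of i j h4_mult_table]
  by (simp add: H4_def)

lemma klinear_H4_counit: "klinear H4 base_field (hcounit H4)"
  using klinear_H4_table[OF kspace_base_field, of h4_counit_table]
  by (simp add: base_field_def H4_def)

lemma kbilinear_H4_mult: "kbilinear H4 H4 H4 (hmult H4)"
  using kbilinear_H4_table[OF kspace_H4, of h4_mult_table]
  by (simp add: H4_def h4_space_def)

lemma sweedler_H4_basis:
  assumes W: "kspace W" and F: "kbilinear H4 H4 W F"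
  shows "sweedler H4 (h4_vec i) F = (\<Sum>(p, q)\<leftarrow>h4_copairs i. F (h4_vec p) (h4_vec q))"
proof -
  have l: "klinear (tensor_space H4 H4) W (tensor_lift H4 H4 F)"
    by (intro tensor_lift_universal(1) kspace_H4 W F)
  have t: "tensor_lift H4 H4 F (h4_vec p \<otimes>\<^bsub>H4,H4\<^esub> h4_vec q) = F (h4_vec p) (h4_vec q)" for p q
    by (rule tensor_lift_tens[OF kspace_H4 kspace_H4 W F]) (simp_all add: H4_simps)
  have c: "h4_vec p \<otimes>\<^bsub>H4,H4\<^esub> h4_vec q \<in> vcarrier (tensor_space H4 H4)" for p q
    by (rule tens_closed) (simp_all add: H4_simps)
  show ?thesis
    unfolding sweedler_def hcomult_H4_basis
    by (cases i) (simp_all add: klinear_add[OF l] t c)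
qed

lemma coalgebra_H4: "coalgebra (H4 :: ('k::field, 'k h4) hopf)"
proof -
  let ?T = "tensor_space (H4 :: ('k, 'k h4) hopf) H4"
  let ?T3 = "tensor_space ?T (H4 :: ('k, 'k h4) hopf)"
  have U: "h \<in> vcarrier H4" for h :: "'k h4" by (simp add: H4_simps)
  have sw1: "klinear X W (\<lambda>x. sweedler H4 (u x) F)"
    if "kspace W" "klinear X H4 u" "kbilinear H4 H4 W F" for X :: "('k, 'x::ab_group_add, 'm) vspace_scheme" and W :: "('k, 'w::ab_group_add, 'n) vspace_scheme" and u and F
    unfolding sweedler_def
    by (intro klinear_tensor_lift klinear_comp[OF klinear_H4_comult] kspace_H4 that)
  have sw2: "klinear X W (\<lambda>x. sweedler H4 h (G x))"
    if "kspace W" "kspace X" "\<And>x. x \<in> vcarrier X \<Longrightarrow> kbilinear H4 H4 W (G x)"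
      "\<And>p q. klinear X W (\<lambda>x. G x p q)" for X :: "('k, 'x::ab_group_add, 'm) vspace_scheme" and W :: "('k, 'w::ab_group_add, 'n) vspace_scheme" and h and G
    unfolding sweedler_def
    by (intro klinear_tensor_lift_param klinear_in[OF klinear_H4_comult] kspace_H4 that U)
  note lin = klin kspace_H4 sw1 sw2 U klinear_comp[OF klinear_H4_counit]
  let ?l = "\<lambda>h :: 'k h4. sweedler H4 h (\<lambda>u h3. sweedler H4 u (\<lambda>h1 h2. (h1 \<otimes>\<^bsub>H4,H4\<^esub> h2) \<otimes>\<^bsub>?T,H4\<^esub> h3))"
  let ?r = "\<lambda>h :: 'k h4. sweedler H4 h (\<lambda>h1 u. sweedler H4 u (\<lambda>h2 h3. (h1 \<otimes>\<^bsub>H4,H4\<^esub> h2) \<otimes>\<^bsub>?T,H4\<^esub> h3))"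
  have coassoc: "?l h = ?r h" for h :: "'k h4"
  proof (rule klinear_H4_eqI[of ?T3 ?l ?r])
    show "klinear H4 ?T3 ?l" "klinear H4 ?T3 ?r" by (rule lin | assumption)+
    have b0: "kbilinear H4 H4 ?T3 (\<lambda>u h3. sweedler H4 u (\<lambda>h1 h2. (h1 \<otimes>\<^bsub>H4,H4\<^esub> h2) \<otimes>\<^bsub>?T,H4\<^esub> h3))"
      "kbilinear H4 H4 ?T3 (\<lambda>h1 u. sweedler H4 u (\<lambda>h2 h3. (h1 \<otimes>\<^bsub>H4,H4\<^esub> h2) \<otimes>\<^bsub>?T,H4\<^esub> h3))"
      by (rule lin | assumption)+
    have b1: "kbilinear H4 H4 ?T3 (\<lambda>h1 h2. (h1 \<otimes>\<^bsub>H4,H4\<^esub> h2) \<otimes>\<^bsub>?T,H4\<^esub> h3)"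
      "kbilinear H4 H4 ?T3 (\<lambda>h2 h3. (h1 \<otimes>\<^bsub>H4,H4\<^esub> h2) \<otimes>\<^bsub>?T,H4\<^esub> h3)" for h1 h3
      by (rule lin | assumption)+
    fix i show "?l (h4_vec i) = ?r (h4_vec i)"
      unfolding sweedler_H4_basis[OF kspace_tensor_space b0(1)] sweedler_H4_basis[OF kspace_tensor_space b0(2)]
        sweedler_H4_basis[OF kspace_tensor_space b1(1)] sweedler_H4_basis[OF kspace_tensor_space b1(2)]
      by (cases i) (simp_all add: add.assoc)
  qed
  let ?cl = "\<lambda>h :: 'k h4. sweedler H4 h (\<lambda>p q. vscale H4 (hcounit H4 p) q)"
  let ?cr = "\<lambda>h :: 'k h4. sweedler H4 h (\<lambda>p q. vscale H4 (hcounit H4 q) p)"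
  have counit: "?cl h = h" "?cr h = h" for h :: "'k h4"
  proof -
    have b: "kbilinear H4 H4 (H4 :: ('k, 'k h4) hopf) (\<lambda>p q. vscale H4 (hcounit H4 p) q)"
      "kbilinear H4 H4 (H4 :: ('k, 'k h4) hopf) (\<lambda>p q. vscale H4 (hcounit H4 q) p)"
      by (rule lin | assumption)+
    have v: "vscale H4 1 v = v" "vscale H4 0 v = 0" for v :: "'k h4"
      by (simp_all add: kspace_scale[OF kspace_H4])
    show "?cl h = h"
    proof (rule klinear_H4_eqI[of H4 ?cl "\<lambda>h. h"])
      show "klinear H4 H4 ?cl" "klinear H4 H4 (\<lambda>h :: 'k h4. h)" by (rule lin | assumption)+
      show "?cl (h4_vec i) = h4_vec i" for i
        unfolding sweedler_H4_basis[OF kspace_H4 b(1)]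
        by (cases i) (simp_all add: hcounit_H4_basis v)
    qed
    show "?cr h = h"
    proof (rule klinear_H4_eqI[of H4 ?cr "\<lambda>h. h"])
      show "klinear H4 H4 ?cr" "klinear H4 H4 (\<lambda>h :: 'k h4. h)" by (rule lin | assumption)+
      show "?cr (h4_vec i) = h4_vec i" for i
        unfolding sweedler_H4_basis[OF kspace_H4 b(2)]
        by (cases i) (simp_all add: hcounit_H4_basis v)
    qed
  qed
  show ?thesis
    unfolding coalgebra_def
    using coassoc counit klinear_H4_comult klinear_H4_counit kspace_H4 by blast
qed

lemma H4_mult_assoc: "(s \<cdot>\<^bsub>H4\<^esub> t) \<cdot>\<^bsub>H4\<^esub> u = s \<cdot>\<^bsub>H4\<^esub> (t \<cdot>\<^bsub>H4\<^esub> u)"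
  and H4_mult_one: "hone H4 \<cdot>\<^bsub>H4\<^esub> s = s" "s \<cdot>\<^bsub>H4\<^esub> hone H4 = s"
  for s t u :: "'k::field h4"
  by (simp_all add: fun_eq_iff all_h4_basis H4_def h4_space_def sum_h4_basis h4_vec_apply algebra_simps)


lemma H4_in: "h \<in> vcarrier H4"
  by (simp add: H4_simps)

lemma algebra_H4: "algebra (H4 :: ('k::field, 'k h4) hopf)"
  unfolding algebra_def
  by (auto simp: kspace_H4 kbilinear_H4_mult H4_mult_assoc H4_mult_one H4_in)

lemmas H4_mult_lin = klinear_bilinear_left[OF kbilinear_H4_mult] klinear_bilinear_right[OF kbilinear_H4_mult]

lemmas H4_lin = slin kspace_H4 coalgebra_H4 H4_in H4_mult_lin

lemma H4_comult_mult:
  fixes W :: "('k::field, 'w::ab_group_add, 'n) vspace_scheme"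
  assumes W: "kspace W" and F: "kbilinear H4 H4 W F"
  shows "sweedler H4 (h \<cdot>\<^bsub>H4\<^esub> g) F =
    sweedler H4 h (\<lambda>h1 h2. sweedler H4 g (\<lambda>g1 g2. F (h1 \<cdot>\<^bsub>H4\<^esub> g1) (h2 \<cdot>\<^bsub>H4\<^esub> g2)))"
proof -
  note Fl = klinear_bilinear_left[OF F] klinear_bilinear_right[OF F]
  note Fs = kbilinear_simps[OF F kspace_H4 kspace_H4]
  let ?r = "\<lambda>h g. sweedler H4 h (\<lambda>h1 h2. sweedler H4 g (\<lambda>g1 g2. F (h1 \<cdot>\<^bsub>H4\<^esub> g1) (h2 \<cdot>\<^bsub>H4\<^esub> g2)))"
  have lF: "klinear H4 W (\<lambda>h. sweedler H4 h F)"
    by (rule H4_lin W F | assumption)+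
  have b1: "kbilinear H4 H4 W (\<lambda>h1 h2. sweedler H4 g (\<lambda>g1 g2. F (h1 \<cdot>\<^bsub>H4\<^esub> g1) (h2 \<cdot>\<^bsub>H4\<^esub> g2)))" for g
    by (rule H4_lin W Fl | assumption)+
  have b2: "kbilinear H4 H4 W (\<lambda>g1 g2. F (h1 \<cdot>\<^bsub>H4\<^esub> g1) (h2 \<cdot>\<^bsub>H4\<^esub> g2))" for h1 h2
    by (rule H4_lin W Fl | assumption)+
  show ?thesis
  proof (rule kbilinear_H4_eqI[of W _ ?r])
    show "klinear H4 W (\<lambda>h. sweedler H4 (h \<cdot>\<^bsub>H4\<^esub> g) F)" "klinear H4 W (\<lambda>h. ?r h g)" for g
      by (rule H4_lin W F Fl | assumption)+
    show "klinear H4 W (\<lambda>g. sweedler H4 (h \<cdot>\<^bsub>H4\<^esub> g) F)" "klinear H4 W (\<lambda>g. ?r h g)" for h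
      by (rule H4_lin W F Fl | assumption)+
    show "sweedler H4 (h4_vec i \<cdot>\<^bsub>H4\<^esub> h4_vec j) F = ?r (h4_vec i) (h4_vec j)" for i j
      unfolding hmult_H4_basis sweedler_H4_basis[OF W b1] unfolding sweedler_H4_basis[OF W b2]
      by (cases i; cases j) (simp_all add: hmult_H4_basis sweedler_H4_basis[OF W F]
          klinear_simps(1,2)[OF lF kspace_H4] Fs H4_in)
  qed
qed

lemma H4_counit_mult: "hcounit H4 (s \<cdot>\<^bsub>H4\<^esub> t) = hcounit H4 s * hcounit H4 t"
  for s t :: "'k::field h4"
  by (simp add: H4_def h4_space_def sum_h4_basis h4_vec_apply algebra_simps)

lemma bialgebra_H4: "bialgebra (H4 :: ('k::field, 'k h4) hopf)"
proof -
  have "hcomult H4 (s \<cdot>\<^bsub>H4\<^esub> t) =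
      sweedler H4 s (\<lambda>s1 s2. sweedler H4 t (\<lambda>t1 t2. (s1 \<cdot>\<^bsub>H4\<^esub> t1) \<otimes>\<^bsub>H4,H4\<^esub> (s2 \<cdot>\<^bsub>H4\<^esub> t2)))" for s t :: "'k h4"
    using H4_comult_mult[OF kspace_tensor_space kbilinear_tens, of s t]
    by (simp only: sweedler_tens[OF coalgebra_H4 H4_in])
  then show ?thesis
    by (simp add: bialgebra_def algebra_H4 coalgebra_H4 H4_simps(3) hcomult_H4_basis
        hcounit_H4_basis H4_counit_mult)
qed

fun h4_antipode_table :: "h4_basis \<Rightarrow> 'k::field h4" where
  "h4_antipode_table B1 = h4_vec B1"
| "h4_antipode_table Bg = h4_vec Bg"
| "h4_antipode_table Bx = - h4_vec Bgx"
| "h4_antipode_table Bgx = h4_vec Bx"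

definition h4_antipode :: "'k::field h4 \<Rightarrow> 'k h4" where
  "h4_antipode s = (\<Sum>i\<in>UNIV. vscale H4 (s i) (h4_antipode_table i))"

lemma klinear_h4_antipode: "klinear H4 H4 h4_antipode"
  unfolding h4_antipode_def[abs_def] by (rule klinear_H4_table[OF kspace_H4 H4_in])

lemma h4_antipode_basis: "h4_antipode (h4_vec i) = h4_antipode_table i"
  unfolding h4_antipode_def by (rule H4_table_basis(1)[OF kspace_H4])

lemma is_antipode_H4: "is_antipode (H4 :: ('k::field, 'k h4) hopf) h4_antipode"
proof -
  note lin = H4_lin klinear_comp[OF klinear_h4_antipode] klinear_scale_left klinear_counit
  let ?l = "\<lambda>h :: 'k h4. sweedler H4 h (\<lambda>h1 h2. h4_antipode h1 \<cdot>\<^bsub>H4\<^esub> h2)"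
  let ?r = "\<lambda>h :: 'k h4. sweedler H4 h (\<lambda>h1 h2. h1 \<cdot>\<^bsub>H4\<^esub> h4_antipode h2)"
  have b: "kbilinear H4 H4 H4 (\<lambda>h1 h2 :: 'k h4. h4_antipode h1 \<cdot>\<^bsub>H4\<^esub> h2)"
    "kbilinear H4 H4 H4 (\<lambda>h1 h2 :: 'k h4. h1 \<cdot>\<^bsub>H4\<^esub> h4_antipode h2)"
    by (rule lin | assumption)+
  note ms = kbilinear_simps[OF kbilinear_H4_mult kspace_H4 kspace_H4]
  have e: "klinear H4 H4 (\<lambda>h :: 'k h4. vscale H4 (hcounit H4 h) (hone H4))"
    by (rule lin | assumption)+
  have l: "klinear H4 H4 ?l" and r: "klinear H4 H4 ?r"
    by (rule lin | assumption)+
  have "?l (h4_vec i) = vscale H4 (hcounit H4 (h4_vec i)) (hone H4)" for i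
    unfolding sweedler_H4_basis[OF kspace_H4 b(1)]
    by (cases i) (simp_all add: h4_antipode_basis hmult_H4_basis ms hcounit_H4_basis
        kspace_scale[OF kspace_H4] H4_simps(3) H4_in)
  note left = klinear_H4_eqI[of H4 ?l, OF l e this]
  have "?r (h4_vec i) = vscale H4 (hcounit H4 (h4_vec i)) (hone H4)" for i
    unfolding sweedler_H4_basis[OF kspace_H4 b(2)]
    by (cases i) (simp_all add: h4_antipode_basis hmult_H4_basis ms hcounit_H4_basis
        kspace_scale[OF kspace_H4] H4_simps(3) H4_in)
  note right = klinear_H4_eqI[of H4 ?r, OF r e this]
  show ?thesis
    unfolding is_antipode_def using klinear_h4_antipode left right by blast
qed

section \<open>The defect of the deformed multiplication\<close>

text \<open>
  In the algebra generated by \<open>g\<close>, \<open>x\<close> and a central element \<open>z\<close> with \<open>g\<^sup>2 = 1\<close>, \<open>x g = - g x\<close> and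
  \<open>x\<^sup>2 = z\<close>, a product of two of the elements \<open>1\<close>, \<open>g\<close>, \<open>x\<close>, \<open>g x\<close> is their product in \<open>H\<^sub>4\<close> plus a
  multiple of \<open>z\<close>. The table lists the coefficients of \<open>z\<close>; for example
  \<open>(g x) (g x) = - g\<^sup>2 x\<^sup>2 = - z\<close>.
\<close>

fun h4_defect_table :: "h4_basis \<Rightarrow> h4_basis \<Rightarrow> 'k::field h4" where
  "h4_defect_table Bx Bx = h4_vec B1"
| "h4_defect_table Bx Bgx = - h4_vec Bg"
| "h4_defect_table Bgx Bx = h4_vec Bg"
| "h4_defect_table Bgx Bgx = - h4_vec B1"
| "h4_defect_table _ _ = 0"

definition h4_defect :: "'k::field h4 \<Rightarrow> 'k h4 \<Rightarrow> 'k h4" where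
  "h4_defect s t = (\<Sum>i\<in>UNIV. \<Sum>j\<in>UNIV. vscale H4 (s i * t j) (h4_defect_table i j))"

lemma kbilinear_h4_defect: "kbilinear H4 H4 H4 h4_defect"
  unfolding h4_defect_def[abs_def] by (rule kbilinear_H4_table[OF kspace_H4 H4_in])

lemma h4_defect_basis: "h4_defect (h4_vec i) (h4_vec j) = h4_defect_table i j"
  unfolding h4_defect_def by (rule H4_table_basis(2)[OF kspace_H4])

text \<open>
  The terms of degree 1 in \<open>z\<close> in the associative law of the deformed multiplication: the defect is a
  Hochschild 2-cocycle.
\<close>

lemma h4_defect_cocycle:
  "h \<cdot>\<^bsub>H4\<^esub> h4_defect g l + h4_defect h (g \<cdot>\<^bsub>H4\<^esub> l) = h4_defect h g \<cdot>\<^bsub>H4\<^esub> l + h4_defect (h \<cdot>\<^bsub>H4\<^esub> g) l"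
  for h g l :: "'k::field h4"
  by (simp add: fun_eq_iff all_h4_basis H4_def h4_space_def sum_h4_basis h4_vec_apply
      h4_defect_def algebra_simps)

text \<open>
  The terms of degree 2 in \<open>z\<close> vanish, because the defect takes values in the span of \<open>1\<close> and \<open>g\<close> and
  is zero when one of its arguments lies there.
\<close>

lemma h4_defect_defect: "h4_defect (h4_defect h g) l = 0" "h4_defect h (h4_defect g l) = 0"
  and h4_defect_one: "h4_defect (hone H4) h = 0" "h4_defect h (hone H4) = 0"
  for h g l :: "'k::field h4"
  by (simp_all add: fun_eq_iff all_h4_basis H4_def h4_space_def sum_h4_basis h4_vec_apply
      h4_defect_def algebra_simps)

lemmas H4_defect_lin = klinear_bilinear_left[OF kbilinear_h4_defect]
  klinear_bilinear_right[OF kbilinear_h4_defect]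

text \<open>
  These identities make the comultiplication compatible with the deformed multiplication. The comultiplication of \<open>z\<close> has
  the two terms \<open>z \<otimes> 1\<close> and \<open>1 \<otimes> z\<close>, and they are matched by the defects in the first and in the
  second leg; there is no term in \<open>z \<otimes> z\<close>, so the third expression has to vanish.
\<close>

lemma h4_defect_bicolinear:
  fixes W :: "('k::field, 'w::ab_group_add, 'n) vspace_scheme"
  assumes W: "kspace W" and F: "kbilinear H4 H4 W F"
  shows "sweedler H4 h (\<lambda>h1 h2. sweedler H4 g (\<lambda>g1 g2. F (h4_defect h1 g1) (h2 \<cdot>\<^bsub>H4\<^esub> g2))) =
      sweedler H4 (h4_defect h g) F"
    and "sweedler H4 h (\<lambda>h1 h2. sweedler H4 g (\<lambda>g1 g2. F (h1 \<cdot>\<^bsub>H4\<^esub> g1) (h4_defect h2 g2))) =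
      sweedler H4 (h4_defect h g) F"
    and "sweedler H4 h (\<lambda>h1 h2. sweedler H4 g (\<lambda>g1 g2. F (h4_defect h1 g1) (h4_defect h2 g2))) = 0"
proof -
  let ?l = "\<lambda>h g. sweedler H4 h (\<lambda>h1 h2. sweedler H4 g (\<lambda>g1 g2. F (h4_defect h1 g1) (h2 \<cdot>\<^bsub>H4\<^esub> g2)))"
  let ?r = "\<lambda>h g. sweedler H4 h (\<lambda>h1 h2. sweedler H4 g (\<lambda>g1 g2. F (h1 \<cdot>\<^bsub>H4\<^esub> g1) (h4_defect h2 g2)))"
  let ?d = "\<lambda>h g. sweedler H4 h (\<lambda>h1 h2. sweedler H4 g (\<lambda>g1 g2. F (h4_defect h1 g1) (h4_defect h2 g2)))"
  let ?m = "\<lambda>h g. sweedler H4 (h4_defect h g) F"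
  note Fl = klinear_bilinear_left[OF F] klinear_bilinear_right[OF F]
  note Fs = kbilinear_simps[OF F kspace_H4 kspace_H4]
  note lin = H4_lin W F Fl H4_defect_lin
  have lF: "klinear H4 W (\<lambda>h. sweedler H4 h F)"
    by (rule lin | assumption)+
  have b1: "kbilinear H4 H4 W (\<lambda>h1 h2. sweedler H4 g (\<lambda>g1 g2. F (h4_defect h1 g1) (h2 \<cdot>\<^bsub>H4\<^esub> g2)))"
    "kbilinear H4 H4 W (\<lambda>h1 h2. sweedler H4 g (\<lambda>g1 g2. F (h1 \<cdot>\<^bsub>H4\<^esub> g1) (h4_defect h2 g2)))"
    "kbilinear H4 H4 W (\<lambda>h1 h2. sweedler H4 g (\<lambda>g1 g2. F (h4_defect h1 g1) (h4_defect h2 g2)))" for g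
    by (rule lin | assumption)+
  have b2: "kbilinear H4 H4 W (\<lambda>g1 g2. F (h4_defect h1 g1) (h2 \<cdot>\<^bsub>H4\<^esub> g2))"
    "kbilinear H4 H4 W (\<lambda>g1 g2. F (h1 \<cdot>\<^bsub>H4\<^esub> g1) (h4_defect h2 g2))"
    "kbilinear H4 H4 W (\<lambda>g1 g2. F (h4_defect h1 g1) (h4_defect h2 g2))" for h1 h2
    by (rule lin | assumption)+
  note sw1 = sweedler_H4_basis[OF W b1(1)] sweedler_H4_basis[OF W b1(2)] sweedler_H4_basis[OF W b1(3)]
  note sw2 = sweedler_H4_basis[OF W b2(1)] sweedler_H4_basis[OF W b2(2)] sweedler_H4_basis[OF W b2(3)]
  note s = hmult_H4_basis h4_defect_basis sweedler_H4_basis[OF W F]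
          klinear_simps(1,2)[OF lF kspace_H4] Fs H4_in
  have m: "klinear H4 W (\<lambda>h. ?m h g)" "klinear H4 W (\<lambda>g. ?m h g)" for h g
    by (rule lin | assumption)+
  show "?l h g = ?m h g"
  proof (rule kbilinear_H4_eqI[of W ?l ?m, OF _ _ m])
    show "klinear H4 W (\<lambda>h. ?l h g)" "klinear H4 W (\<lambda>g. ?l h g)" for h g
      by (rule lin | assumption)+
    show "?l (h4_vec i) (h4_vec j) = ?m (h4_vec i) (h4_vec j)" for i j
      unfolding sw1 unfolding sw2 by (cases i; cases j) (simp_all add: s)
  qed
  show "?r h g = ?m h g"
  proof (rule kbilinear_H4_eqI[of W ?r ?m, OF _ _ m])
    show "klinear H4 W (\<lambda>h. ?r h g)" "klinear H4 W (\<lambda>g. ?r h g)" for h g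
      by (rule lin | assumption)+
    show "?r (h4_vec i) (h4_vec j) = ?m (h4_vec i) (h4_vec j)" for i j
      unfolding sw1 unfolding sw2 by (cases i; cases j) (simp_all add: s)
  qed
  show "?d h g = 0"
  proof (rule kbilinear_H4_eqI[of W ?d "\<lambda>h g. 0"])
    show "klinear H4 W (\<lambda>h. ?d h g)" "klinear H4 W (\<lambda>g. ?d h g)" for h g
      by (rule lin | assumption)+
    show "klinear H4 W (\<lambda>h :: 'k h4. 0)" "klinear H4 W (\<lambda>h :: 'k h4. 0)"
      by (rule lin | assumption)+
    show "?d (h4_vec i) (h4_vec j) = 0" for i j
      unfolding sw1 unfolding sw2 by (cases i; cases j) (simp_all add: s)
  qed
qed

text \<open>
  The antipode of \<open>H\<^sub>4\<close> needs no correction after the deformation.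
\<close>

lemma h4_defect_antipode:
  "sweedler H4 h (\<lambda>h1 h2. h4_defect (h4_antipode h1) h2) = 0"
  "sweedler H4 h (\<lambda>h1 h2. h4_defect h1 (h4_antipode h2)) = 0"
  for h :: "'k::field h4"
proof -
  let ?l = "\<lambda>h :: 'k h4. sweedler H4 h (\<lambda>h1 h2. h4_defect (h4_antipode h1) h2)"
  let ?r = "\<lambda>h :: 'k h4. sweedler H4 h (\<lambda>h1 h2. h4_defect h1 (h4_antipode h2))"
  note lin = H4_lin klinear_comp[OF klinear_h4_antipode] H4_defect_lin
  have b: "kbilinear H4 H4 H4 (\<lambda>h1 h2 :: 'k h4. h4_defect (h4_antipode h1) h2)"
    "kbilinear H4 H4 H4 (\<lambda>h1 h2 :: 'k h4. h4_defect h1 (h4_antipode h2))"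
    by (rule lin | assumption)+
  note ms = kbilinear_simps[OF kbilinear_h4_defect kspace_H4 kspace_H4]
  have z: "klinear H4 H4 (\<lambda>h :: 'k h4. 0 :: 'k h4)"
    by (rule lin | assumption)+
  have l: "klinear H4 H4 ?l" and r: "klinear H4 H4 ?r"
    by (rule lin | assumption)+
  show "?l h = 0"
  proof (rule klinear_H4_eqI[of H4 ?l, OF l z])
    show "?l (h4_vec i) = 0" for i
      unfolding sweedler_H4_basis[OF kspace_H4 b(1)]
      by (cases i) (simp_all add: h4_antipode_basis h4_defect_basis ms H4_in)
  qed
  show "?r h = 0"
  proof (rule klinear_H4_eqI[of H4 ?r, OF r z])
    show "?r (h4_vec i) = 0" for i
      unfolding sweedler_H4_basis[OF kspace_H4 b(2)]
      by (cases i) (simp_all add: h4_antipode_basis h4_defect_basis ms H4_in)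
  qed
qed


section \<open>The multiplication of a crossed product\<close>

lemma klinear_cong:
  "kspace V \<Longrightarrow> (\<And>x. x \<in> vcarrier V \<Longrightarrow> f x = g x) \<Longrightarrow> klinear V W g \<Longrightarrow> klinear V W f"
  by (rule klinearI) (simp_all add: klinear_in klinear_add klinear_scale kspace_closed)

lemma kbilinear_tensor_eqI:
  assumes k: "kspace U" "kspace V" "kspace W"
    and F: "kbilinear (tensor_space U V) (tensor_space U V) W F"
    and G: "kbilinear (tensor_space U V) (tensor_space U V) W G"
    and eq: "\<And>a h c g. a \<in> vcarrier U \<Longrightarrow> h \<in> vcarrier V \<Longrightarrow> c \<in> vcarrier U \<Longrightarrow> g \<in> vcarrier V \<Longrightarrow>
      F (a \<otimes>\<^bsub>U,V\<^esub> h) (c \<otimes>\<^bsub>U,V\<^esub> g) = G (a \<otimes>\<^bsub>U,V\<^esub> h) (c \<otimes>\<^bsub>U,V\<^esub> g)"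
    and s: "s \<in> vcarrier (tensor_space U V)" and t: "t \<in> vcarrier (tensor_space U V)"
  shows "F s t = G s t"
proof -
  have l: "klinear (tensor_space U V) W (F x)" "klinear (tensor_space U V) W (G x)"
    "klinear (tensor_space U V) W (\<lambda>s. F s x)" "klinear (tensor_space U V) W (\<lambda>s. G s x)"
    if "x \<in> vcarrier (tensor_space U V)" for x
    using F G that by (auto simp: kbilinear_def)
  have "F (a \<otimes>\<^bsub>U,V\<^esub> h) t = G (a \<otimes>\<^bsub>U,V\<^esub> h) t" if "a \<in> vcarrier U" "h \<in> vcarrier V" for a h
    by (rule klinear_tensor_eqI[OF k l(1,2)[OF tens_closed] _ t]) (simp_all add: that eq)
  then show ?thesis
    by (intro klinear_tensor_eqI[OF k l(3,4)[OF t] _ s])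
qed

text \<open>
  A quadrilinear map on \<open>U \<times> V \<times> U \<times> V\<close> induces a bilinear map on the tensor product of \<open>U\<close> and \<open>V\<close>.
\<close>

lemma
  assumes k: "kspace U" "kspace V" "kspace W"
    and l1: "\<And>h c g. h \<in> vcarrier V \<Longrightarrow> c \<in> vcarrier U \<Longrightarrow> g \<in> vcarrier V \<Longrightarrow> klinear U W (\<lambda>a. F a h c g)"
    and l2: "\<And>a c g. a \<in> vcarrier U \<Longrightarrow> c \<in> vcarrier U \<Longrightarrow> g \<in> vcarrier V \<Longrightarrow> klinear V W (\<lambda>h. F a h c g)"
    and l3: "\<And>a h g. a \<in> vcarrier U \<Longrightarrow> h \<in> vcarrier V \<Longrightarrow> g \<in> vcarrier V \<Longrightarrow> klinear U W (\<lambda>c. F a h c g)"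
    and l4: "\<And>a h c. a \<in> vcarrier U \<Longrightarrow> h \<in> vcarrier V \<Longrightarrow> c \<in> vcarrier U \<Longrightarrow> klinear V W (\<lambda>g. F a h c g)"
  shows kbilinear_tensor_lift2:
      "kbilinear (tensor_space U V) (tensor_space U V) W (tensor_lift2 U V F)"
    and tensor_lift2_tens:
      "a \<in> vcarrier U \<Longrightarrow> h \<in> vcarrier V \<Longrightarrow> c \<in> vcarrier U \<Longrightarrow> g \<in> vcarrier V \<Longrightarrow>
        tensor_lift2 U V F (a \<otimes>\<^bsub>U,V\<^esub> h) (c \<otimes>\<^bsub>U,V\<^esub> g) = F a h c g"
proof -
  let ?T = "tensor_space U V"
  have b: "kbilinear U V W (F a h)" if "a \<in> vcarrier U" "h \<in> vcarrier V" for a h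
    using that by (intro kbilinearI l3 l4)
  have b': "kbilinear U V W (\<lambda>a h. tensor_lift U V (F a h) t)" if "t \<in> vcarrier ?T" for t
    by (rule kbilinearI klinear_tensor_lift_param k that b l1 l2 | assumption)+
  have eq: "tensor_lift2 U V F s t = tensor_lift U V (\<lambda>x y. tensor_lift U V (F x y) t) s"
    if "s \<in> vcarrier ?T" "t \<in> vcarrier ?T" for s t
    using that by (simp add: tensor_lift2_def)
  show "kbilinear ?T ?T W (tensor_lift2 U V F)"
  proof (rule kbilinearI)
    fix s assume s: "s \<in> vcarrier ?T"
    have "klinear ?T W (\<lambda>t. tensor_lift U V (\<lambda>x y. tensor_lift U V (F x y) t) s)"
      by (rule klin klinear_tensor_lift_param klinear_tensor_lift k s b b' | assumption)+
    then show "klinear ?T W (tensor_lift2 U V F s)"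
      by (rule klinear_cong[OF kspace_tensor_space, rotated]) (rule eq[OF s])
  next
    fix t assume t: "t \<in> vcarrier ?T"
    have "klinear ?T W (\<lambda>s. tensor_lift U V (\<lambda>x y. tensor_lift U V (F x y) t) s)"
      by (rule tensor_lift_universal(1)[OF k b'[OF t]])
    then show "klinear ?T W (\<lambda>s. tensor_lift2 U V F s t)"
      by (rule klinear_cong[OF kspace_tensor_space, rotated]) (rule eq[OF _ t])
  qed
  show "tensor_lift2 U V F (a \<otimes>\<^bsub>U,V\<^esub> h) (c \<otimes>\<^bsub>U,V\<^esub> g) = F a h c g"
    if "a \<in> vcarrier U" "h \<in> vcarrier V" "c \<in> vcarrier U" "g \<in> vcarrier V"
    using that by (simp add: eq tens_closed tensor_lift_tens[OF k b'] tensor_lift_tens[OF k b])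
qed

lemma has_tensor_coalgebra_crossed_product: "has_tensor_coalgebra A H (crossed_product A H act f)"
  by (simp add: has_tensor_coalgebra_def crossed_product_def)

lemma hone_crossed_product: "hone (crossed_product A H act f) = hone A \<otimes>\<^bsub>A,H\<^esub> hone H"
  by (simp add: crossed_product_def)

lemma
  assumes A: "bialgebra A" and H: "bialgebra H" and act: "kbilinear H A A act" and f: "kbilinear H H A f"
  shows kbilinear_crossed_mult:
      "kbilinear (tensor_space A H) (tensor_space A H) (tensor_space A H) (hmult (crossed_product A H act f))"
    and crossed_mult_tens:
      "a \<in> vcarrier A \<Longrightarrow> h \<in> vcarrier H \<Longrightarrow> c \<in> vcarrier A \<Longrightarrow> g \<in> vcarrier H \<Longrightarrow>
        (a \<otimes>\<^bsub>A,H\<^esub> h) \<cdot>\<^bsub>crossed_product A H act f\<^esub> (c \<otimes>\<^bsub>A,H\<^esub> g) =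
        sweedler3 H h (\<lambda>h1 h2 h3. sweedler H g (\<lambda>g1 g2.
          (a \<cdot>\<^bsub>A\<^esub> act h1 c \<cdot>\<^bsub>A\<^esub> f h2 g1) \<otimes>\<^bsub>A,H\<^esub> (h3 \<cdot>\<^bsub>H\<^esub> g2)))"
proof -
  note lin = slin bialgebraD(2,8)[OF A] bialgebraD(2,8)[OF H]
    klinear_bilinear_left[OF bialgebraD(4)[OF A]] klinear_bilinear_right[OF bialgebraD(4)[OF A]]
    klinear_bilinear_left[OF bialgebraD(4)[OF H]] klinear_bilinear_right[OF bialgebraD(4)[OF H]]
    klinear_bilinear_left[OF act] klinear_bilinear_right[OF act] kbilinearD(1)[OF act]
    klinear_bilinear_left[OF f] klinear_bilinear_right[OF f] kbilinearD(1)[OF f]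
  have m: "hmult (crossed_product A H act f) = tensor_lift2 A H (\<lambda>a h c g.
        sweedler3 H h (\<lambda>h1 h2 h3. sweedler H g (\<lambda>g1 g2.
          (a \<cdot>\<^bsub>A\<^esub> act h1 c \<cdot>\<^bsub>A\<^esub> f h2 g1) \<otimes>\<^bsub>A,H\<^esub> (h3 \<cdot>\<^bsub>H\<^esub> g2))))"
    by (simp add: crossed_product_def)
  show "kbilinear (tensor_space A H) (tensor_space A H) (tensor_space A H) (hmult (crossed_product A H act f))"
    unfolding m sweedler3_def
    by (rule kbilinear_tensor_lift2) (rule lin | assumption)+
  show "(a \<otimes>\<^bsub>A,H\<^esub> h) \<cdot>\<^bsub>crossed_product A H act f\<^esub> (c \<otimes>\<^bsub>A,H\<^esub> g) =
        sweedler3 H h (\<lambda>h1 h2 h3. sweedler H g (\<lambda>g1 g2.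
          (a \<cdot>\<^bsub>A\<^esub> act h1 c \<cdot>\<^bsub>A\<^esub> f h2 g1) \<otimes>\<^bsub>A,H\<^esub> (h3 \<cdot>\<^bsub>H\<^esub> g2)))"
    if "a \<in> vcarrier A" "h \<in> vcarrier H" "c \<in> vcarrier A" "g \<in> vcarrier H"
    unfolding m sweedler3_def
    by (rule tensor_lift2_tens[where W = "tensor_space A H"]) (rule lin that | assumption)+
qed

text \<open>
  The formula for the product of a crossed product on generators \<open>a # e\<close> with a basis element \<open>e\<close> of
  \<open>H\<^sub>4\<close>. Simplification evaluates it for concrete basis elements.
\<close>

lemma crossed_mult_H4_basis:
  fixes A :: "('k::field, 'a::ab_group_add, 'm) hopf_scheme"
  assumes A: "bialgebra A" and act: "kbilinear H4 A A act" and f: "kbilinear H4 H4 A f"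
    and a: "a \<in> vcarrier A" and c: "c \<in> vcarrier A"
  shows "(a \<otimes>\<^bsub>A,H4\<^esub> h4_vec i) \<cdot>\<^bsub>crossed_product A H4 act f\<^esub> (c \<otimes>\<^bsub>A,H4\<^esub> h4_vec j) =
    (\<Sum>(u, k)\<leftarrow>h4_copairs i. \<Sum>(p, q)\<leftarrow>h4_copairs u. \<Sum>(r, s)\<leftarrow>h4_copairs j.
      (a \<cdot>\<^bsub>A\<^esub> act (h4_vec p) c \<cdot>\<^bsub>A\<^esub> f (h4_vec q) (h4_vec r)) \<otimes>\<^bsub>A,H4\<^esub> h4_mult_table k s)"
proof -
  let ?T = "tensor_space A (H4 :: ('k, 'k h4) hopf)"
  note lin = H4_lin bialgebraD(2,8)[OF A]
    klinear_bilinear_left[OF bialgebraD(4)[OF A]] klinear_bilinear_right[OF bialgebraD(4)[OF A]]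
    klinear_bilinear_left[OF act] klinear_bilinear_right[OF act] kbilinearD(1)[OF act]
    klinear_bilinear_left[OF f] klinear_bilinear_right[OF f] kbilinearD(1)[OF f] a c
  let ?E = "\<lambda>h1 h2 h3 g1 g2. (a \<cdot>\<^bsub>A\<^esub> act h1 c \<cdot>\<^bsub>A\<^esub> f h2 g1) \<otimes>\<^bsub>A,H4\<^esub> (h3 \<cdot>\<^bsub>H4\<^esub> g2)"
  have b1: "kbilinear H4 H4 ?T (\<lambda>u h3. sweedler H4 u (\<lambda>h1 h2. sweedler H4 g (?E h1 h2 h3)))" for g
    by (rule lin | assumption)+
  have b2: "kbilinear H4 H4 ?T (\<lambda>h1 h2. sweedler H4 g (?E h1 h2 h3))" for g h3
    by (rule lin | assumption)+
  have b3: "kbilinear H4 H4 ?T (?E h1 h2 h3)" for h1 h2 h3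
    by (rule lin | assumption)+
  show ?thesis
    unfolding crossed_mult_tens[OF A bialgebra_H4 act f a H4_in c H4_in] sweedler3_def
    unfolding sweedler_H4_basis[OF kspace_tensor_space b1]
    unfolding sweedler_H4_basis[OF kspace_tensor_space b2]
    unfolding sweedler_H4_basis[OF kspace_tensor_space b3] hmult_H4_basis ..
qed


text \<open>
  The data of a crossed product with \<open>H\<^sub>4\<close>, without any compatibility condition. Both directions of the
  classification start from it.
\<close>

locale crossed_product_H4 =
  fixes A :: "('k::field, 'a::ab_group_add, 'm) hopf_scheme"
    and act :: "'k h4 \<Rightarrow> 'a \<Rightarrow> 'a" and f :: "'k h4 \<Rightarrow> 'k h4 \<Rightarrow> 'a"
  assumes bialg_A: "bialgebra A"
    and bil_act: "kbilinear H4 A A act"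
    and bil_f: "kbilinear H4 H4 A f"
begin

abbreviation "K \<equiv> H4 :: ('k, 'k h4) hopf"
abbreviation "T \<equiv> tensor_space A K"
abbreviation "B \<equiv> crossed_product A K act f"

lemmas co_A = bialgebraD(2)[OF bialg_A]
lemmas k_A = bialgebraD(3)[OF bialg_A]
lemmas mult_A = bialgebraD(4)[OF bialg_A]
lemmas one_A = bialgebraD(5)[OF bialg_A]

lemmas mult_B = kbilinear_crossed_mult[OF bialg_A bialgebra_H4 bil_act bil_f]
lemmas mult_B_basis = crossed_mult_H4_basis[OF bialg_A bil_act bil_f]
lemmas tens_co_B = has_tensor_coalgebra_crossed_product[of A K act f]
lemmas sel_B = has_tensor_coalgebraD[OF tens_co_B]
lemmas cong_B = space_cong[OF sel_B(1,2)] tensor_space_cong[OF sel_B(1,2)]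
lemmas sweedler_B = sweedler_tensor_coalgebra[OF tens_co_B co_A coalgebra_H4 _ _ H4_in]
lemmas tens_simps = kbilinear_simps[OF kbilinear_tens[of A K] k_A kspace_H4]

lemma act_in: "a \<in> vcarrier A \<Longrightarrow> act h a \<in> vcarrier A"
  and f_in: "f h g \<in> vcarrier A"
  by (auto intro: kbilinearD(1)[OF bil_act] kbilinearD(1)[OF bil_f] H4_in)

lemmas lin_B = H4_lin co_A k_A one_A bialgebraD(8)[OF bialg_A] act_in f_in
  klinear_bilinear_left[OF mult_A] klinear_bilinear_right[OF mult_A]
  klinear_bilinear_left[OF mult_B] klinear_bilinear_right[OF mult_B] kbilinearD(1)[OF mult_B]
  klinear_bilinear_left[OF bil_act] klinear_bilinear_right[OF bil_act]
  klinear_bilinear_left[OF bil_f] klinear_bilinear_right[OF bil_f]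
  klinear_sweedler_tensor_coalgebra[OF tens_co_B co_A coalgebra_H4]
  klinear_sweedler_tensor_coalgebra_param[OF tens_co_B co_A coalgebra_H4]

lemma hone_B: "hone B = hone A \<otimes>\<^bsub>A,K\<^esub> hone K"
  by (rule hone_crossed_product)

lemma counit_B_tens: "a \<in> vcarrier A \<Longrightarrow> hcounit B (a \<otimes>\<^bsub>A,K\<^esub> h) = hcounit A a * hcounit K h"
  unfolding sel_B by (rule tensor_counit_tens[OF co_A coalgebra_H4 _ H4_in])

lemma klinear_counit_B: "klinear T base_field (hcounit B)"
  unfolding sel_B by (rule klinear_tensor_counit[OF co_A coalgebra_H4])

lemma klinear_comult_B: "klinear T (tensor_space T T) (hcomult B)"
  unfolding sel_B by (rule klinear_tensor_comult[OF co_A coalgebra_H4])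

lemma comult_B_tens:
  assumes "b \<in> vcarrier A"
  shows "hcomult B (b \<otimes>\<^bsub>A,K\<^esub> k) =
    sweedler A b (\<lambda>p q. sweedler K k (\<lambda>u v. (p \<otimes>\<^bsub>A,K\<^esub> u) \<otimes>\<^bsub>T,T\<^esub> (q \<otimes>\<^bsub>A,K\<^esub> v)))"
  unfolding sel_B tensor_comult_def
  by (rule tensor_lift_tens[OF k_A kspace_H4 kspace_tensor_space
        kbilinear_tensor_comult[OF co_A coalgebra_H4] assms H4_in])

lemma sweedler_one_A:
  assumes "kspace W" "kbilinear A A W F"
  shows "sweedler A (hone A) F = F (hone A) (hone A)"
  unfolding sweedler_def bialgebraD(6)[OF bialg_A]
  by (rule tensor_lift_tens[OF k_A k_A assms one_A one_A])

end

lemma kbilinear_h4_cocycle: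
  assumes A: "bialgebra A" and z: "z \<in> vcarrier A"
  shows "kbilinear H4 H4 A (h4_cocycle A z)"
  unfolding h4_cocycle_def
proof (rule kbilinear_H4_table[OF bialgebraD(3)[OF A]])
  show "h4_cocycle_table A z i j \<in> vcarrier A" for i j
    by (cases i; cases j) (simp_all add: z bialgebraD[OF A] kspace_closed[OF bialgebraD(3)[OF A]])
qed

lemma h4_cocycle_basis:
  "bialgebra A \<Longrightarrow> h4_cocycle A z (h4_vec i) (h4_vec j) = h4_cocycle_table A z i j"
  unfolding h4_cocycle_def by (rule H4_table_basis(2)[OF bialgebraD(3)])

lemma trivial_action_apply:
  "h \<in> vcarrier H \<Longrightarrow> b \<in> vcarrier A \<Longrightarrow> trivial_action A H h b = vscale A (hcounit H h) b"
  by (simp add: trivial_action_def)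

lemma kbilinear_trivial_action:
  assumes A: "kspace A" and H: "coalgebra H"
  shows "kbilinear H A A (trivial_action A H)"
proof (rule kbilinearI)
  fix h assume h: "h \<in> vcarrier H"
  have "klinear A A (\<lambda>b. vscale A (hcounit H h) b)"
    by (rule slin A | assumption)+
  then show "klinear A A (trivial_action A H h)"
    by (rule klinear_cong[OF A, rotated]) (simp add: trivial_action_apply h)
next
  fix b assume b: "b \<in> vcarrier A"
  have "klinear H A (\<lambda>h. vscale A (hcounit H h) b)"
    by (rule slin A H b | assumption)+
  then show "klinear H A (\<lambda>h. trivial_action A H h b)"
    by (rule klinear_cong[OF coalgebraD(1)[OF H], rotated]) (simp add: trivial_action_apply b)
qed

text \<open>
  The multiplication for the cocycle of \<open>z\<close> is the one of the tensor product, deformed by \<open>z\<close> times the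
  defect. By bilinearity it suffices to compare the sixteen products of basis elements of \<open>H\<^sub>4\<close>.
\<close>

lemma crossed_mult_defect:
  fixes A :: "('k::field, 'a::ab_group_add, 'm) hopf_scheme"
  assumes A: "bialgebra A" and z: "z \<in> vcarrier A" and a: "a \<in> vcarrier A" and c: "c \<in> vcarrier A"
  shows "(a \<otimes>\<^bsub>A,H4\<^esub> h) \<cdot>\<^bsub>crossed_product A H4 (trivial_action A H4) (h4_cocycle A z)\<^esub> (c \<otimes>\<^bsub>A,H4\<^esub> g) =
    (a \<cdot>\<^bsub>A\<^esub> c) \<otimes>\<^bsub>A,H4\<^esub> (h \<cdot>\<^bsub>H4\<^esub> g) + (a \<cdot>\<^bsub>A\<^esub> c \<cdot>\<^bsub>A\<^esub> z) \<otimes>\<^bsub>A,H4\<^esub> h4_defect h g"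
proof -
  let ?l = "\<lambda>h g. (a \<otimes>\<^bsub>A,H4\<^esub> h) \<cdot>\<^bsub>crossed_product A H4 (trivial_action A H4) (h4_cocycle A z)\<^esub> (c \<otimes>\<^bsub>A,H4\<^esub> g)"
  let ?r = "\<lambda>h g. (a \<cdot>\<^bsub>A\<^esub> c) \<otimes>\<^bsub>A,H4\<^esub> (h \<cdot>\<^bsub>H4\<^esub> g) + (a \<cdot>\<^bsub>A\<^esub> c \<cdot>\<^bsub>A\<^esub> z) \<otimes>\<^bsub>A,H4\<^esub> h4_defect h g"
  note kA = bialgebraD(3)[OF A]
  note bi = A kbilinear_trivial_action[OF kA coalgebra_H4] kbilinear_h4_cocycle[OF A z]
  let ?T = "tensor_space A (H4 :: ('k, 'k h4) hopf)"
  note M = kbilinear_crossed_mult[OF A bialgebra_H4 bi(2,3)]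
  note lin = H4_lin H4_defect_lin bialgebraD(8)[OF A] a c z
    klinear_bilinear_left[OF M] klinear_bilinear_right[OF M]
  note ts = kbilinear_simps[OF kbilinear_tens[of A H4] kA kspace_H4]
  note ms = kbilinear_simps[OF bialgebraD(4)[OF A] kA kA]
  show ?thesis
  proof (rule kbilinear_H4_eqI[of ?T ?l ?r])
    show "klinear H4 ?T (\<lambda>h. ?l h g)" "klinear H4 ?T (\<lambda>g. ?l h g)" for h g
      by (rule lin | assumption)+
    show "klinear H4 ?T (\<lambda>h. ?r h g)" "klinear H4 ?T (\<lambda>g. ?r h g)" for h g
      by (rule lin | assumption)+
    show "?l (h4_vec i) (h4_vec j) = ?r (h4_vec i) (h4_vec j)" for i j
      unfolding crossed_mult_H4_basis[OF bi a c] hmult_H4_basis h4_defect_basis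
      by (cases i; cases j) (simp_all add: trivial_action_apply H4_in c a z hcounit_H4_basis
          h4_cocycle_basis[OF A] kspace_scale[OF kA] bialgebraD(5,8,12)[OF A] ts ms add_ac
          kspace_closed[OF kA])
  qed
qed


section \<open>Every central primitive element gives a crossed system\<close>

locale hopf_central_primitive =
  fixes A :: "('k::field, 'a::ab_group_add, 'm) hopf_scheme" and z :: 'a
  assumes hopf_A: "hopf_algebra A" and z: "z \<in> central_primitives A"
begin

lemma z_in: "z \<in> vcarrier A"
  and z_central: "y \<in> vcarrier A \<Longrightarrow> z \<cdot>\<^bsub>A\<^esub> y = y \<cdot>\<^bsub>A\<^esub> z"
  and z_primitive: "hcomult A z = z \<otimes>\<^bsub>A,A\<^esub> hone A + hone A \<otimes>\<^bsub>A,A\<^esub> z"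
  using z by (auto simp: central_primitives_def)

sublocale crossed_product_H4 A "trivial_action A H4" "h4_cocycle A z"
proof
  show bialg: "bialgebra A"
    using hopf_A by (simp add: hopf_algebra_def)
  show "kbilinear H4 A A (trivial_action A H4)"
    by (rule kbilinear_trivial_action[OF bialgebraD(3)[OF bialg] coalgebra_H4])
  show "kbilinear H4 H4 A (h4_cocycle A z)"
    by (rule kbilinear_h4_cocycle[OF bialg z_in])
qed

lemmas co_B = coalgebra_tensor[OF tens_co_B co_A coalgebra_H4]
lemmas lin_D = lin_B H4_defect_lin z_in

lemmas mult_B_tens = crossed_mult_defect[OF bialg_A z_in]

lemmas tens_add = kbilinearD(2,3)[OF kbilinear_tens[of A K], OF _ H4_in]

text \<open>
  Primitivity of \<open>z\<close>, for an arbitrary bilinear map.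
\<close>

lemma sweedler_z:
  assumes W: "kspace W" and F: "kbilinear A A W F"
  shows "sweedler A z F = F z (hone A) + F (hone A) z"
proof -
  have l: "klinear (tensor_space A A) W (tensor_lift A A F)"
    by (intro tensor_lift_universal(1) k_A W F)
  show ?thesis
    unfolding sweedler_def z_primitive
    by (simp add: klinear_add[OF l] tens_closed z_in bialgebraD(5)[OF bialg_A]
        tensor_lift_tens[OF k_A k_A W F])
qed

lemma counit_z: "hcounit A z = 0"
proof -
  have "sweedler A z (\<lambda>p q. hcounit A p * hcounit A q) = hcounit A z"
    using sweedler_counit(1)[OF co_A kspace_base_field z_in klinear_counit[OF co_A klinear_id]]
    by (simp add: base_field_def)
  moreover have "sweedler A z (\<lambda>p q. hcounit A p * hcounit A q) = hcounit A z + hcounit A z"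
    by (subst sweedler_z[OF kspace_base_field])
      ((rule lin_D | assumption)+, simp add: bialgebraD[OF bialg_A])
  ultimately show ?thesis by (metis add_cancel_left_left)
qed

text \<open>
  On pure tensors both sides are expanded in powers of \<open>z\<close>. Collecting them needs that \<open>z\<close> is central.
\<close>

lemma mult_B_assoc:
  assumes "s \<in> vcarrier T" "t \<in> vcarrier T" "u \<in> vcarrier T"
  shows "(s \<cdot>\<^bsub>B\<^esub> t) \<cdot>\<^bsub>B\<^esub> u = s \<cdot>\<^bsub>B\<^esub> (t \<cdot>\<^bsub>B\<^esub> u)"
proof -
  have pure: "((a \<otimes>\<^bsub>A,K\<^esub> h) \<cdot>\<^bsub>B\<^esub> (b \<otimes>\<^bsub>A,K\<^esub> g)) \<cdot>\<^bsub>B\<^esub> (c \<otimes>\<^bsub>A,K\<^esub> l) =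
      (a \<otimes>\<^bsub>A,K\<^esub> h) \<cdot>\<^bsub>B\<^esub> ((b \<otimes>\<^bsub>A,K\<^esub> g) \<cdot>\<^bsub>B\<^esub> (c \<otimes>\<^bsub>A,K\<^esub> l))"
    if abc: "a \<in> vcarrier A" "b \<in> vcarrier A" "c \<in> vcarrier A" for a b c h g l
  proof -
    note cl = abc z_in bialgebraD(8)[OF bialg_A] H4_in tens_closed
    note add = kbilinearD(2,3)[OF mult_B]
    let ?p = "a \<cdot>\<^bsub>A\<^esub> b \<cdot>\<^bsub>A\<^esub> c"
    have zc: "a \<cdot>\<^bsub>A\<^esub> b \<cdot>\<^bsub>A\<^esub> z \<cdot>\<^bsub>A\<^esub> c = ?p \<cdot>\<^bsub>A\<^esub> z"
      using abc z_in z_central[of c] by (simp add: bialgebraD(8)[OF bialg_A] flip: bialgebraD(10)[OF bialg_A])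
    have "((a \<otimes>\<^bsub>A,K\<^esub> h) \<cdot>\<^bsub>B\<^esub> (b \<otimes>\<^bsub>A,K\<^esub> g)) \<cdot>\<^bsub>B\<^esub> (c \<otimes>\<^bsub>A,K\<^esub> l) =
        ?p \<otimes>\<^bsub>A,K\<^esub> (h \<cdot>\<^bsub>K\<^esub> g \<cdot>\<^bsub>K\<^esub> l) +
        (?p \<cdot>\<^bsub>A\<^esub> z) \<otimes>\<^bsub>A,K\<^esub> (h4_defect h g \<cdot>\<^bsub>K\<^esub> l + h4_defect (h \<cdot>\<^bsub>K\<^esub> g) l)"
      by (simp add: mult_B_tens add cl zc h4_defect_defect tens_simps tens_add ac_simps)
    moreover have "(a \<otimes>\<^bsub>A,K\<^esub> h) \<cdot>\<^bsub>B\<^esub> ((b \<otimes>\<^bsub>A,K\<^esub> g) \<cdot>\<^bsub>B\<^esub> (c \<otimes>\<^bsub>A,K\<^esub> l)) =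
        ?p \<otimes>\<^bsub>A,K\<^esub> (h \<cdot>\<^bsub>K\<^esub> (g \<cdot>\<^bsub>K\<^esub> l)) +
        (?p \<cdot>\<^bsub>A\<^esub> z) \<otimes>\<^bsub>A,K\<^esub> (h \<cdot>\<^bsub>K\<^esub> h4_defect g l + h4_defect h (g \<cdot>\<^bsub>K\<^esub> l))"
      by (simp add: mult_B_tens add cl bialgebraD(10)[OF bialg_A] h4_defect_defect tens_simps
          tens_add ac_simps)
    ultimately show ?thesis
      by (simp add: h4_defect_cocycle H4_mult_assoc)
  qed
  note lin = lin_D assms
  have 1: "((a \<otimes>\<^bsub>A,K\<^esub> h) \<cdot>\<^bsub>B\<^esub> (b \<otimes>\<^bsub>A,K\<^esub> g)) \<cdot>\<^bsub>B\<^esub> u =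
      (a \<otimes>\<^bsub>A,K\<^esub> h) \<cdot>\<^bsub>B\<^esub> ((b \<otimes>\<^bsub>A,K\<^esub> g) \<cdot>\<^bsub>B\<^esub> u)"
    if ab: "a \<in> vcarrier A" "b \<in> vcarrier A" for a b h g
    by (rule klinear_tensor_eqI[where U = A and V = K and W = T, OF _ _ _ _ _ _ assms(3)])
      (rule lin pure ab | assumption)+
  show ?thesis
    by (rule kbilinear_tensor_eqI[where U = A and V = K and W = T and
          F = "\<lambda>s t. (s \<cdot>\<^bsub>B\<^esub> t) \<cdot>\<^bsub>B\<^esub> u" and G = "\<lambda>s t. s \<cdot>\<^bsub>B\<^esub> (t \<cdot>\<^bsub>B\<^esub> u)"])
      (rule lin 1 | assumption)+
qed

lemma hone_B_in: "hone B \<in> vcarrier T"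
  unfolding hone_B by (rule lin_D)+

lemma mult_B_one:
  assumes "t \<in> vcarrier T"
  shows "hone B \<cdot>\<^bsub>B\<^esub> t = t" "t \<cdot>\<^bsub>B\<^esub> hone B = t"
proof -
  note lin = lin_D hone_B_in
  have l: "klinear T T (\<lambda>t. hone B \<cdot>\<^bsub>B\<^esub> t)" and r: "klinear T T (\<lambda>t. t \<cdot>\<^bsub>B\<^esub> hone B)"
    by (rule lin | assumption)+
  have "hone B \<cdot>\<^bsub>B\<^esub> (a \<otimes>\<^bsub>A,K\<^esub> h) = a \<otimes>\<^bsub>A,K\<^esub> h" "(a \<otimes>\<^bsub>A,K\<^esub> h) \<cdot>\<^bsub>B\<^esub> hone B = a \<otimes>\<^bsub>A,K\<^esub> h"
    if "a \<in> vcarrier A" for a h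
    using that unfolding hone_B
    by (simp_all add: mult_B_tens bialgebraD[OF bialg_A] z_in h4_defect_one H4_mult_one tens_simps)
  note this = klinear_tensor_eqI[OF k_A kspace_H4 kspace_tensor_space l klinear_id this(1) assms]
    klinear_tensor_eqI[OF k_A kspace_H4 kspace_tensor_space r klinear_id this(2) assms]
  then show "hone B \<cdot>\<^bsub>B\<^esub> t = t" "t \<cdot>\<^bsub>B\<^esub> hone B = t" by auto
qed

lemma algebra_B: "algebra B"
  unfolding algebra_def cong_B sel_B
  using mult_B kspace_tensor_space hone_B_in mult_B_assoc mult_B_one by auto

lemma counit_B_mult:
  assumes "s \<in> vcarrier T" "t \<in> vcarrier T"
  shows "hcounit B (s \<cdot>\<^bsub>B\<^esub> t) = hcounit B s * hcounit B t"
proof (rule kbilinear_tensor_eqI[OF k_A kspace_H4 kspace_base_field _ _ _ assms])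
  note lin = lin_D klinear_comp[OF klinear_counit_B]
  show "kbilinear T T base_field (\<lambda>s t. hcounit B (s \<cdot>\<^bsub>B\<^esub> t))"
    "kbilinear T T base_field (\<lambda>s t. hcounit B s * hcounit B t)"
    by (rule lin | assumption)+
  show "hcounit B ((a \<otimes>\<^bsub>A,K\<^esub> h) \<cdot>\<^bsub>B\<^esub> (c \<otimes>\<^bsub>A,K\<^esub> g)) =
      hcounit B (a \<otimes>\<^bsub>A,K\<^esub> h) * hcounit B (c \<otimes>\<^bsub>A,K\<^esub> g)"
    if "a \<in> vcarrier A" "c \<in> vcarrier A" for a c h g
    using that
    by (simp add: mult_B_tens klinear_add[OF klinear_counit_B] tens_closed H4_in z_in counit_z
        bialgebraD(8,9)[OF bialg_A] H4_counit_mult counit_B_tens)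
qed

text \<open>
  The right-hand side is rearranged until the two sums over \<open>H\<^sub>4\<close> are innermost. There the expansion in
  \<open>z\<close> has four terms: one is the comultiplication of \<open>h g\<close>, two are the comultiplication of the defect
  with a factor \<open>z\<close> in one of the legs, and the term with \<open>z\<close> in both legs vanishes. As \<open>z\<close> is
  primitive, the two middle terms together are the comultiplication of \<open>a c z\<close> on the left-hand side.
\<close>

lemma comult_B_mult_pure:
  assumes a: "a \<in> vcarrier A" and c: "c \<in> vcarrier A"
  shows "hcomult B ((a \<otimes>\<^bsub>A,K\<^esub> h) \<cdot>\<^bsub>B\<^esub> (c \<otimes>\<^bsub>A,K\<^esub> g)) =
    sweedler B (a \<otimes>\<^bsub>A,K\<^esub> h) (\<lambda>s1 s2. sweedler B (c \<otimes>\<^bsub>A,K\<^esub> g) (\<lambda>t1 t2.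
      (s1 \<cdot>\<^bsub>B\<^esub> t1) \<otimes>\<^bsub>T,T\<^esub> (s2 \<cdot>\<^bsub>B\<^esub> t2)))"
proof -
  let ?T2 = "tensor_space T T"
  let ?D = "h4_defect h g"
  note lin = lin_D a c
  let ?G = "\<lambda>p q. sweedler K (h \<cdot>\<^bsub>K\<^esub> g) (\<lambda>u v. (p \<otimes>\<^bsub>A,K\<^esub> u) \<otimes>\<^bsub>T,T\<^esub> (q \<otimes>\<^bsub>A,K\<^esub> v))"
  let ?E = "\<lambda>p q. sweedler K ?D (\<lambda>u v. (p \<otimes>\<^bsub>A,K\<^esub> u) \<otimes>\<^bsub>T,T\<^esub> (q \<otimes>\<^bsub>A,K\<^esub> v))"
  let ?N = "\<lambda>p q. ?G p q + (?E (p \<cdot>\<^bsub>A\<^esub> z) q + ?E p (q \<cdot>\<^bsub>A\<^esub> z))"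
  have bG: "kbilinear A A ?T2 ?G" and bE: "kbilinear A A ?T2 ?E"
    by (rule lin | assumption)+
  have bN: "kbilinear A A ?T2 ?N"
    and bE': "kbilinear A A ?T2 (\<lambda>p q. ?E (p \<cdot>\<^bsub>A\<^esub> z) q + ?E p (q \<cdot>\<^bsub>A\<^esub> z))"
    by (rule lin | assumption)+
  have Ez: "sweedler A (b \<cdot>\<^bsub>A\<^esub> z) ?E = sweedler A b (\<lambda>p q. ?E (p \<cdot>\<^bsub>A\<^esub> z) q + ?E p (q \<cdot>\<^bsub>A\<^esub> z))"
    if b: "b \<in> vcarrier A" for b
  proof -
    have "sweedler A z (\<lambda>z1 z2. ?E (p \<cdot>\<^bsub>A\<^esub> z1) (q \<cdot>\<^bsub>A\<^esub> z2)) = ?E (p \<cdot>\<^bsub>A\<^esub> z) q + ?E p (q \<cdot>\<^bsub>A\<^esub> z)"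
      if "p \<in> vcarrier A" "q \<in> vcarrier A" for p q
    proof -
      have "sweedler A z (\<lambda>z1 z2. ?E (p \<cdot>\<^bsub>A\<^esub> z1) (q \<cdot>\<^bsub>A\<^esub> z2)) =
          ?E (p \<cdot>\<^bsub>A\<^esub> z) (q \<cdot>\<^bsub>A\<^esub> hone A) + ?E (p \<cdot>\<^bsub>A\<^esub> hone A) (q \<cdot>\<^bsub>A\<^esub> z)"
        by (rule sweedler_z[of ?T2]) (rule lin that | assumption)+
      then show ?thesis
        using that by (simp add: bialgebraD(12)[OF bialg_A])
    qed
    then show ?thesis
      using sweedler_mult[OF bialg_A kspace_tensor_space b z_in bE] by (simp cong: sweedler_cong)
  qed
  have inner: "sweedler K h (\<lambda>h1 h2. sweedler K g (\<lambda>g1 g2.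
      (p \<otimes>\<^bsub>A,K\<^esub> (h1 \<cdot>\<^bsub>K\<^esub> g1) + (p \<cdot>\<^bsub>A\<^esub> z) \<otimes>\<^bsub>A,K\<^esub> h4_defect h1 g1) \<otimes>\<^bsub>T,T\<^esub>
      (q \<otimes>\<^bsub>A,K\<^esub> (h2 \<cdot>\<^bsub>K\<^esub> g2) + (q \<cdot>\<^bsub>A\<^esub> z) \<otimes>\<^bsub>A,K\<^esub> h4_defect h2 g2))) = ?N p q"
    if pq: "p \<in> vcarrier A" "q \<in> vcarrier A" for p q
  proof -
    note linp = lin pq
    have pz: "p \<cdot>\<^bsub>A\<^esub> z \<in> vcarrier A" "q \<cdot>\<^bsub>A\<^esub> z \<in> vcarrier A"
      by (rule linp)+
    let ?F = "\<lambda>p q u v. (p \<otimes>\<^bsub>A,K\<^esub> u) \<otimes>\<^bsub>T,T\<^esub> (q \<otimes>\<^bsub>A,K\<^esub> v)"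
    have bF: "kbilinear K K ?T2 (?F p q)" if "p \<in> vcarrier A" "q \<in> vcarrier A" for p q
      by (rule lin that | assumption)+
    \<comment> \<open>The tensor product of the two sums is expanded into four terms, which are then summed
      separately.\<close>
    have sp: "sweedler K h (\<lambda>h1 h2. sweedler K g (\<lambda>g1 g2. F1 h1 h2 g1 g2 + F2 h1 h2 g1 g2)) =
        sweedler K h (\<lambda>h1 h2. sweedler K g (F1 h1 h2)) + sweedler K h (\<lambda>h1 h2. sweedler K g (F2 h1 h2))"
      if "\<And>h1 h2. kbilinear K K ?T2 (F1 h1 h2)" "\<And>h1 h2. kbilinear K K ?T2 (F2 h1 h2)"
        "kbilinear K K ?T2 (\<lambda>h1 h2. sweedler K g (F1 h1 h2))"
        "kbilinear K K ?T2 (\<lambda>h1 h2. sweedler K g (F2 h1 h2))" for F1 F2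
      unfolding sweedler_plus[OF coalgebra_H4 kspace_tensor_space H4_in that(1,2)]
      by (rule sweedler_plus[OF coalgebra_H4 kspace_tensor_space H4_in that(3,4)])
    have "sweedler K h (\<lambda>h1 h2. sweedler K g (\<lambda>g1 g2.
      (p \<otimes>\<^bsub>A,K\<^esub> (h1 \<cdot>\<^bsub>K\<^esub> g1) + (p \<cdot>\<^bsub>A\<^esub> z) \<otimes>\<^bsub>A,K\<^esub> h4_defect h1 g1) \<otimes>\<^bsub>T,T\<^esub>
      (q \<otimes>\<^bsub>A,K\<^esub> (h2 \<cdot>\<^bsub>K\<^esub> g2) + (q \<cdot>\<^bsub>A\<^esub> z) \<otimes>\<^bsub>A,K\<^esub> h4_defect h2 g2))) =
      sweedler K h (\<lambda>h1 h2. sweedler K g (\<lambda>g1 g2.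
        ?F p q (h1 \<cdot>\<^bsub>K\<^esub> g1) (h2 \<cdot>\<^bsub>K\<^esub> g2) + (?F (p \<cdot>\<^bsub>A\<^esub> z) q (h4_defect h1 g1) (h2 \<cdot>\<^bsub>K\<^esub> g2) +
        (?F p (q \<cdot>\<^bsub>A\<^esub> z) (h1 \<cdot>\<^bsub>K\<^esub> g1) (h4_defect h2 g2) +
        ?F (p \<cdot>\<^bsub>A\<^esub> z) (q \<cdot>\<^bsub>A\<^esub> z) (h4_defect h1 g1) (h4_defect h2 g2)))))"
      by (intro sweedler_cong)
        (simp add: kbilinearD(2,3)[OF kbilinear_tens[of T T]] tens_closed pq pz H4_in
          kspace_closed[OF kspace_tensor_space] ac_simps)
    also have "\<dots> = sweedler K h (\<lambda>h1 h2. sweedler K g (\<lambda>g1 g2. ?F p q (h1 \<cdot>\<^bsub>K\<^esub> g1) (h2 \<cdot>\<^bsub>K\<^esub> g2))) +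
        (sweedler K h (\<lambda>h1 h2. sweedler K g (\<lambda>g1 g2. ?F (p \<cdot>\<^bsub>A\<^esub> z) q (h4_defect h1 g1) (h2 \<cdot>\<^bsub>K\<^esub> g2))) +
        (sweedler K h (\<lambda>h1 h2. sweedler K g (\<lambda>g1 g2. ?F p (q \<cdot>\<^bsub>A\<^esub> z) (h1 \<cdot>\<^bsub>K\<^esub> g1) (h4_defect h2 g2))) +
        sweedler K h (\<lambda>h1 h2. sweedler K g (\<lambda>g1 g2.
          ?F (p \<cdot>\<^bsub>A\<^esub> z) (q \<cdot>\<^bsub>A\<^esub> z) (h4_defect h1 g1) (h4_defect h2 g2)))))"
      by (subst sp, (rule linp | assumption)+)+ (rule refl)
    also have "\<dots> = ?N p q"
      by (simp add: H4_comult_mult[OF kspace_tensor_space bF] pq pz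
          h4_defect_bicolinear[OF kspace_tensor_space bF])
    finally show ?thesis .
  qed
  have "hcomult B ((a \<otimes>\<^bsub>A,K\<^esub> h) \<cdot>\<^bsub>B\<^esub> (c \<otimes>\<^bsub>A,K\<^esub> g)) =
      sweedler A (a \<cdot>\<^bsub>A\<^esub> c) ?G + sweedler A (a \<cdot>\<^bsub>A\<^esub> c \<cdot>\<^bsub>A\<^esub> z) ?E"
    using a c z_in
    by (simp add: mult_B_tens klinear_add[OF klinear_comult_B] tens_closed H4_in
        bialgebraD(8)[OF bialg_A] comult_B_tens)
  also have "\<dots> = sweedler A (a \<cdot>\<^bsub>A\<^esub> c) ?N"
    unfolding Ez[OF bialgebraD(8)[OF bialg_A a c]]
    by (rule sweedler_plus[OF co_A kspace_tensor_space bialgebraD(8)[OF bialg_A a c] bG bE', symmetric])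
  also have "\<dots> = sweedler A a (\<lambda>a1 a2. sweedler A c (\<lambda>c1 c2. ?N (a1 \<cdot>\<^bsub>A\<^esub> c1) (a2 \<cdot>\<^bsub>A\<^esub> c2)))"
    by (rule sweedler_mult[OF bialg_A kspace_tensor_space a c bN])
  also have "\<dots> = sweedler A a (\<lambda>a1 a2. sweedler A c (\<lambda>c1 c2.
      sweedler K h (\<lambda>h1 h2. sweedler K g (\<lambda>g1 g2.
        ((a1 \<otimes>\<^bsub>A,K\<^esub> h1) \<cdot>\<^bsub>B\<^esub> (c1 \<otimes>\<^bsub>A,K\<^esub> g1)) \<otimes>\<^bsub>T,T\<^esub> ((a2 \<otimes>\<^bsub>A,K\<^esub> h2) \<cdot>\<^bsub>B\<^esub> (c2 \<otimes>\<^bsub>A,K\<^esub> g2))))))"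
    by (intro sweedler_cong) (simp add: inner bialgebraD(8)[OF bialg_A] mult_B_tens)
  also have "\<dots> = sweedler A a (\<lambda>a1 a2. sweedler K h (\<lambda>h1 h2. sweedler A c (\<lambda>c1 c2.
      sweedler K g (\<lambda>g1 g2.
        ((a1 \<otimes>\<^bsub>A,K\<^esub> h1) \<cdot>\<^bsub>B\<^esub> (c1 \<otimes>\<^bsub>A,K\<^esub> g1)) \<otimes>\<^bsub>T,T\<^esub> ((a2 \<otimes>\<^bsub>A,K\<^esub> h2) \<cdot>\<^bsub>B\<^esub> (c2 \<otimes>\<^bsub>A,K\<^esub> g2))))))"
    by (rule sweedler_cong, rule sweedler_swap[where W = ?T2]) (rule lin | assumption)+
  also have "\<dots> = sweedler A a (\<lambda>a1 a2. sweedler K h (\<lambda>h1 h2. sweedler B (c \<otimes>\<^bsub>A,K\<^esub> g) (\<lambda>t1 t2.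
        ((a1 \<otimes>\<^bsub>A,K\<^esub> h1) \<cdot>\<^bsub>B\<^esub> t1) \<otimes>\<^bsub>T,T\<^esub> ((a2 \<otimes>\<^bsub>A,K\<^esub> h2) \<cdot>\<^bsub>B\<^esub> t2))))"
    by (rule sweedler_cong, rule sweedler_cong, rule sweedler_B[where W = ?T2, symmetric])
      (rule lin | assumption)+
  also have "\<dots> = sweedler B (a \<otimes>\<^bsub>A,K\<^esub> h) (\<lambda>s1 s2. sweedler B (c \<otimes>\<^bsub>A,K\<^esub> g) (\<lambda>t1 t2.
      (s1 \<cdot>\<^bsub>B\<^esub> t1) \<otimes>\<^bsub>T,T\<^esub> (s2 \<cdot>\<^bsub>B\<^esub> t2)))"
    by (rule sweedler_B[where W = ?T2, symmetric]) (rule lin | assumption)+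
  finally show ?thesis .
qed

lemma comult_B_mult:
  assumes "s \<in> vcarrier T" "t \<in> vcarrier T"
  shows "hcomult B (s \<cdot>\<^bsub>B\<^esub> t) = sweedler B s (\<lambda>s1 s2. sweedler B t (\<lambda>t1 t2.
      (s1 \<cdot>\<^bsub>B\<^esub> t1) \<otimes>\<^bsub>T,T\<^esub> (s2 \<cdot>\<^bsub>B\<^esub> t2)))"
proof (rule kbilinear_tensor_eqI[where F = "\<lambda>s t. hcomult B (s \<cdot>\<^bsub>B\<^esub> t)" and
      G = "\<lambda>s t. sweedler B s (\<lambda>s1 s2. sweedler B t (\<lambda>t1 t2. (s1 \<cdot>\<^bsub>B\<^esub> t1) \<otimes>\<^bsub>T,T\<^esub> (s2 \<cdot>\<^bsub>B\<^esub> t2)))",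
      OF k_A kspace_H4 kspace_tensor_space _ _ _ assms])
  note lin = lin_D klinear_comp[OF klinear_comult_B]
  show "kbilinear T T (tensor_space T T) (\<lambda>s t. hcomult B (s \<cdot>\<^bsub>B\<^esub> t))"
    "kbilinear T T (tensor_space T T) (\<lambda>s t. sweedler B s (\<lambda>s1 s2. sweedler B t (\<lambda>t1 t2.
      (s1 \<cdot>\<^bsub>B\<^esub> t1) \<otimes>\<^bsub>T,T\<^esub> (s2 \<cdot>\<^bsub>B\<^esub> t2))))"
    by (rule lin | assumption)+
qed (rule comult_B_mult_pure)

lemma bialgebra_B: "bialgebra B"
proof -
  have "hcomult B (hone B) = hone B \<otimes>\<^bsub>T,T\<^esub> hone B"
  proof -
    have sK: "sweedler K (hone K) F = F (hone K) (hone K)" if "kspace W" "kbilinear K K W F"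
      for W :: "('k, 'w::ab_group_add, 'n) vspace_scheme" and F
      unfolding sweedler_def bialgebraD(6)[OF bialgebra_H4]
      by (rule tensor_lift_tens[OF kspace_H4 kspace_H4 that H4_in H4_in])
    have "hcomult B (hone B) = sweedler A (hone A) (\<lambda>p q. sweedler K (hone K)
        (\<lambda>u v. (p \<otimes>\<^bsub>A,K\<^esub> u) \<otimes>\<^bsub>T,T\<^esub> (q \<otimes>\<^bsub>A,K\<^esub> v)))"
      unfolding hone_B by (rule comult_B_tens[OF one_A])
    also have "\<dots> = sweedler K (hone K)
        (\<lambda>u v. (hone A \<otimes>\<^bsub>A,K\<^esub> u) \<otimes>\<^bsub>T,T\<^esub> (hone A \<otimes>\<^bsub>A,K\<^esub> v))"
      by (rule sweedler_one_A[of "tensor_space T T"]) (rule lin_D | assumption)+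
    also have "\<dots> = hone B \<otimes>\<^bsub>T,T\<^esub> hone B"
      unfolding hone_B by (rule sK[of "tensor_space T T"]) (rule lin_D | assumption)+
    finally show ?thesis .
  qed
  moreover have "hcounit B (hone B) = 1"
    unfolding hone_B by (simp add: counit_B_tens bialgebraD[OF bialg_A] bialgebraD(7)[OF bialgebra_H4])
  ultimately show ?thesis
    unfolding bialgebra_def cong_B sel_B(1)
    using algebra_B co_B comult_B_mult counit_B_mult by blast
qed

text \<open>
  With \<open>S a # S h\<close> as antipode, the part of the antipode equations without \<open>z\<close> is the product of those
  of \<open>A\<close> and \<open>H\<^sub>4\<close>, and the part with \<open>z\<close> vanishes by \<open>h4_defect_antipode\<close>.
\<close>

lemma hopf_algebra_B: "hopf_algebra B"
proof -
  obtain S where S: "is_antipode A S"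
    using hopf_A by (auto simp: hopf_algebra_def)
  then have linS: "klinear A A S"
    and Sl: "\<And>h. h \<in> vcarrier A \<Longrightarrow> sweedler A h (\<lambda>h1 h2. S h1 \<cdot>\<^bsub>A\<^esub> h2) = vscale A (hcounit A h) (hone A)"
    and Sr: "\<And>h. h \<in> vcarrier A \<Longrightarrow> sweedler A h (\<lambda>h1 h2. h1 \<cdot>\<^bsub>A\<^esub> S h2) = vscale A (hcounit A h) (hone A)"
    by (auto simp: is_antipode_def)
  note S_in = klinear_in[OF linS]
  let ?s = "\<lambda>a h. S a \<otimes>\<^bsub>A,K\<^esub> h4_antipode h"
  define SB where "SB = tensor_lift A K ?s"
  note lin0 = lin_D klinear_comp[OF linS] klinear_comp[OF klinear_h4_antipode] S_in
  have bs: "kbilinear A K T ?s"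
    by (rule lin0 | assumption)+
  have linSB: "klinear T T SB"
    unfolding SB_def by (rule tensor_lift_universal(1)[OF k_A kspace_H4 kspace_tensor_space bs])
  have SBt: "SB (a \<otimes>\<^bsub>A,K\<^esub> h) = S a \<otimes>\<^bsub>A,K\<^esub> h4_antipode h" if "a \<in> vcarrier A" for a h
    unfolding SB_def by (rule tensor_lift_tens[OF k_A kspace_H4 kspace_tensor_space bs that H4_in])
  note lin = lin0 klinear_comp[OF linSB] klinear_in[OF linSB] klinear_comp[OF klinear_counit_B] hone_B_in
  have sK: "sweedler K h (\<lambda>h1 h2. p \<otimes>\<^bsub>A,K\<^esub> F h1 h2 + q \<otimes>\<^bsub>A,K\<^esub> F' h1 h2) =
      p \<otimes>\<^bsub>A,K\<^esub> sweedler K h F + q \<otimes>\<^bsub>A,K\<^esub> sweedler K h F'"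
    if "p \<in> vcarrier A" "q \<in> vcarrier A" "kbilinear K K K F" "kbilinear K K K F'" for p q h F F'
  proof -
    note Fl = klinear_bilinear_left[OF that(3)] klinear_bilinear_right[OF that(3)]
      klinear_bilinear_left[OF that(4)] klinear_bilinear_right[OF that(4)]
    have t: "klinear K T (\<lambda>h. p \<otimes>\<^bsub>A,K\<^esub> h)" "klinear K T (\<lambda>h. q \<otimes>\<^bsub>A,K\<^esub> h)"
      by (rule lin that | assumption)+
    have "sweedler K h (\<lambda>h1 h2. p \<otimes>\<^bsub>A,K\<^esub> F h1 h2 + q \<otimes>\<^bsub>A,K\<^esub> F' h1 h2) =
      sweedler K h (\<lambda>h1 h2. p \<otimes>\<^bsub>A,K\<^esub> F h1 h2) + sweedler K h (\<lambda>h1 h2. q \<otimes>\<^bsub>A,K\<^esub> F' h1 h2)"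
      by (rule sweedler_plus[where W = T]) (rule lin Fl that | assumption)+
    then show ?thesis
      unfolding sweedler_push[OF coalgebra_H4 kspace_H4 kspace_tensor_space H4_in that(3) t(1)]
        sweedler_push[OF coalgebra_H4 kspace_H4 kspace_tensor_space H4_in that(4) t(2)] .
  qed
  have aK: "sweedler K h (\<lambda>h1 h2. h4_antipode h1 \<cdot>\<^bsub>K\<^esub> h2) = vscale K (hcounit K h) (hone K)"
    "sweedler K h (\<lambda>h1 h2. h1 \<cdot>\<^bsub>K\<^esub> h4_antipode h2) = vscale K (hcounit K h) (hone K)" for h
    using is_antipode_H4[where 'k = 'k] by (simp_all add: is_antipode_def H4_in)
  have bK: "kbilinear K K K (\<lambda>h1 h2. h4_antipode h1 \<cdot>\<^bsub>K\<^esub> h2)"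
    "kbilinear K K K (\<lambda>h1 h2. h1 \<cdot>\<^bsub>K\<^esub> h4_antipode h2)"
    "kbilinear K K K (\<lambda>h1 h2. h4_defect (h4_antipode h1) h2)"
    "kbilinear K K K (\<lambda>h1 h2. h4_defect h1 (h4_antipode h2))"
    by (rule lin | assumption)+
  have bA: "kbilinear A A A (\<lambda>a1 a2. S a1 \<cdot>\<^bsub>A\<^esub> a2)" "kbilinear A A A (\<lambda>a1 a2. a1 \<cdot>\<^bsub>A\<^esub> S a2)"
    by (rule lin | assumption)+
  have tA: "klinear A T (\<lambda>a. a \<otimes>\<^bsub>A,K\<^esub> h)" for h
    by (rule lin | assumption)+
  have eps: "vscale A c (hone A) \<otimes>\<^bsub>A,K\<^esub> vscale K d (hone K) = vscale T (c * d) (hone B)" for c d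
    unfolding hone_B
    by (simp add: kbilinearD(4,5)[OF kbilinear_tens] bialgebraD(5)[OF bialg_A] H4_in
        kspace_closed[OF k_A] kspace_scale[OF kspace_tensor_space] mult.commute)
  have left: "sweedler B t (\<lambda>t1 t2. SB t1 \<cdot>\<^bsub>B\<^esub> t2) = vscale T (hcounit B t) (hone B)"
    if t: "t \<in> vcarrier T" for t
  proof (rule klinear_tensor_eqI[where U = A and V = K and W = T, OF _ _ _ _ _ _ t])
    show "kspace A" "kspace K" "kspace T" by (rule lin)+
    show "klinear T T (\<lambda>t. sweedler B t (\<lambda>t1 t2. SB t1 \<cdot>\<^bsub>B\<^esub> t2))"
      "klinear T T (\<lambda>t. vscale T (hcounit B t) (hone B))"
      by (rule lin | assumption)+
    fix a h assume a: "a \<in> vcarrier A"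
    have "sweedler B (a \<otimes>\<^bsub>A,K\<^esub> h) (\<lambda>t1 t2. SB t1 \<cdot>\<^bsub>B\<^esub> t2) =
        sweedler A a (\<lambda>a1 a2. sweedler K h (\<lambda>h1 h2. SB (a1 \<otimes>\<^bsub>A,K\<^esub> h1) \<cdot>\<^bsub>B\<^esub> (a2 \<otimes>\<^bsub>A,K\<^esub> h2)))"
      by (rule sweedler_B[where W = T]) (rule lin a | assumption)+
    also have "\<dots> = sweedler A a (\<lambda>a1 a2. (S a1 \<cdot>\<^bsub>A\<^esub> a2) \<otimes>\<^bsub>A,K\<^esub> vscale K (hcounit K h) (hone K))"
      by (intro sweedler_cong)
        (simp add: SBt mult_B_tens S_in sK bK bialgebraD(8)[OF bialg_A] z_in aK h4_defect_antipode tens_simps)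
    also have "\<dots> = vscale A (hcounit A a) (hone A) \<otimes>\<^bsub>A,K\<^esub> vscale K (hcounit K h) (hone K)"
      using sweedler_push[OF co_A k_A kspace_tensor_space a bA(1) tA] Sl[OF a] by simp
    finally show "sweedler B (a \<otimes>\<^bsub>A,K\<^esub> h) (\<lambda>t1 t2. SB t1 \<cdot>\<^bsub>B\<^esub> t2) =
        vscale T (hcounit B (a \<otimes>\<^bsub>A,K\<^esub> h)) (hone B)"
      by (simp add: eps counit_B_tens a)
  qed
  have right: "sweedler B t (\<lambda>t1 t2. t1 \<cdot>\<^bsub>B\<^esub> SB t2) = vscale T (hcounit B t) (hone B)"
    if t: "t \<in> vcarrier T" for t
  proof (rule klinear_tensor_eqI[where U = A and V = K and W = T, OF _ _ _ _ _ _ t])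
    show "kspace A" "kspace K" "kspace T" by (rule lin)+
    show "klinear T T (\<lambda>t. sweedler B t (\<lambda>t1 t2. t1 \<cdot>\<^bsub>B\<^esub> SB t2))"
      "klinear T T (\<lambda>t. vscale T (hcounit B t) (hone B))"
      by (rule lin | assumption)+
    fix a h assume a: "a \<in> vcarrier A"
    have "sweedler B (a \<otimes>\<^bsub>A,K\<^esub> h) (\<lambda>t1 t2. t1 \<cdot>\<^bsub>B\<^esub> SB t2) =
        sweedler A a (\<lambda>a1 a2. sweedler K h (\<lambda>h1 h2. (a1 \<otimes>\<^bsub>A,K\<^esub> h1) \<cdot>\<^bsub>B\<^esub> SB (a2 \<otimes>\<^bsub>A,K\<^esub> h2)))"
      by (rule sweedler_B[where W = T]) (rule lin a | assumption)+
    also have "\<dots> = sweedler A a (\<lambda>a1 a2. (a1 \<cdot>\<^bsub>A\<^esub> S a2) \<otimes>\<^bsub>A,K\<^esub> vscale K (hcounit K h) (hone K))"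
      by (intro sweedler_cong)
        (simp add: SBt mult_B_tens S_in sK bK bialgebraD(8)[OF bialg_A] z_in aK h4_defect_antipode tens_simps)
    also have "\<dots> = vscale A (hcounit A a) (hone A) \<otimes>\<^bsub>A,K\<^esub> vscale K (hcounit K h) (hone K)"
      using sweedler_push[OF co_A k_A kspace_tensor_space a bA(2) tA] Sr[OF a] by simp
    finally show "sweedler B (a \<otimes>\<^bsub>A,K\<^esub> h) (\<lambda>t1 t2. t1 \<cdot>\<^bsub>B\<^esub> SB t2) =
        vscale T (hcounit B (a \<otimes>\<^bsub>A,K\<^esub> h)) (hone B)"
      by (simp add: eps counit_B_tens a)
  qed
  have "is_antipode B SB"
    unfolding is_antipode_def cong_B sel_B(1,2) using linSB left right by blast
  with bialgebra_B show ?thesis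
    by (auto simp: hopf_algebra_def)
qed

end


section \<open>Every crossed system comes from a central primitive element\<close>

locale crossed_system_H4 = crossed_product_H4 A act f
  for A :: "('k::field, 'a::ab_group_add, 'm) hopf_scheme" and act and f +
  assumes weak: "weak_action A K act"
    and bialg_B: "bialgebra (crossed_product A K act f)"
begin

abbreviation "e \<equiv> h4_vec :: h4_basis \<Rightarrow> 'k h4"

lemma act_unit: "act h (hone A) = vscale A (hcounit K h) (hone A)"
  and act_one: "a \<in> vcarrier A \<Longrightarrow> act (e B1) a = a"
  using weak by (auto simp: weak_action_def H4_simps)

lemmas mult_simps = kbilinear_simps[OF mult_A k_A k_A]
lemmas one_simps = bialgebraD(11,12)[OF bialg_A]

lemmas A_in = kspace_closed[OF k_A] bialgebraD(5,8)[OF bialg_A] act_in f_in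

text \<open>
  With respect to the basis \<open>e\<close> of \<open>H\<^sub>4\<close>, \<open>coord i\<close> is the \<open>i\<close>-th coordinate on \<open>A \<otimes> H\<^sub>4\<close> with values in
  \<open>A\<close>, \<open>to_A\<close> is \<open>id \<otimes> \<epsilon>\<close>, and \<open>to_H4 i\<close> is the \<open>i\<close>-th coordinate of \<open>\<epsilon> \<otimes> id\<close>.
\<close>

definition "coord i = tensor_lift A K (\<lambda>a h. vscale A (h i) a)"
definition "to_A = tensor_lift A K (\<lambda>a h. vscale A (hcounit K h) a)"
definition "to_H4 i = tensor_lift A K (\<lambda>a h. hcounit A a * h i)"

lemma klinear_K_coord: "klinear X K u \<Longrightarrow> klinear X base_field (\<lambda>x. u x i)"
  by (rule klinear_comp[OF klinear_H4_coord])

lemma bil_projections: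
  "kbilinear A K A (\<lambda>a h. vscale A (h i) a)"
  "kbilinear A K A (\<lambda>a h. vscale A (hcounit K h) a)"
  "kbilinear A K base_field (\<lambda>a h. hcounit A a * h i)"
  by (rule lin_B klinear_K_coord | assumption)+

lemma klinear_coord: "klinear T A (coord i)"
  and klinear_to_A: "klinear T A to_A"
  and klinear_to_H4: "klinear T base_field (to_H4 i)"
  unfolding coord_def to_A_def to_H4_def
  by (intro tensor_lift_universal(1) k_A kspace_H4 kspace_base_field bil_projections)+

lemma projections_tens:
  assumes "a \<in> vcarrier A"
  shows "coord i (a \<otimes>\<^bsub>A,K\<^esub> h) = vscale A (h i) a"
    and "to_A (a \<otimes>\<^bsub>A,K\<^esub> h) = vscale A (hcounit K h) a"
    and "to_H4 i (a \<otimes>\<^bsub>A,K\<^esub> h) = hcounit A a * h i"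
  unfolding coord_def to_A_def to_H4_def
  by (rule tensor_lift_tens; rule k_A kspace_H4 kspace_base_field bil_projections assms H4_in)+

lemma pure_in: "a \<in> vcarrier A \<Longrightarrow> a \<otimes>\<^bsub>A,K\<^esub> h \<in> vcarrier T"
  by (rule tens_closed[OF _ H4_in])

lemmas T_in = pure_in kspace_closed[OF kspace_tensor_space[of A K]]

lemmas linear_simps =
  klinear_add[OF klinear_coord] klinear_simps(1,2)[OF klinear_coord kspace_tensor_space]
  klinear_add[OF klinear_to_A] klinear_simps(1,2)[OF klinear_to_A kspace_tensor_space]
  klinear_add[OF klinear_to_H4] klinear_simps(1,2)[OF klinear_to_H4 kspace_tensor_space]
  klinear_add[OF klinear_counit_B] klinear_simps(1,2)[OF klinear_counit_B kspace_tensor_space]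

lemmas eval = linear_simps projections_tens counit_B_tens T_in A_in h4_vec_apply hcounit_H4_basis
  kspace_scale[OF k_A] tens_simps mult_simps one_simps H4_in

text \<open>
  Coordinates of the equation \<open>(1 # 1) (1 # e\<^sub>j) = 1 # e\<^sub>j\<close>.
\<close>

lemma f_one_left: "f (e B1) (e j) = vscale A (hcounit K (e j)) (hone A)"
proof -
  have unit: "(hone A \<otimes>\<^bsub>A,K\<^esub> e B1) \<cdot>\<^bsub>B\<^esub> (hone A \<otimes>\<^bsub>A,K\<^esub> e j) = hone A \<otimes>\<^bsub>A,K\<^esub> e j" for j
    using bialgebraD(11)[OF bialg_B, of "hone A \<otimes>\<^bsub>A,K\<^esub> e j"]
    by (simp add: hone_crossed_product sel_B pure_in one_A H4_simps)
  have c: "coord i ((hone A \<otimes>\<^bsub>A,K\<^esub> e B1) \<cdot>\<^bsub>B\<^esub> (hone A \<otimes>\<^bsub>A,K\<^esub> e j)) = coord i (hone A \<otimes>\<^bsub>A,K\<^esub> e j)" for i j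
    by (simp only: unit)
  note c = c[unfolded mult_B_basis[OF one_A one_A]]
  show ?thesis
    using c[of B1 B1] c[of Bg Bg] c[of B1 Bx] c[of Bg Bgx]
    by (cases j) (simp_all add: eval act_one)
qed

lemma f_one_right: "f (e i) (e B1) = vscale A (hcounit K (e i)) (hone A)"
proof -
  have unit: "(hone A \<otimes>\<^bsub>A,K\<^esub> e j) \<cdot>\<^bsub>B\<^esub> (hone A \<otimes>\<^bsub>A,K\<^esub> e B1) = hone A \<otimes>\<^bsub>A,K\<^esub> e j" for j
    using bialgebraD(12)[OF bialg_B, of "hone A \<otimes>\<^bsub>A,K\<^esub> e j"]
    by (simp add: hone_crossed_product sel_B pure_in one_A H4_simps)
  have c: "coord i ((hone A \<otimes>\<^bsub>A,K\<^esub> e j) \<cdot>\<^bsub>B\<^esub> (hone A \<otimes>\<^bsub>A,K\<^esub> e B1)) = coord i (hone A \<otimes>\<^bsub>A,K\<^esub> e j)" for i j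
    by (simp only: unit)
  note c = c[unfolded mult_B_basis[OF one_A one_A]]
  show ?thesis
    using c[of B1 B1] c[of Bg Bg] c[of B1 Bx] c[of Bg Bgx]
    by (cases i) (simp_all add: eval act_unit)
qed

lemma f_one:
  "f (e B1) (e B1) = hone A" "f (e B1) (e Bg) = hone A" "f (e B1) (e Bx) = 0" "f (e B1) (e Bgx) = 0"
  "f (e Bg) (e B1) = hone A" "f (e Bx) (e B1) = 0" "f (e Bgx) (e B1) = 0"
  by (simp_all add: f_one_left f_one_right hcounit_H4_basis kspace_scale[OF k_A])

lemma mult_act:
  assumes "c \<in> vcarrier A"
  shows "(hone A \<otimes>\<^bsub>A,K\<^esub> e B1) \<cdot>\<^bsub>B\<^esub> (c \<otimes>\<^bsub>A,K\<^esub> e B1) = c \<otimes>\<^bsub>A,K\<^esub> e B1"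
    and "(hone A \<otimes>\<^bsub>A,K\<^esub> e Bg) \<cdot>\<^bsub>B\<^esub> (c \<otimes>\<^bsub>A,K\<^esub> e B1) = act (e Bg) c \<otimes>\<^bsub>A,K\<^esub> e Bg"
    and "(hone A \<otimes>\<^bsub>A,K\<^esub> e Bx) \<cdot>\<^bsub>B\<^esub> (c \<otimes>\<^bsub>A,K\<^esub> e B1) = act (e Bx) c \<otimes>\<^bsub>A,K\<^esub> e B1 + act (e Bg) c \<otimes>\<^bsub>A,K\<^esub> e Bx"
    and "(hone A \<otimes>\<^bsub>A,K\<^esub> e Bgx) \<cdot>\<^bsub>B\<^esub> (c \<otimes>\<^bsub>A,K\<^esub> e B1) = act (e Bgx) c \<otimes>\<^bsub>A,K\<^esub> e Bg + c \<otimes>\<^bsub>A,K\<^esub> e Bgx"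
  unfolding mult_B_basis[OF one_A assms]
  by (simp_all add: eval assms f_one act_one)

lemma counit_mult:
  "s \<in> vcarrier T \<Longrightarrow> t \<in> vcarrier T \<Longrightarrow> hcounit B (s \<cdot>\<^bsub>B\<^esub> t) = hcounit B s * hcounit B t"
  using bialgebraD(9)[OF bialg_B] by (simp add: sel_B)

text \<open>
  The counit of \<open>B\<close> is multiplicative and is applied to the products in \<open>mult_act\<close>.
\<close>

lemma counit_act:
  assumes c: "c \<in> vcarrier A"
  shows "hcounit A (act (e Bg) c) = hcounit A c" "hcounit A (act (e Bx) c) = 0"
    "hcounit A (act (e Bgx) c) = 0"
proof -
  have "hcounit B ((hone A \<otimes>\<^bsub>A,K\<^esub> e i) \<cdot>\<^bsub>B\<^esub> (c \<otimes>\<^bsub>A,K\<^esub> e B1)) =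
      hcounit B (hone A \<otimes>\<^bsub>A,K\<^esub> e i) * hcounit B (c \<otimes>\<^bsub>A,K\<^esub> e B1)" for i
    by (intro counit_mult pure_in one_A c)
  from this[of Bg] this[of Bx] this[of Bgx]
  show "hcounit A (act (e Bg) c) = hcounit A c" "hcounit A (act (e Bx) c) = 0"
    "hcounit A (act (e Bgx) c) = 0"
    by (simp_all add: mult_act c eval bialgebraD(7)[OF bialg_A])
qed

lemma sweedler_B_basis:
  assumes W: "kspace W" and F: "kbilinear T T W F"
  shows "sweedler B (hone A \<otimes>\<^bsub>A,K\<^esub> e i) F =
    (\<Sum>(p, q)\<leftarrow>h4_copairs i. F (hone A \<otimes>\<^bsub>A,K\<^esub> e p) (hone A \<otimes>\<^bsub>A,K\<^esub> e q))"
proof -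
  note lin = lin_B W klinear_bilinear_left[OF F] klinear_bilinear_right[OF F]
  have b1: "kbilinear A A W (\<lambda>a1 a2. sweedler K (e i) (\<lambda>h1 h2. F (a1 \<otimes>\<^bsub>A,K\<^esub> h1) (a2 \<otimes>\<^bsub>A,K\<^esub> h2)))"
    by (rule lin | assumption)+
  have b2: "kbilinear K K W (\<lambda>h1 h2. F (hone A \<otimes>\<^bsub>A,K\<^esub> h1) (hone A \<otimes>\<^bsub>A,K\<^esub> h2))"
    by (rule lin | assumption)+
  show ?thesis
    unfolding sweedler_B[OF W one_A F] sweedler_one_A[OF W b1] sweedler_H4_basis[OF W b2] ..
qed

lemma sweedler_B_A:
  assumes W: "kspace W" and F: "kbilinear T T W F" and c: "c \<in> vcarrier A"
  shows "sweedler B (c \<otimes>\<^bsub>A,K\<^esub> e B1) F =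
    sweedler A c (\<lambda>c1 c2. F (c1 \<otimes>\<^bsub>A,K\<^esub> e B1) (c2 \<otimes>\<^bsub>A,K\<^esub> e B1))"
proof -
  note lin = lin_B W klinear_bilinear_left[OF F] klinear_bilinear_right[OF F]
  have b2: "kbilinear K K W (\<lambda>h1 h2. F (p \<otimes>\<^bsub>A,K\<^esub> h1) (q \<otimes>\<^bsub>A,K\<^esub> h2))"
    if "p \<in> vcarrier A" "q \<in> vcarrier A" for p q
    by (rule lin that | assumption)+
  show ?thesis
    unfolding sweedler_B[OF W c F]
    by (rule sweedler_cong) (simp add: sweedler_H4_basis[OF W b2])
qed

lemma sweedler_B_mult:
  assumes "kspace W" "kbilinear T T W F" "s \<in> vcarrier T" "t \<in> vcarrier T"
  shows "sweedler B (s \<cdot>\<^bsub>B\<^esub> t) F =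
    sweedler B s (\<lambda>s1 s2. sweedler B t (\<lambda>t1 t2. F (s1 \<cdot>\<^bsub>B\<^esub> t1) (s2 \<cdot>\<^bsub>B\<^esub> t2)))"
  by (rule sweedler_mult[OF bialg_B assms(1)]) (simp_all add: cong_B sel_B assms)

text \<open>
  The \<open>H\<^sub>4\<close>-component is taken from the first leg in \<open>HA\<close> and from the second leg in \<open>AH\<close>.
\<close>

abbreviation "HA i \<equiv> \<lambda>s t. vscale A (to_H4 i s) (to_A t)"
abbreviation "AH i \<equiv> \<lambda>s t. vscale A (to_H4 i t) (to_A s)"

lemmas lin_P = lin_B klinear_comp[OF klinear_to_A] klinear_comp[OF klinear_to_H4]
  klinear_in[OF klinear_to_A]

text \<open>
  The coalgebra \<open>A \<otimes> H\<^sub>4\<close> does not see the order of its two factors: by the counit axioms of \<open>A\<close> and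
  \<open>H\<^sub>4\<close>, both ways to project the two legs give back the coordinate of \<open>t\<close>.
\<close>

lemma coord_sweedler:
  assumes t: "t \<in> vcarrier T"
  shows "sweedler B t (HA i) = coord i t" "sweedler B t (AH i) = coord i t"
proof -
  have bil: "kbilinear T T A (HA i)" "kbilinear T T A (AH i)"
    by (rule lin_P | assumption)+
  have lin: "klinear T A (\<lambda>t. sweedler B t (HA i))" "klinear T A (\<lambda>t. sweedler B t (AH i))"
    by (rule lin_P | assumption)+
  have pure: "sweedler B (a \<otimes>\<^bsub>A,K\<^esub> h) (HA i) = coord i (a \<otimes>\<^bsub>A,K\<^esub> h)"
    "sweedler B (a \<otimes>\<^bsub>A,K\<^esub> h) (AH i) = coord i (a \<otimes>\<^bsub>A,K\<^esub> h)" if a: "a \<in> vcarrier A" for a h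
  proof -
    have s: "sweedler K h (\<lambda>h1 h2. vscale A (hcounit K h2) (vscale A (h1 i) b)) = vscale A (h i) b"
      "sweedler K h (\<lambda>h1 h2. vscale A (hcounit K h1) (vscale A (h2 i) b)) = vscale A (h i) b"
      if b: "b \<in> vcarrier A" for b
      by ((rule sweedler_counit[OF coalgebra_H4 k_A H4_in, where L = "\<lambda>h. vscale A (h i) b"],
          (rule lin_B klinear_K_coord b | assumption)+))+
    have sA: "sweedler A a (\<lambda>a1 a2. vscale A (hcounit A a1) (vscale A (h i) a2)) = vscale A (h i) a"
      "sweedler A a (\<lambda>a1 a2. vscale A (hcounit A a2) (vscale A (h i) a1)) = vscale A (h i) a"
      by (rule sweedler_counit[OF co_A k_A a, where L = "\<lambda>a. vscale A (h i) a"],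
          (rule lin_B | assumption)+)+
    have "sweedler B (a \<otimes>\<^bsub>A,K\<^esub> h) (HA i) = sweedler A a (\<lambda>a1 a2. sweedler K h (\<lambda>h1 h2.
        vscale A (hcounit K h2) (vscale A (h1 i) (vscale A (hcounit A a1) a2))))"
      unfolding sweedler_B[OF k_A a bil(1)]
      by (intro sweedler_cong) (simp add: eval ac_simps)
    also have "\<dots> = sweedler A a (\<lambda>a1 a2. vscale A (h i) (vscale A (hcounit A a1) a2))"
      by (intro sweedler_cong s A_in)
    also have "\<dots> = coord i (a \<otimes>\<^bsub>A,K\<^esub> h)"
      using sA(1) by (simp add: eval a mult.commute)
    finally show "sweedler B (a \<otimes>\<^bsub>A,K\<^esub> h) (HA i) = coord i (a \<otimes>\<^bsub>A,K\<^esub> h)" .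
    have "sweedler B (a \<otimes>\<^bsub>A,K\<^esub> h) (AH i) = sweedler A a (\<lambda>a1 a2. sweedler K h (\<lambda>h1 h2.
        vscale A (hcounit K h1) (vscale A (h2 i) (vscale A (hcounit A a2) a1))))"
      unfolding sweedler_B[OF k_A a bil(2)]
      by (intro sweedler_cong) (simp add: eval ac_simps)
    also have "\<dots> = sweedler A a (\<lambda>a1 a2. vscale A (h i) (vscale A (hcounit A a2) a1))"
      by (intro sweedler_cong s A_in)
    also have "\<dots> = coord i (a \<otimes>\<^bsub>A,K\<^esub> h)"
      using sA(2) by (simp add: eval a mult.commute)
    finally show "sweedler B (a \<otimes>\<^bsub>A,K\<^esub> h) (AH i) = coord i (a \<otimes>\<^bsub>A,K\<^esub> h)" .
  qed
  show "sweedler B t (HA i) = coord i t"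
    by (rule klinear_tensor_eqI[OF k_A kspace_H4 k_A lin(1) klinear_coord pure(1) t])
  show "sweedler B t (AH i) = coord i t"
    by (rule klinear_tensor_eqI[OF k_A kspace_H4 k_A lin(2) klinear_coord pure(2) t])
qed

text \<open>
  The key restriction: \<open>coord_sweedler\<close> for a product \<open>s t\<close>, whose comultiplication is computed
  from those of \<open>s\<close> and \<open>t\<close>. In the two lemmas that use it, it becomes a linear relation between
  values of the action or of the cocycle.
\<close>

lemma cocentral:
  assumes "s \<in> vcarrier T" "t \<in> vcarrier T"
  shows "sweedler B s (\<lambda>s1 s2. sweedler B t (\<lambda>t1 t2. HA i (s1 \<cdot>\<^bsub>B\<^esub> t1) (s2 \<cdot>\<^bsub>B\<^esub> t2))) =
    sweedler B s (\<lambda>s1 s2. sweedler B t (\<lambda>t1 t2. AH i (s1 \<cdot>\<^bsub>B\<^esub> t1) (s2 \<cdot>\<^bsub>B\<^esub> t2)))"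
proof -
  have bil: "kbilinear T T A (HA i)" "kbilinear T T A (AH i)"
    by (rule lin_P | assumption)+
  show ?thesis
    unfolding sweedler_B_mult[OF k_A bil(1) assms, symmetric]
      sweedler_B_mult[OF k_A bil(2) assms, symmetric]
      coord_sweedler[OF kbilinearD(1)[OF mult_B assms]] ..
qed

lemma cocentral_act:
  assumes c: "c \<in> vcarrier A"
  shows "sweedler A c (\<lambda>c1 c2. \<Sum>(p, q)\<leftarrow>h4_copairs j.
      HA i ((hone A \<otimes>\<^bsub>A,K\<^esub> e p) \<cdot>\<^bsub>B\<^esub> (c1 \<otimes>\<^bsub>A,K\<^esub> e B1)) ((hone A \<otimes>\<^bsub>A,K\<^esub> e q) \<cdot>\<^bsub>B\<^esub> (c2 \<otimes>\<^bsub>A,K\<^esub> e B1))) =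
    sweedler A c (\<lambda>c1 c2. \<Sum>(p, q)\<leftarrow>h4_copairs j.
      AH i ((hone A \<otimes>\<^bsub>A,K\<^esub> e p) \<cdot>\<^bsub>B\<^esub> (c1 \<otimes>\<^bsub>A,K\<^esub> e B1)) ((hone A \<otimes>\<^bsub>A,K\<^esub> e q) \<cdot>\<^bsub>B\<^esub> (c2 \<otimes>\<^bsub>A,K\<^esub> e B1)))"
proof -
  have sum: "sweedler A c (\<lambda>c1 c2. \<Sum>(p, q)\<leftarrow>h4_copairs j. F p q c1 c2) =
      (\<Sum>(p, q)\<leftarrow>h4_copairs j. sweedler A c (F p q))" if "\<And>p q. kbilinear A A A (F p q)" for F
    by (cases j) (simp_all add: sweedler_plus[OF co_A k_A c that that])
  have main: "sweedler B (hone A \<otimes>\<^bsub>A,K\<^esub> e j) (\<lambda>s1 s2. sweedler B (c \<otimes>\<^bsub>A,K\<^esub> e B1) (\<lambda>t1 t2.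
        F (s1 \<cdot>\<^bsub>B\<^esub> t1) (s2 \<cdot>\<^bsub>B\<^esub> t2))) =
      sweedler A c (\<lambda>c1 c2. \<Sum>(p, q)\<leftarrow>h4_copairs j.
        F ((hone A \<otimes>\<^bsub>A,K\<^esub> e p) \<cdot>\<^bsub>B\<^esub> (c1 \<otimes>\<^bsub>A,K\<^esub> e B1)) ((hone A \<otimes>\<^bsub>A,K\<^esub> e q) \<cdot>\<^bsub>B\<^esub> (c2 \<otimes>\<^bsub>A,K\<^esub> e B1)))"
    if F: "kbilinear T T A F" for F
  proof -
    note lin = lin_P c klinear_bilinear_left[OF F] klinear_bilinear_right[OF F]
    have b1: "kbilinear T T A (\<lambda>s1 s2. sweedler B (c \<otimes>\<^bsub>A,K\<^esub> e B1) (\<lambda>t1 t2. F (s1 \<cdot>\<^bsub>B\<^esub> t1) (s2 \<cdot>\<^bsub>B\<^esub> t2)))"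
      by (rule lin | assumption)+
    have b2: "kbilinear T T A (\<lambda>t1 t2. F (s1 \<cdot>\<^bsub>B\<^esub> t1) (s2 \<cdot>\<^bsub>B\<^esub> t2))"
      if "s1 \<in> vcarrier T" "s2 \<in> vcarrier T" for s1 s2
      by (rule lin that | assumption)+
    have b3: "kbilinear A A A (\<lambda>c1 c2.
        F ((hone A \<otimes>\<^bsub>A,K\<^esub> e p) \<cdot>\<^bsub>B\<^esub> (c1 \<otimes>\<^bsub>A,K\<^esub> e B1)) ((hone A \<otimes>\<^bsub>A,K\<^esub> e q) \<cdot>\<^bsub>B\<^esub> (c2 \<otimes>\<^bsub>A,K\<^esub> e B1)))" for p q
      by (rule lin | assumption)+
    show ?thesis
      unfolding sweedler_B_basis[OF k_A b1] sum[OF b3]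
        sweedler_B_A[OF k_A b2[OF pure_in[OF one_A] pure_in[OF one_A]] c] ..
  qed
  have bil: "kbilinear T T A (HA i)" "kbilinear T T A (AH i)"
    by (rule lin_P | assumption)+
  show ?thesis
    using cocentral[OF pure_in[OF one_A, of "e j"] pure_in[OF c, of "e B1"], of i]
    unfolding main[OF bil(1)] main[OF bil(2)] .
qed

text \<open>
  Cocentrality for \<open>x\<close>, which has comultiplication \<open>x \<otimes> 1 + g \<otimes> x\<close>: the coordinate at \<open>1\<close> gives
  \<open>x \<triangleright> c = 0\<close>, and the coordinate at \<open>x\<close> gives \<open>g \<triangleright> c = c\<close>. In the same way \<open>g x\<close> gives
  \<open>gx \<triangleright> c = 0\<close> at the coordinate \<open>1\<close>.
\<close>

lemma act_basis:
  assumes c: "c \<in> vcarrier A"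
  shows "act (e i) c = vscale A (hcounit K (e i)) c"
proof -
  note ev = mult_act eval counit_act
  have z: "sweedler A c (\<lambda>p q. 0 :: 'a) = 0"
    using sweedler_counit(1)[OF co_A k_A c klinear_zero[OF k_A]] by (simp add: kspace_scale[OF k_A])
  have left: "sweedler A c (\<lambda>c1 c2. vscale A (hcounit A c1) (L c2)) = L c"
    and right: "sweedler A c (\<lambda>c1 c2. vscale A (hcounit A c2) (L c1)) = L c"
    if "klinear A A L" for L
    using sweedler_counit[OF co_A k_A c that] by auto
  have la: "klinear A A (\<lambda>c. act h c)" for h
    by (rule lin_B | assumption)+
  have "sweedler A c (\<lambda>c1 c2. 0 :: 'a) = sweedler A c (\<lambda>c1 c2. vscale A (hcounit A c2) (act (e Bx) c1))"
    using cocentral_act[OF c, of B1 Bx] by (simp add: ev cong: sweedler_cong)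
  then have x: "act (e Bx) c = 0"
    by (simp add: z right[OF la])
  have "sweedler A c (\<lambda>c1 c2. vscale A (hcounit A c1) c2) =
      sweedler A c (\<lambda>c1 c2. vscale A (hcounit A c2) (act (e Bg) c1))"
    using cocentral_act[OF c, of Bx Bx] by (simp add: ev cong: sweedler_cong)
  then have g: "act (e Bg) c = c"
    by (simp add: left[OF klinear_id] right[OF la])
  have "sweedler A c (\<lambda>c1 c2. vscale A (hcounit A c1) (act (e Bgx) c2)) = sweedler A c (\<lambda>c1 c2. 0)"
    using cocentral_act[OF c, of B1 Bgx] by (simp add: ev cong: sweedler_cong)
  then have gx: "act (e Bgx) c = 0"
    by (simp add: z left[OF la])
  show ?thesis
    by (cases i) (simp_all add: x g gx act_one c hcounit_H4_basis kspace_scale[OF k_A])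
qed

lemma act_trivial:
  assumes c: "c \<in> vcarrier A"
  shows "act h c = vscale A (hcounit K h) c"
  by (rule klinear_H4_eqI[of A "\<lambda>h. act h c" "\<lambda>h. vscale A (hcounit K h) c", OF _ _ act_basis[OF c]])
    (rule lin_B c | assumption)+

end


context crossed_system_H4
begin

section \<open>The cocycle of a crossed system\<close>

abbreviation "E i \<equiv> hone A \<otimes>\<^bsub>A,K\<^esub> e i"

lemmas act_simps = act_basis[unfolded hcounit_H4_basis]

lemma mult_E:
  "E Bg \<cdot>\<^bsub>B\<^esub> E Bg = f (e Bg) (e Bg) \<otimes>\<^bsub>A,K\<^esub> e B1"
  "E Bx \<cdot>\<^bsub>B\<^esub> E Bg = f (e Bx) (e Bg) \<otimes>\<^bsub>A,K\<^esub> e Bg - f (e Bg) (e Bg) \<otimes>\<^bsub>A,K\<^esub> e Bgx"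
  "E Bgx \<cdot>\<^bsub>B\<^esub> E Bg = f (e Bgx) (e Bg) \<otimes>\<^bsub>A,K\<^esub> e B1 - E Bx"
  "E Bg \<cdot>\<^bsub>B\<^esub> E Bx = f (e Bg) (e Bx) \<otimes>\<^bsub>A,K\<^esub> e Bg + f (e Bg) (e Bg) \<otimes>\<^bsub>A,K\<^esub> e Bgx"
  "E Bg \<cdot>\<^bsub>B\<^esub> E Bgx = f (e Bg) (e Bgx) \<otimes>\<^bsub>A,K\<^esub> e B1 + E Bx"
  "E B1 \<cdot>\<^bsub>B\<^esub> E i = E i" "E i \<cdot>\<^bsub>B\<^esub> E B1 = E i"
proof -
  show "E Bg \<cdot>\<^bsub>B\<^esub> E Bg = f (e Bg) (e Bg) \<otimes>\<^bsub>A,K\<^esub> e B1"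
    "E Bx \<cdot>\<^bsub>B\<^esub> E Bg = f (e Bx) (e Bg) \<otimes>\<^bsub>A,K\<^esub> e Bg - f (e Bg) (e Bg) \<otimes>\<^bsub>A,K\<^esub> e Bgx"
    "E Bgx \<cdot>\<^bsub>B\<^esub> E Bg = f (e Bgx) (e Bg) \<otimes>\<^bsub>A,K\<^esub> e B1 - E Bx"
    "E Bg \<cdot>\<^bsub>B\<^esub> E Bx = f (e Bg) (e Bx) \<otimes>\<^bsub>A,K\<^esub> e Bg + f (e Bg) (e Bg) \<otimes>\<^bsub>A,K\<^esub> e Bgx"
    "E Bg \<cdot>\<^bsub>B\<^esub> E Bgx = f (e Bg) (e Bgx) \<otimes>\<^bsub>A,K\<^esub> e B1 + E Bx"
    unfolding mult_B_basis[OF one_A one_A]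
    by (simp_all add: eval f_one act_simps)
  show "E B1 \<cdot>\<^bsub>B\<^esub> E i = E i" "E i \<cdot>\<^bsub>B\<^esub> E B1 = E i"
    using bialgebraD(11,12)[OF bialg_B, of "E i"]
    by (simp_all add: hone_crossed_product sel_B pure_in one_A H4_simps)
qed

lemma sweedler_E_mult:
  assumes W: "kspace W" and F: "kbilinear T T W F"
  shows "sweedler B (E i) (\<lambda>s1 s2. sweedler B (E j) (\<lambda>t1 t2. F (s1 \<cdot>\<^bsub>B\<^esub> t1) (s2 \<cdot>\<^bsub>B\<^esub> t2))) =
    (\<Sum>(p, q)\<leftarrow>h4_copairs i. \<Sum>(r, s)\<leftarrow>h4_copairs j. F (E p \<cdot>\<^bsub>B\<^esub> E r) (E q \<cdot>\<^bsub>B\<^esub> E s))"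
proof -
  note lin = lin_P W klinear_bilinear_left[OF F] klinear_bilinear_right[OF F]
  have b1: "kbilinear T T W (\<lambda>s1 s2. sweedler B (E j) (\<lambda>t1 t2. F (s1 \<cdot>\<^bsub>B\<^esub> t1) (s2 \<cdot>\<^bsub>B\<^esub> t2)))"
    by (rule lin | assumption)+
  have b2: "kbilinear T T W (\<lambda>t1 t2. F (E p \<cdot>\<^bsub>B\<^esub> t1) (E q \<cdot>\<^bsub>B\<^esub> t2))" for p q
    by (rule lin | assumption)+
  show ?thesis
    unfolding sweedler_B_basis[OF W b1] sweedler_B_basis[OF W b2] ..
qed

lemma cocentral_E:
  "(\<Sum>(p, q)\<leftarrow>h4_copairs i. \<Sum>(r, s)\<leftarrow>h4_copairs j. HA k (E p \<cdot>\<^bsub>B\<^esub> E r) (E q \<cdot>\<^bsub>B\<^esub> E s)) =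
    (\<Sum>(p, q)\<leftarrow>h4_copairs i. \<Sum>(r, s)\<leftarrow>h4_copairs j. AH k (E p \<cdot>\<^bsub>B\<^esub> E r) (E q \<cdot>\<^bsub>B\<^esub> E s))"
proof -
  have bil: "kbilinear T T A (HA k)" "kbilinear T T A (AH k)"
    by (rule lin_P | assumption)+
  show ?thesis
    using cocentral[OF pure_in[OF one_A, of "e i"] pure_in[OF one_A, of "e j"], of k]
    unfolding sweedler_E_mult[OF k_A bil(1)] sweedler_E_mult[OF k_A bil(2)] .
qed

lemmas counit_one = bialgebraD(7)[OF bialg_A]

lemma linear_diff:
  assumes "s \<in> vcarrier T" "t \<in> vcarrier T"
  shows "coord i (s - t) = coord i s - coord i t" "to_A (s - t) = to_A s - to_A t"
    "to_H4 i (s - t) = to_H4 i s - to_H4 i t" "hcounit B (s - t) = hcounit B s - hcounit B t"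
    "s - t \<in> vcarrier T"
  using assms unfolding diff_conv_add_uminus
  by (simp_all add: linear_simps T_in del: add_uminus_conv_diff)

lemma counit_f:
  "hcounit A (f (e Bg) (e Bg)) = 1" "hcounit A (f (e Bx) (e Bg)) = 0"
  "hcounit A (f (e Bgx) (e Bg)) = 0" "hcounit A (f (e Bg) (e Bx)) = 0"
  "hcounit A (f (e Bg) (e Bgx)) = 0"
proof -
  have c: "hcounit B (E i \<cdot>\<^bsub>B\<^esub> E j) = hcounit B (E i) * hcounit B (E j)" for i j
    by (intro counit_mult pure_in one_A)
  show "hcounit A (f (e Bg) (e Bg)) = 1" "hcounit A (f (e Bx) (e Bg)) = 0"
    "hcounit A (f (e Bgx) (e Bg)) = 0" "hcounit A (f (e Bg) (e Bx)) = 0"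
    "hcounit A (f (e Bg) (e Bgx)) = 0"
    using c[of Bg Bg] c[of Bx Bg] c[of Bgx Bg] c[of Bg Bx] c[of Bg Bgx]
    by (simp_all add: mult_E linear_diff eval counit_one)
qed

text \<open>
  Each value is read off from one coordinate of the cocentrality condition for a product of \<open>g\<close> with
  \<open>x\<close> or \<open>g x\<close>.
\<close>

lemma f_g:
  "f (e Bg) (e Bg) = hone A" "f (e Bx) (e Bg) = 0" "f (e Bgx) (e Bg) = 0"
  "f (e Bg) (e Bx) = 0" "f (e Bg) (e Bgx) = 0"
proof -
  note ev = mult_E linear_diff eval counit_one counit_f
  \<comment> \<open>The coordinate \<open>k\<close> is one at which the two sides differ in the wanted value.\<close>
  show "f (e Bx) (e Bg) = 0"
    using cocentral_E[where k = B1 and i = Bx and j = Bg] by (simp add: ev)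
  show "f (e Bg) (e Bg) = hone A"
    using cocentral_E[where k = Bgx and i = Bx and j = Bg] by (simp add: ev)
  show "f (e Bgx) (e Bg) = 0"
    using cocentral_E[where k = Bg and i = Bgx and j = Bg] by (simp add: ev)
  show "f (e Bg) (e Bx) = 0"
    using cocentral_E[where k = B1 and i = Bg and j = Bx] by (simp add: ev)
  show "f (e Bg) (e Bgx) = 0"
    using cocentral_E[where k = Bg and i = Bg and j = Bgx] by (simp add: ev)
qed

text \<open>
  With \<open>X = 1 # x\<close>, the square of \<open>X\<close> is \<open>z # 1\<close>.
\<close>

abbreviation "z \<equiv> f (e Bx) (e Bx)"

lemma mult_pure:
  assumes "a \<in> vcarrier A" "c \<in> vcarrier A"
  shows "(a \<otimes>\<^bsub>A,K\<^esub> e B1) \<cdot>\<^bsub>B\<^esub> (c \<otimes>\<^bsub>A,K\<^esub> e i) = (a \<cdot>\<^bsub>A\<^esub> c) \<otimes>\<^bsub>A,K\<^esub> e i"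
    "(a \<otimes>\<^bsub>A,K\<^esub> e i) \<cdot>\<^bsub>B\<^esub> (c \<otimes>\<^bsub>A,K\<^esub> e B1) = (a \<cdot>\<^bsub>A\<^esub> c) \<otimes>\<^bsub>A,K\<^esub> e i"
    "(a \<otimes>\<^bsub>A,K\<^esub> e Bg) \<cdot>\<^bsub>B\<^esub> (c \<otimes>\<^bsub>A,K\<^esub> e Bg) = (a \<cdot>\<^bsub>A\<^esub> c) \<otimes>\<^bsub>A,K\<^esub> e B1"
    "(a \<otimes>\<^bsub>A,K\<^esub> e Bx) \<cdot>\<^bsub>B\<^esub> (c \<otimes>\<^bsub>A,K\<^esub> e Bg) = - ((a \<cdot>\<^bsub>A\<^esub> c) \<otimes>\<^bsub>A,K\<^esub> e Bgx)"
    "(a \<otimes>\<^bsub>A,K\<^esub> e Bg) \<cdot>\<^bsub>B\<^esub> (c \<otimes>\<^bsub>A,K\<^esub> e Bx) = (a \<cdot>\<^bsub>A\<^esub> c) \<otimes>\<^bsub>A,K\<^esub> e Bgx"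
    "(a \<otimes>\<^bsub>A,K\<^esub> e Bx) \<cdot>\<^bsub>B\<^esub> (c \<otimes>\<^bsub>A,K\<^esub> e Bx) = (a \<cdot>\<^bsub>A\<^esub> c \<cdot>\<^bsub>A\<^esub> z) \<otimes>\<^bsub>A,K\<^esub> e B1"
    "(a \<otimes>\<^bsub>A,K\<^esub> e Bx) \<cdot>\<^bsub>B\<^esub> (c \<otimes>\<^bsub>A,K\<^esub> e Bgx) = (a \<cdot>\<^bsub>A\<^esub> c \<cdot>\<^bsub>A\<^esub> f (e Bx) (e Bgx)) \<otimes>\<^bsub>A,K\<^esub> e Bg"
    "(a \<otimes>\<^bsub>A,K\<^esub> e Bgx) \<cdot>\<^bsub>B\<^esub> (c \<otimes>\<^bsub>A,K\<^esub> e Bx) = (a \<cdot>\<^bsub>A\<^esub> c \<cdot>\<^bsub>A\<^esub> f (e Bgx) (e Bx)) \<otimes>\<^bsub>A,K\<^esub> e Bg"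
    "(a \<otimes>\<^bsub>A,K\<^esub> e Bgx) \<cdot>\<^bsub>B\<^esub> (c \<otimes>\<^bsub>A,K\<^esub> e Bgx) = (a \<cdot>\<^bsub>A\<^esub> c \<cdot>\<^bsub>A\<^esub> f (e Bgx) (e Bgx)) \<otimes>\<^bsub>A,K\<^esub> e B1"
  unfolding mult_B_basis[OF assms]
  by (cases i; simp add: eval f_one f_g act_simps assms)+

lemma assoc_B:
  assumes "s \<in> vcarrier T" "t \<in> vcarrier T" "u \<in> vcarrier T"
  shows "s \<cdot>\<^bsub>B\<^esub> (t \<cdot>\<^bsub>B\<^esub> u) = (s \<cdot>\<^bsub>B\<^esub> t) \<cdot>\<^bsub>B\<^esub> u"
  using bialgebraD(10)[OF bialg_B] assms by (simp add: sel_B)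

lemma mult_B_minus:
  assumes "s \<in> vcarrier T" "t \<in> vcarrier T"
  shows "s \<cdot>\<^bsub>B\<^esub> (- t) = - (s \<cdot>\<^bsub>B\<^esub> t)"
  by (rule kbilinear_simps(4)[OF mult_B kspace_tensor_space kspace_tensor_space assms])

lemma tens_basis_cancel:
  assumes "a \<otimes>\<^bsub>A,K\<^esub> e i = b \<otimes>\<^bsub>A,K\<^esub> e i" "a \<in> vcarrier A" "b \<in> vcarrier A"
  shows "a = b"
  using arg_cong[OF assms(1), of "coord i"] assms(2,3) by (simp add: eval)

text \<open>
  As the action is trivial, \<open>X\<close> commutes with \<open>c # 1\<close>; so does \<open>X\<^sup>2 = z # 1\<close>.
\<close>

lemma z_central:
  assumes c: "c \<in> vcarrier A"
  shows "z \<cdot>\<^bsub>A\<^esub> c = c \<cdot>\<^bsub>A\<^esub> z"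
proof -
  have "E Bx \<cdot>\<^bsub>B\<^esub> (E Bx \<cdot>\<^bsub>B\<^esub> (c \<otimes>\<^bsub>A,K\<^esub> e B1)) = (E Bx \<cdot>\<^bsub>B\<^esub> E Bx) \<cdot>\<^bsub>B\<^esub> (c \<otimes>\<^bsub>A,K\<^esub> e B1)"
    by (intro assoc_B pure_in one_A c)
  then have "(c \<cdot>\<^bsub>A\<^esub> z) \<otimes>\<^bsub>A,K\<^esub> e B1 = (z \<cdot>\<^bsub>A\<^esub> c) \<otimes>\<^bsub>A,K\<^esub> e B1"
    by (simp add: mult_pure eval c)
  from tens_basis_cancel[OF this] show ?thesis
    by (simp add: A_in c)
qed

text \<open>
  The remaining values of \<open>f\<close> follow from the associative law for products of \<open>G\<close> and \<open>X\<close>; here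
  \<open>X (X G) = X\<^sup>2 G\<close> with \<open>X G = - G X\<close>.
\<close>

lemma f_x_gx: "f (e Bx) (e Bgx) = - z"
proof -
  have "E Bx \<cdot>\<^bsub>B\<^esub> (E Bx \<cdot>\<^bsub>B\<^esub> E Bg) = (E Bx \<cdot>\<^bsub>B\<^esub> E Bx) \<cdot>\<^bsub>B\<^esub> E Bg"
    by (intro assoc_B pure_in one_A)
  then have "(- f (e Bx) (e Bgx)) \<otimes>\<^bsub>A,K\<^esub> e Bg = z \<otimes>\<^bsub>A,K\<^esub> e Bg"
    by (simp add: mult_pure mult_B_minus eval)
  from tens_basis_cancel[OF this] show ?thesis
    by (simp add: A_in minus_equation_iff[of _ z] eq_commute)
qed

lemma f_gx_x: "f (e Bgx) (e Bx) = z"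
proof -
  have "E Bg \<cdot>\<^bsub>B\<^esub> (E Bx \<cdot>\<^bsub>B\<^esub> E Bx) = (E Bg \<cdot>\<^bsub>B\<^esub> E Bx) \<cdot>\<^bsub>B\<^esub> E Bx"
    by (intro assoc_B pure_in one_A)
  then have "z \<otimes>\<^bsub>A,K\<^esub> e Bg = f (e Bgx) (e Bx) \<otimes>\<^bsub>A,K\<^esub> e Bg"
    by (simp add: mult_pure eval)
  from tens_basis_cancel[OF this] show ?thesis
    by (simp add: A_in)
qed

lemma f_gx_gx: "f (e Bgx) (e Bgx) = - z"
proof -
  have "E Bg \<cdot>\<^bsub>B\<^esub> (E Bx \<cdot>\<^bsub>B\<^esub> E Bgx) = (E Bg \<cdot>\<^bsub>B\<^esub> E Bx) \<cdot>\<^bsub>B\<^esub> E Bgx"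
    by (intro assoc_B pure_in one_A)
  then have "f (e Bx) (e Bgx) \<otimes>\<^bsub>A,K\<^esub> e B1 = f (e Bgx) (e Bgx) \<otimes>\<^bsub>A,K\<^esub> e B1"
    by (simp add: mult_pure eval)
  from tens_basis_cancel[OF this] show ?thesis
    by (simp add: A_in f_x_gx)
qed

lemma f_cocycle: "f h g = h4_cocycle A z h g"
proof (rule kbilinear_H4_eqI[where W = A and F = f and G = "h4_cocycle A z"])
  note bc = kbilinear_h4_cocycle[OF bialg_A f_in[of "e Bx" "e Bx"]]
  note lin = lin_B klinear_bilinear_left[OF bc] klinear_bilinear_right[OF bc]
  show "klinear H4 A (\<lambda>h. f h g)" "klinear H4 A (\<lambda>g. f h g)" for h g
    by (rule lin | assumption)+
  show "klinear H4 A (\<lambda>h. h4_cocycle A z h g)" "klinear H4 A (\<lambda>g. h4_cocycle A z h g)" for h g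
    by (rule lin | assumption)+
  show "f (e i) (e j) = h4_cocycle A z (e i) (e j)" for i j
    unfolding h4_cocycle_basis[OF bialg_A]
    by (cases i; cases j) (simp_all add: f_one f_g f_x_gx f_gx_x f_gx_gx)
qed

lemma comult_to_A:
  assumes t: "t \<in> vcarrier T"
  shows "sweedler B t (\<lambda>t1 t2. to_A t1 \<otimes>\<^bsub>A,A\<^esub> to_A t2) = hcomult A (to_A t)"
proof -
  let ?AA = "tensor_space A A"
  have bil: "kbilinear T T ?AA (\<lambda>t1 t2. to_A t1 \<otimes>\<^bsub>A,A\<^esub> to_A t2)"
    by (rule lin_P | assumption)+
  have lin: "klinear T ?AA (\<lambda>t. sweedler B t (\<lambda>t1 t2. to_A t1 \<otimes>\<^bsub>A,A\<^esub> to_A t2))"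
    "klinear T ?AA (\<lambda>t. hcomult A (to_A t))"
    by (rule lin_P klinear_comp[OF coalgebraD(2)[OF co_A]] | assumption)+
  have pure: "sweedler B (a \<otimes>\<^bsub>A,K\<^esub> h) (\<lambda>t1 t2. to_A t1 \<otimes>\<^bsub>A,A\<^esub> to_A t2) =
      hcomult A (to_A (a \<otimes>\<^bsub>A,K\<^esub> h))" if a: "a \<in> vcarrier A" for a h
  proof -
    have s: "sweedler K h (\<lambda>h1 h2. vscale ?AA (hcounit K h1) (vscale ?AA (hcounit K h2) w)) =
        vscale ?AA (hcounit K h) w" if w: "w \<in> vcarrier ?AA" for w
      by (rule sweedler_counit(1)[OF coalgebra_H4 kspace_tensor_space H4_in, where L = "\<lambda>h. vscale ?AA (hcounit K h) w"])
        (rule lin_P w | assumption)+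
    have "sweedler B (a \<otimes>\<^bsub>A,K\<^esub> h) (\<lambda>t1 t2. to_A t1 \<otimes>\<^bsub>A,A\<^esub> to_A t2) =
        sweedler A a (\<lambda>a1 a2. sweedler K h (\<lambda>h1 h2.
          vscale ?AA (hcounit K h1) (vscale ?AA (hcounit K h2) (a1 \<otimes>\<^bsub>A,A\<^esub> a2))))"
      unfolding sweedler_B[OF kspace_tensor_space a bil]
      by (intro sweedler_cong) (simp add: eval kbilinearD(4,5)[OF kbilinear_tens[of A A]]
          kspace_scale[OF kspace_tensor_space[of A A]] mult.commute)
    also have "\<dots> = sweedler A a (\<lambda>a1 a2. vscale ?AA (hcounit K h) (a1 \<otimes>\<^bsub>A,A\<^esub> a2))"
      by (intro sweedler_cong s tens_closed)
    also have "\<dots> = vscale ?AA (hcounit K h) (hcomult A a)"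
      unfolding sweedler_tens[OF co_A a, symmetric]
      by (rule sweedler_push[OF co_A kspace_tensor_space kspace_tensor_space a kbilinear_tens, symmetric])
        (rule lin_P | assumption)+
    also have "\<dots> = hcomult A (to_A (a \<otimes>\<^bsub>A,K\<^esub> h))"
      by (simp add: eval a klinear_scale[OF coalgebraD(2)[OF co_A]])
    finally show ?thesis .
  qed
  show ?thesis
    by (rule klinear_tensor_eqI[OF k_A kspace_H4 kspace_tensor_space lin pure t])
qed

text \<open>
  In the comultiplication \<open>(X \<otimes> 1 + G \<otimes> X)\<^sup>2\<close> of \<open>X\<^sup>2\<close>, the mixed terms are killed by \<open>id \<otimes> \<epsilon>\<close> in each
  leg, because \<open>f(x, g) = f(g, x) = 0\<close>.
\<close>

lemma z_primitive: "hcomult A z = z \<otimes>\<^bsub>A,A\<^esub> hone A + hone A \<otimes>\<^bsub>A,A\<^esub> z"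
proof -
  let ?F = "\<lambda>t1 t2. to_A t1 \<otimes>\<^bsub>A,A\<^esub> to_A t2"
  have bil: "kbilinear T T (tensor_space A A) ?F"
    by (rule lin_P | assumption)+
  have "hcomult A z = hcomult A (to_A (E Bx \<cdot>\<^bsub>B\<^esub> E Bx))"
    by (simp add: mult_pure eval)
  also have "\<dots> = sweedler B (E Bx \<cdot>\<^bsub>B\<^esub> E Bx) ?F"
    by (rule comult_to_A[symmetric]) (simp add: mult_pure eval)
  also have "\<dots> = (\<Sum>(p, q)\<leftarrow>h4_copairs Bx. \<Sum>(r, s)\<leftarrow>h4_copairs Bx.
      ?F (E p \<cdot>\<^bsub>B\<^esub> E r) (E q \<cdot>\<^bsub>B\<^esub> E s))"
    unfolding sweedler_B_mult[OF kspace_tensor_space bil pure_in[OF one_A] pure_in[OF one_A]]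
    by (rule sweedler_E_mult[OF kspace_tensor_space bil])
  also have "\<dots> = z \<otimes>\<^bsub>A,A\<^esub> hone A + hone A \<otimes>\<^bsub>A,A\<^esub> z"
    by (simp add: mult_pure eval kbilinear_simps[OF kbilinear_tens[of A A] k_A k_A])
  finally show ?thesis .
qed

lemma z_central_primitive: "z \<in> central_primitives A"
  by (auto simp: central_primitives_def f_in z_primitive z_central)

end


section \<open>Classification of crossed systems\<close>

lemma weak_action_trivial:
  assumes A: "bialgebra A" and H: "bialgebra H"
  shows "weak_action A H (trivial_action A H)"
proof -
  note k = bialgebraD(3)[OF A] and co = bialgebraD(2)[OF H]
  have "trivial_action A H h (a \<cdot>\<^bsub>A\<^esub> b) =
      sweedler H h (\<lambda>h1 h2. trivial_action A H h1 a \<cdot>\<^bsub>A\<^esub> trivial_action A H h2 b)"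
    if h: "h \<in> vcarrier H" and a: "a \<in> vcarrier A" and b: "b \<in> vcarrier A" for h a b
  proof -
    have "sweedler H h (\<lambda>h1 h2. trivial_action A H h1 a \<cdot>\<^bsub>A\<^esub> trivial_action A H h2 b) =
        sweedler H h (\<lambda>h1 h2. vscale A (hcounit H h1) (vscale A (hcounit H h2) (a \<cdot>\<^bsub>A\<^esub> b)))"
      by (intro sweedler_cong) (simp add: trivial_action_apply a b kspace_closed[OF k]
          kbilinearD(4,5)[OF bialgebraD(4)[OF A]] kspace_scale[OF k] mult.commute)
    also have "\<dots> = vscale A (hcounit H h) (a \<cdot>\<^bsub>A\<^esub> b)"
      by (rule sweedler_counit(1)[OF co k h, where L = "\<lambda>h. vscale A (hcounit H h) (a \<cdot>\<^bsub>A\<^esub> b)"])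
        (rule slin k co bialgebraD(8)[OF A] a b | assumption)+
    finally show ?thesis
      using h a b by (simp add: trivial_action_apply bialgebraD(8)[OF A])
  qed
  then show ?thesis
    unfolding weak_action_def
    by (simp add: kbilinear_trivial_action[OF k co] trivial_action_apply bialgebraD(5,7)[OF A]
        bialgebraD(5,7)[OF H] kspace_scale[OF k])
qed

lemma h4_cocycle_crossed_system:
  assumes A: "hopf_algebra A" and z: "z \<in> central_primitives A"
  shows "(trivial_action A H4, h4_cocycle A z) \<in> crossed_systems A H4"
proof -
  interpret hopf_central_primitive A z
    by unfold_locales (rule A, rule z)
  have "trivial_action A H4 \<in> vcarrier H4 \<rightarrow>\<^sub>E vcarrier A \<rightarrow>\<^sub>E vcarrier A"
    unfolding trivial_action_def by (auto simp: kspace_closed[OF k_A])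
  moreover have "h4_cocycle A z \<in> vcarrier H4 \<rightarrow>\<^sub>E vcarrier H4 \<rightarrow>\<^sub>E vcarrier A"
    using kbilinearD(1)[OF kbilinear_h4_cocycle[OF bialg_A z_in] H4_in H4_in]
    by (auto simp: PiE_def extensional_def H4_simps)
  ultimately show ?thesis
    unfolding crossed_systems_def
    using weak_action_trivial[OF bialg_A bialgebra_H4] kbilinear_h4_cocycle[OF bialg_A z_in]
      hopf_algebra_B by simp
qed

text \<open>
  Agreement on the carriers is equality, since both components of a crossed system are extensional.
\<close>

lemma crossed_system_H4_cases:
  assumes A: "hopf_algebra A" and p: "(act, f) \<in> crossed_systems A H4"
  obtains z where "z \<in> central_primitives A" "act = trivial_action A H4" "f = h4_cocycle A z"
proof -
  interpret crossed_system_H4 A act f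
    using A p by unfold_locales (auto simp: hopf_algebra_def crossed_systems_def weak_action_def)
  have act_PiE: "act \<in> vcarrier H4 \<rightarrow>\<^sub>E vcarrier A \<rightarrow>\<^sub>E vcarrier A"
    using p by (auto simp: crossed_systems_def)
  have "act h b = trivial_action A H4 h b" for h b
  proof (cases "b \<in> vcarrier A")
    case True
    then show ?thesis by (simp add: act_trivial trivial_action_apply H4_in)
  next
    case False
    moreover have "act h \<in> extensional (vcarrier A)"
      using PiE_mem[OF act_PiE H4_in, of h] by (simp add: PiE_def)
    ultimately show ?thesis
      by (simp add: trivial_action_def H4_in extensional_def)
  qed
  then have "act = trivial_action A H4" by blast
  moreover have "f = h4_cocycle A z" by (intro ext f_cocycle)
  ultimately show thesis
    using that z_central_primitive by blast
qed

lemma h4_cocycle_zero: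
  assumes A: "bialgebra A"
  shows "h4_cocycle A 0 = trivial_cocycle A H4"
proof (intro ext)
  fix s t
  note k = bialgebraD(3)[OF A] and o = bialgebraD(5)[OF A]
  note bc = kbilinear_h4_cocycle[OF A kspace_closed(1)[OF k]]
  note lin = H4_lin klinear_bilinear_left[OF bc] klinear_bilinear_right[OF bc] k o
  have "h4_cocycle A 0 s t = vscale A (hcounit H4 s * hcounit H4 t) (hone A)"
  proof (rule kbilinear_H4_eqI[where W = A and F = "h4_cocycle A 0" and
        G = "\<lambda>s t. vscale A (hcounit H4 s * hcounit H4 t) (hone A)"])
    show "klinear H4 A (\<lambda>s. h4_cocycle A 0 s t)" "klinear H4 A (\<lambda>t. h4_cocycle A 0 s t)" for s t
      by (rule lin | assumption)+
    show "klinear H4 A (\<lambda>s. vscale A (hcounit H4 s * hcounit H4 t) (hone A))"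
      "klinear H4 A (\<lambda>t. vscale A (hcounit H4 s * hcounit H4 t) (hone A))" for s t
      by (rule lin | assumption)+
    show "h4_cocycle A 0 (h4_vec i) (h4_vec j) =
        vscale A (hcounit H4 (h4_vec i) * hcounit H4 (h4_vec j)) (hone A)" for i j
      unfolding h4_cocycle_basis[OF A] hcounit_H4_basis
      by (cases i; cases j) (simp_all add: kspace_scale[OF k])
  qed
  then show "h4_cocycle A 0 s t = trivial_cocycle A H4 s t"
    by (simp add: trivial_cocycle_def H4_in)
qed

lemma tensor_lift2_cong:
  assumes "\<And>a h c g. a \<in> vcarrier U \<Longrightarrow> h \<in> vcarrier V \<Longrightarrow> c \<in> vcarrier U \<Longrightarrow> g \<in> vcarrier V \<Longrightarrow>
    F a h c g = G a h c g"
  shows "tensor_lift2 U V F = tensor_lift2 U V G"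
  unfolding tensor_lift2_def by (intro restrict_ext tensor_lift_cong assms)

text \<open>
  For \<open>z = 0\<close> the defect disappears from \<open>crossed_mult_defect\<close>.
\<close>

lemma crossed_product_trivial:
  fixes A :: "('k::field, 'a::ab_group_add, 'm) hopf_scheme"
  assumes A: "bialgebra A"
  shows "crossed_product A H4 (trivial_action A H4) (trivial_cocycle A H4) = tensor_hopf A H4"
proof -
  note k = bialgebraD(3)[OF A]
  note bi = kbilinear_trivial_action[OF k coalgebra_H4] kbilinear_h4_cocycle[OF A kspace_closed(1)[OF k]]
  have "sweedler3 H4 h (\<lambda>h1 h2 h3. sweedler H4 g (\<lambda>g1 g2.
          (a \<cdot>\<^bsub>A\<^esub> trivial_action A H4 h1 c \<cdot>\<^bsub>A\<^esub> h4_cocycle A 0 h2 g1) \<otimes>\<^bsub>A,H4\<^esub> (h3 \<cdot>\<^bsub>H4\<^esub> g2))) =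
      (a \<cdot>\<^bsub>A\<^esub> c) \<otimes>\<^bsub>A,H4\<^esub> (h \<cdot>\<^bsub>H4\<^esub> g)"
    if a: "a \<in> vcarrier A" and c: "c \<in> vcarrier A" for a h c and g :: "'k h4"
    using crossed_mult_defect[OF A kspace_closed(1)[OF k] a c, of h g]
      crossed_mult_tens[OF A bialgebra_H4 bi a H4_in c H4_in, of h g]
    by (simp add: kbilinear_simps[OF bialgebraD(4)[OF A] k k] bialgebraD(8)[OF A] a c
        kbilinear_simps[OF kbilinear_tens[of A H4] k kspace_H4] H4_in)
  then show ?thesis
    unfolding h4_cocycle_zero[OF A, symmetric] crossed_product_def tensor_hopf_def
    by (simp cong: tensor_lift2_cong)
qed


theorem theorem3p1:
  fixes A :: "('k::field, 'a::ab_group_add) hopf"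
  assumes "CHAR('k) \<noteq> 2"
    and "hopf_algebra A"
  shows "bij_betw (\<lambda>a. (trivial_action A H4, h4_cocycle A a))
           (central_primitives A) (crossed_systems A H4) \<and>
         (central_primitives A = {0} \<longrightarrow>
            crossed_systems A H4 = {(trivial_action A H4, trivial_cocycle A H4)} \<and>
            crossed_products A H4 = {tensor_hopf A H4} \<and>
            is_singleton (H2 H4 A) \<and>
            Crp H4 A = {hopf_iso_rel `` {tensor_hopf A H4}} \<and>
            (\<exists>\<phi>. bij_betw \<phi> (H2 H4 A) (Crp H4 A)))"
proof (intro conjI impI)
  have bialg: "bialgebra A"
    using assms(2) by (simp add: hopf_algebra_def)
  show bij: "bij_betw (\<lambda>a. (trivial_action A H4, h4_cocycle A a))
      (central_primitives A) (crossed_systems A H4)"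
  proof (rule bij_betw_imageI)
    show "inj_on (\<lambda>a. (trivial_action A H4, h4_cocycle A a)) (central_primitives A)"
    proof (rule inj_onI)
      fix a b
      assume "(trivial_action A H4, h4_cocycle A a) = (trivial_action A H4, h4_cocycle A b)"
      then have "h4_cocycle A a (h4_vec Bx) (h4_vec Bx) = h4_cocycle A b (h4_vec Bx) (h4_vec Bx)"
        by simp
      then show "a = b"
        by (simp add: h4_cocycle_basis[OF bialg])
    qed
    show "(\<lambda>a. (trivial_action A H4, h4_cocycle A a)) ` central_primitives A = crossed_systems A H4"
      using h4_cocycle_crossed_system[OF assms(2)]
      by (auto elim!: crossed_system_H4_cases[OF assms(2)])
  qed
  assume "central_primitives A = {0}"
  then show systems: "crossed_systems A H4 = {(trivial_action A H4, trivial_cocycle A H4)}"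
    using bij_betw_imp_surj_on[OF bij] by (simp add: h4_cocycle_zero[OF bialg])
  show products: "crossed_products A H4 = {tensor_hopf A H4}"
    by (simp add: crossed_products_def systems crossed_product_trivial[OF bialg])
  show H2: "is_singleton (H2 H4 A)"
    by (simp add: H2_def systems quotient_def is_singleton_def)
  show Crp: "Crp H4 A = {hopf_iso_rel `` {tensor_hopf A H4}}"
    by (simp add: Crp_def products quotient_def)
  obtain c where "H2 H4 A = {c}"
    using H2 by (auto simp: is_singleton_def)
  then show "\<exists>\<phi>. bij_betw \<phi> (H2 H4 A) (Crp H4 A)"
    unfolding Crp by (intro exI[of _ "\<lambda>_. hopf_iso_rel `` {tensor_hopf A H4}"]) (simp add: bij_betw_def)
qed

end
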